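(* Let $(Z_i)$ be i.i.d. $\mathbb R^d$-valued random variables with $Z_1$ satisfying (A1) (with good rate function $I$ for $Z_1/n$, not necessarily convex). Let $\mathbf f:\mathcal X\to\mathbb R^{m\times d}$ be continuous and let $(x_i^n,1\le i\le n,n\ge1)\subset\mathcal X$ satisfy (A5) and (A6). Then $L_n=\frac1n\sum_{i=1}^n\mathbf f(x_i^n)\cdot Z_i$ satisfies the LDP in $\mathbb R^m$ with good rate function $$I_{\mathbf f}(z)=\inf\Big\{\Gamma^*(z_0)+\sum_{\ell=1}^TI(y_\ell):\ z_0+\sum_{\ell=1}^T\mathbf f(x^\infty_\ell)\cdot y_\ell=z\Big\}.$$
   Context: (A1): $\mathbb E\,e^{\alpha|Z_1|}<\infty$ for some $\alpha>0$ and $Z_1/n$ satisfies the LDP with a good rate function $I$. (A5): $(\mathcal X,\rho)$ is a locally compact metric space, $\frac1n\sum_i\delta_{x_i^n}\to R$ weakly with $R$ a Borel probability measure whose support $\mathcal Y$ is compact, and $R(U)>0$ for every nonempty relatively open $U\subset\mathcal Y$. (A6): $\mathcal X\subset\mathbb R^p$ for some $p$, and there is an integer $T$ such that $\{x_i^n:1\le i\le n\}=\tilde A_n\cup\{x^n_{i_1},\dots,x^n_{i_T}\}$ where $\sup_{x\in\tilde A_n}\rho(x,\mathcal Y)\to0$ and, for each $\ell$, $x^n_{i_\ell}\to x^\infty_\ell$ with $x^\infty_\ell\notin\mathcal Y$. $\Lambda(\theta)=\log\mathbb E e^{\langle\theta,Z_1\rangle}$, $\Gamma(\lambda)=\int\Lambda(\sum_{k=1}^m\lambda_kf_k(x))R(dx)$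 with $f_k$ the rows of $\mathbf f$, and $\Gamma^*$ its convex conjugate. *)

theory Defs
  imports "HOL-Probability.Probability"
begin

definition eln :: "real \<Rightarrow> ereal" where
  "eln p = (if p \<le> 0 then -\<infinity> else ereal (ln p))"

definition good_rate_function :: "('b::topological_space \<Rightarrow> ereal) \<Rightarrow> bool" where
  "good_rate_function J \<longleftrightarrow> (\<forall>x. 0 \<le> J x) \<and>
     (\<forall>c::real. closed {x. J x \<le> ereal c} \<and> compact {x. J x \<le> ereal c})"

definition satisfies_LDP ::
  "'a measure \<Rightarrow> (nat \<Rightarrow> 'a \<Rightarrow> 'b::topological_space) \<Rightarrow> ('b \<Rightarrow> ereal) \<Rightarrow> bool" where
  "satisfies_LDP M X J \<longleftrightarrow> good_rate_function J \<and>
     (\<forall>F. closed F \<longrightarrow>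
        limsup (\<lambda>n. ereal (1 / real n) * eln (measure M {\<omega> \<in> space M. X n \<omega> \<in> F}))
          \<le> - (INF x\<in>F. J x)) \<and>
     (\<forall>G. open G \<longrightarrow>
        - (INF x\<in>G. J x)
          \<le> liminf (\<lambda>n. ereal (1 / real n) * eln (measure M {\<omega> \<in> space M. X n \<omega> \<in> G})))"

definition log_mgf :: "'a measure \<Rightarrow> ('a \<Rightarrow> 'v::real_inner) \<Rightarrow> 'v \<Rightarrow> ereal" where
  "log_mgf M Y \<theta> =
     (let E = (\<integral>\<^sup>+\<omega>. ennreal (exp (\<theta> \<bullet> Y \<omega>)) \<partial>M)
      in if E = \<infinity> then \<infinity> else eln (enn2real E))"

definition ext_integral :: "'x measure \<Rightarrow> ('x \<Rightarrow> ereal) \<Rightarrow> ereal" where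
  "ext_integral R g =
     enn2ereal (\<integral>\<^sup>+x. e2ennreal (g x) \<partial>R) - enn2ereal (\<integral>\<^sup>+x. e2ennreal (- g x) \<partial>R)"

definition Gamma_fun ::
  "'a measure \<Rightarrow> ('a \<Rightarrow> real^'d) \<Rightarrow> 'x measure \<Rightarrow> ('x \<Rightarrow> real^'d^'m) \<Rightarrow> real^'m \<Rightarrow> ereal" where
  "Gamma_fun M Z1 R f lam =
     ext_integral R (\<lambda>x. log_mgf M Z1 (\<Sum>k\<in>UNIV. (lam $ k) *\<^sub>R (f x $ k)))"

definition convex_conjugate :: "('v::real_inner \<Rightarrow> ereal) \<Rightarrow> 'v \<Rightarrow> ereal" where
  "convex_conjugate G z = (SUP lam. ereal (lam \<bullet> z) - G lam)"

definition measure_support :: "'x::metric_space measure \<Rightarrow> 'x set" where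
  "measure_support R = {x \<in> space R. \<forall>e>0. measure R (ball x e \<inter> space R) > 0}"

end

theory Submission
  imports Defs
begin

text \<open>
  The bulk part of \<open>L\<^sub>n\<close> (all points except the \<open>T\<close> outliers) satisfies the LDP with rate \<open>\<Gamma>\<^sup>*\<close>. For the
  upper bound, if \<open>\<Gamma>(\<lambda>) < \<infinity>\<close> then \<open>\<Lambda>\<close> is continuous at all the points \<open>t \<lambda> f(y)\<close> with \<open>y\<close> in the support
  and \<open>t < 1\<close>, so Chernoff's bound applies at \<open>t \<lambda>\<close>, and \<open>\<Gamma>(t \<lambda>) \<le> t \<Gamma>(\<lambda>)\<close> by convexity. For the lower bound,
  \<open>\<Gamma>\<close> need not be steep, so \<open>Z\<close> is truncated at level \<open>k\<close>. The truncated function \<open>\<Gamma>\<^sub>k\<close> is finite and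
  semiconcave, and at a minimiser of \<open>\<Gamma>\<^sub>k(\<lambda>) - \<langle>\<lambda>, z\<rangle> + 2\<epsilon>|\<lambda>|\<^sup>2\<close> this already suffices for exponential tilting;
  \<open>\<Gamma>\<^sub>k\<close> increases to \<open>\<Gamma>\<close>, and compactness of superlevel sets of the penalised functions gives the
  right rate in the limit \<open>k \<rightarrow> \<infinity>\<close>, \<open>\<epsilon> \<rightarrow> 0\<close>. The outliers are independent of the bulk and are added one at a
  time by a contraction principle for maps that converge continuously.
\<close>

section \<open>Large deviations in local form\<close>

text \<open>Moment generating functions cannot handle \<open>L_n\<close> as a whole: an outlier
  contributes the rate \<open>I\<close>, which need not be convex, while every rate obtained as a
  conjugate is. They are therefore used for the bulk only. Two obstacles shape the upper bound for
  the bulk. \<Gamma>(\<lambda>) < \<infinity> makes \<Lambda> finite only R-almost everywhere, and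
  the bulk points merely approach the support, so even finiteness on all of it would say nothing
  about the summands. But relatively open sets meeting the support have positive measure, so
  \<open>\<lambda> v* f y\<close> lies in the closure of the domain of \<Lambda> for every y in the
  support. A factor t < 1 moves it into the interior, and this persists on a neighbourhood of the
  support. In the lower bound, truncation restricts expectations to the event that all bulk
  variables have norm at most the truncation level, which can only lose probability. No tilted
  measure is constructed: semiconcavity enters through an inequality between truncated exponential
  moments at l and at finitely many points \<open>l + \<sigma> v\<close>, so that only limits of
  averages of truncated cumulants are needed.\<close>

lemma eln_scaled_le_iff:
  assumes "n > 0" "0 \<le> p"
  shows "ereal (1 / real n) * eln p \<le> ereal a \<longleftrightarrow> p \<le> exp (real n * a)"
proof (cases "p = 0")
  case False
  with assms have "p > 0" by simp
  then have "p \<le> exp (real n * a) \<longleftrightarrow> ln p \<le> real n * a"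
    using ln_ge_iff[of p] by (metis exp_le_cancel_iff exp_ln)
  with \<open>p > 0\<close> assms show ?thesis by (simp add: eln_def field_simps)
qed (use assms in \<open>simp add: eln_def\<close>)

lemma eln_scaled_ge_iff:
  assumes "n > 0" "0 \<le> p"
  shows "ereal a \<le> ereal (1 / real n) * eln p \<longleftrightarrow> exp (real n * a) \<le> p"
proof (cases "p = 0")
  case False
  with assms have "p > 0" by simp
  then have "exp (real n * a) \<le> p \<longleftrightarrow> real n * a \<le> ln p"
    by (rule ln_ge_iff[symmetric])
  with \<open>p > 0\<close> assms show ?thesis by (simp add: eln_def field_simps)
qed (use assms in \<open>simp add: eln_def\<close>)

lemma ereal_real_between:
  fixes a b :: ereal
  assumes "a < b"
  obtains r :: real where "a < ereal r" "ereal r < b"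
  using ereal_dense2[OF assms] by blast

text \<open>Replaces a bound on normalised logarithms by eventual exponential bounds with real
  rates, so that later estimates stay within the reals. Quantifying over real c strictly below S
  covers S = \<infinity> as well. The index 0 is discarded in the proof because
  \<open>1 / real 0\<close> is 0.\<close>

lemma limsup_eln_le_iff:
  assumes p: "\<And>n. 0 \<le> p n"
  shows "limsup (\<lambda>n. ereal (1 / real n) * eln (p n)) \<le> - S \<longleftrightarrow>
    (\<forall>c::real. ereal c < S \<longrightarrow> (\<forall>\<^sub>F n in sequentially. p n \<le> exp (- (real n * c))))"
proof (intro iffI allI impI)
  fix c :: real
  assume L: "limsup (\<lambda>n. ereal (1 / real n) * eln (p n)) \<le> - S" and c: "ereal c < S"
  have "- S < ereal (- c)" using c by (metis ereal_minus_less_minus uminus_ereal.simps(1))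
  with L have "\<forall>\<^sub>F n in sequentially. ereal (1 / real n) * eln (p n) < ereal (- c)"
    unfolding Limsup_le_iff by blast
  with eventually_gt_at_top[of 0]
  show "\<forall>\<^sub>F n in sequentially. p n \<le> exp (- (real n * c))"
  proof eventually_elim
    case (elim n)
    then show ?case using eln_scaled_le_iff[of n "p n" "- c"] p[of n] less_imp_le[OF elim(2)] by simp
  qed
next
  assume R: "\<forall>c::real. ereal c < S \<longrightarrow> (\<forall>\<^sub>F n in sequentially. p n \<le> exp (- (real n * c)))"
  show "limsup (\<lambda>n. ereal (1 / real n) * eln (p n)) \<le> - S"
    unfolding Limsup_le_iff
  proof (intro allI impI)
    fix y assume "- S < y"
    then obtain r where r: "- S < ereal r" "ereal r < y" by (rule ereal_real_between)
    then have "ereal (- r) < S" by (metis ereal_minus_less_minus ereal_uminus_uminus uminus_ereal.simps(1))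
    with R have "\<forall>\<^sub>F n in sequentially. p n \<le> exp (- (real n * - r))" by blast
    with eventually_gt_at_top[of 0]
    show "\<forall>\<^sub>F n in sequentially. ereal (1 / real n) * eln (p n) < y"
    proof eventually_elim
      case (elim n)
      then have "ereal (1 / real n) * eln (p n) \<le> ereal r" using p by (subst eln_scaled_le_iff) auto
      with r show ?case by order
    qed
  qed
qed

lemma le_liminf_eln_iff:
  assumes p: "\<And>n. 0 \<le> p n"
  shows "- S \<le> liminf (\<lambda>n. ereal (1 / real n) * eln (p n)) \<longleftrightarrow>
    (\<forall>c::real. S < ereal c \<longrightarrow> (\<forall>\<^sub>F n in sequentially. exp (- (real n * c)) \<le> p n))"
proof (intro iffI allI impI)
  fix c :: real
  assume L: "- S \<le> liminf (\<lambda>n. ereal (1 / real n) * eln (p n))" and c: "S < ereal c"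
  have "ereal (- c) < - S" using c by (metis ereal_minus_less_minus uminus_ereal.simps(1))
  with L have "\<forall>\<^sub>F n in sequentially. ereal (- c) < ereal (1 / real n) * eln (p n)"
    unfolding le_Liminf_iff by blast
  with eventually_gt_at_top[of 0]
  show "\<forall>\<^sub>F n in sequentially. exp (- (real n * c)) \<le> p n"
  proof eventually_elim
    case (elim n)
    then show ?case using eln_scaled_ge_iff[of n "p n" "- c"] p[of n] less_imp_le[OF elim(2)] by simp
  qed
next
  assume R: "\<forall>c::real. S < ereal c \<longrightarrow> (\<forall>\<^sub>F n in sequentially. exp (- (real n * c)) \<le> p n)"
  show "- S \<le> liminf (\<lambda>n. ereal (1 / real n) * eln (p n))"
    unfolding le_Liminf_iff
  proof (intro allI impI)
    fix y assume "y < - S"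
    then obtain r where r: "y < ereal r" "ereal r < - S" by (rule ereal_real_between)
    then have "S < ereal (- r)" by (metis ereal_minus_less_minus ereal_uminus_uminus uminus_ereal.simps(1))
    with R have "\<forall>\<^sub>F n in sequentially. exp (- (real n * - r)) \<le> p n" by blast
    with eventually_gt_at_top[of 0]
    show "\<forall>\<^sub>F n in sequentially. y < ereal (1 / real n) * eln (p n)"
    proof eventually_elim
      case (elim n)
      then have "ereal r \<le> ereal (1 / real n) * eln (p n)" using p by (subst eln_scaled_ge_iff) auto
      with r show ?case by order
    qed
  qed
qed

lemma ereal_add_less_split:
  fixes a b :: ereal
  assumes "a + b < ereal c" "0 \<le> a" "0 \<le> b"
  obtains r s where "a < ereal r" "b < ereal s" "r + s \<le> c"
proof -
  obtain x y where xy: "a = ereal x" "b = ereal y" using assms by (cases a; cases b) auto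
  with assms have "x + y < c" by simp
  then show thesis using that[of "x + (c - x - y)/2" "y + (c - x - y)/2"] xy by (simp add: field_simps)
qed

lemma ereal_less_add_split:
  fixes a b :: ereal
  assumes "ereal c < a + b" "0 \<le> a" "0 \<le> b"
  obtains r s where "ereal r < a" "ereal s < b" "c \<le> r + s"
proof (cases a)
  case (real x)
  show thesis
  proof (cases b)
    case (real y)
    with \<open>a = ereal x\<close> assms have "c < x + y" by simp
    then show thesis using that[of "x - (x + y - c)/2" "y - (x + y - c)/2"] \<open>a = ereal x\<close> real
      by (simp add: field_simps)
  next
    case PInf
    then show thesis using that[of "x - 1" "c - (x - 1)"] real by simp
  qed (use assms in auto)
next
  case PInf
  \<comment> \<open>As b may be 0, the real number below it has to be negative; the infinite a
    compensates with c + 1.\<close>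
  have "ereal (-1) < b" using assms(3) by (cases b) auto
  with PInf show thesis using that[of "c + 1" "-1"] by simp
qed (use assms in auto)

text \<open>In finite dimension this is equivalent to \<^const>\<open>satisfies_LDP\<close>, but it is easier to transport through
  products and continuous images. Measurability is only required eventually: the outlier indices may
  lie outside \<open>{1..n}\<close> for small \<open>n\<close>, and \<open>Z 0\<close> need not be measurable.\<close>

definition local_LDP ::
  "'a measure \<Rightarrow> (nat \<Rightarrow> 'a \<Rightarrow> 'b::euclidean_space) \<Rightarrow> ('b \<Rightarrow> ereal) \<Rightarrow> bool" where
  "local_LDP M X J \<longleftrightarrow> good_rate_function J \<and>
     (\<forall>\<^sub>F n in sequentially. X n \<in> borel_measurable M) \<and>
     (\<forall>x c e. J x < ereal c \<longrightarrow> 0 < e \<longrightarrow>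
        (\<forall>\<^sub>F n in sequentially. exp (- (real n * c)) \<le> measure M {\<omega>\<in>space M. X n \<omega> \<in> ball x e})) \<and>
     (\<forall>x c. ereal c < J x \<longrightarrow>
        (\<exists>e>0. \<forall>\<^sub>F n in sequentially. measure M {\<omega>\<in>space M. X n \<omega> \<in> cball x e} \<le> exp (- (real n * c)))) \<and>
     (\<forall>c. \<exists>r. \<forall>\<^sub>F n in sequentially. measure M {\<omega>\<in>space M. r < norm (X n \<omega>)} \<le> exp (- (real n * c)))"

lemma local_LDPD:
  assumes "local_LDP M X J"
  shows local_LDP_good: "good_rate_function J"
    and local_LDP_measurable: "\<forall>\<^sub>F n in sequentially. X n \<in> borel_measurable M"
    and local_LDP_lower: "J x < ereal c \<Longrightarrow> 0 < e \<Longrightarrow>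
      \<forall>\<^sub>F n in sequentially. exp (- (real n * c)) \<le> measure M {\<omega>\<in>space M. X n \<omega> \<in> ball x e}"
    and local_LDP_upper: "ereal c < J x \<Longrightarrow>
      \<exists>e>0. \<forall>\<^sub>F n in sequentially. measure M {\<omega>\<in>space M. X n \<omega> \<in> cball x e} \<le> exp (- (real n * c))"
    and local_LDP_tight:
      "\<exists>r. \<forall>\<^sub>F n in sequentially. measure M {\<omega>\<in>space M. r < norm (X n \<omega>)} \<le> exp (- (real n * c))"
  using assms by (auto simp: local_LDP_def)

lemma good_rate_functionD:
  assumes "good_rate_function J"
  shows "0 \<le> J x" "closed {x. J x \<le> ereal c}" "compact {x. J x \<le> ereal c}"
  using assms by (auto simp: good_rate_function_def)

text \<open>Lower semicontinuity of J in the form used later; it comes from closedness of the level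
  sets.\<close>

lemma good_rate_function_eventually_gt:
  fixes J :: "'b::metric_space \<Rightarrow> ereal"
  assumes "good_rate_function J" "ereal c < J x"
  obtains e where "0 < e" "\<And>y. y \<in> cball x e \<Longrightarrow> ereal c < J y"
proof -
  have "open (- {x. J x \<le> ereal c})"
    using good_rate_functionD(2)[OF assms(1)] by (simp add: open_Compl)
  moreover have "x \<in> - {x. J x \<le> ereal c}" using assms by simp
  ultimately obtain e where "0 < e" "cball x e \<subseteq> - {x. J x \<le> ereal c}"
    by (meson open_contains_cball)
  then have "\<And>y. y \<in> cball x e \<Longrightarrow> ereal c < J y" by (metis ComplD mem_Collect_eq not_le subsetD)
  with \<open>0 < e\<close> show thesis by (rule that)
qed

text \<open>A constant prefactor is absorbed by an arbitrarily small loss in the rate, since powers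
  of exp (c - c') tend to 0.\<close>

lemma eventually_const_mult_exp_le:
  fixes c c' :: real
  assumes "c < c'"
  shows "\<forall>\<^sub>F n in sequentially. B * exp (- (real n * c')) \<le> exp (- (real n * c))"
proof -
  have "((\<lambda>n. B * exp (- (real n * (c' - c)))) \<longlongrightarrow> 0) sequentially"
  proof -
    have "(\<lambda>n. exp (- (c' - c)) ^ n) \<longlonglongrightarrow> 0"
      using assms by (intro LIMSEQ_power_zero) simp
    then have "(\<lambda>n. B * exp (- (c' - c)) ^ n) \<longlonglongrightarrow> 0"
      by (rule tendsto_mult_right_zero)
    then show ?thesis by (simp add: algebra_simps flip: exp_of_nat_mult)
  qed
  then have "\<forall>\<^sub>F n in sequentially. B * exp (- (real n * (c' - c))) < 1"
    by (rule order_tendstoD) simp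
  then show ?thesis
  proof eventually_elim
    case (elim n)
    then have "B * exp (- (real n * (c' - c))) * exp (- (real n * c)) \<le> 1 * exp (- (real n * c))"
      by (intro mult_right_mono) auto
    then show ?case by (simp add: algebra_simps flip: exp_add)
  qed
qed

text \<open>Principle of the largest term: in a finite union bound the number of sets is a constant
  prefactor and costs only the slack between c and c'.\<close>

lemma (in prob_space) eventually_prob_finite_cover_le:
  assumes "finite A" "c < c'"
    and meas: "\<forall>\<^sub>F n in sequentially. \<forall>a\<in>A. E a n \<in> events"
    and cover: "\<forall>\<^sub>F n in sequentially. S n \<subseteq> (\<Union>a\<in>A. E a n)"
    and bound: "\<And>a. a \<in> A \<Longrightarrow> \<forall>\<^sub>F n in sequentially. prob (E a n) \<le> exp (- (real n * c'))"
  shows "\<forall>\<^sub>F n in sequentially. prob (S n) \<le> exp (- (real n * c))"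
proof -
  have "\<forall>\<^sub>F n in sequentially. \<forall>a\<in>A. prob (E a n) \<le> exp (- (real n * c'))"
    using assms by (intro eventually_ball_finite) auto
  with meas cover eventually_const_mult_exp_le[OF \<open>c < c'\<close>, of "real (card A)"]
  show ?thesis
  proof eventually_elim
    case (elim n)
    have "prob (S n) \<le> prob (\<Union>a\<in>A. E a n)"
      using elim \<open>finite A\<close> by (intro finite_measure_mono) auto
    also have "\<dots> \<le> (\<Sum>a\<in>A. prob (E a n))"
      using elim \<open>finite A\<close> by (intro finite_measure_subadditive_finite) auto
    also have "\<dots> \<le> real (card A) * exp (- (real n * c'))"
      using elim by (intro sum_bounded_above) auto
    finally show ?case using elim by linarith
  qed
qed

text \<open>The local upper bound combines the closed-set bound with lower semicontinuity of J. The
  tail bound comes from compactness of a single level set, outside of which J exceeds c + 1.\<close>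

lemma (in prob_space) satisfies_LDP_imp_local_LDP:
  fixes X :: "nat \<Rightarrow> 'a \<Rightarrow> 'b::euclidean_space"
  assumes L: "satisfies_LDP M X J" and X: "\<forall>\<^sub>F n in sequentially. X n \<in> borel_measurable M"
  shows "local_LDP M X J"
proof -
  have good: "good_rate_function J" using L by (simp add: satisfies_LDP_def)
  have up: "\<forall>\<^sub>F n in sequentially. prob {\<omega>\<in>space M. X n \<omega> \<in> F} \<le> exp (- (real n * c))"
    if "closed F" "ereal c < (INF x\<in>F. J x)" for F c
  proof -
    have "limsup (\<lambda>n. ereal (1 / real n) * eln (prob {\<omega>\<in>space M. X n \<omega> \<in> F})) \<le> - (INF x\<in>F. J x)"
      using L that unfolding satisfies_LDP_def by blast
    with that show ?thesis by (simp add: limsup_eln_le_iff)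
  qed
  have lo: "\<forall>\<^sub>F n in sequentially. exp (- (real n * c)) \<le> prob {\<omega>\<in>space M. X n \<omega> \<in> G}"
    if "open G" "(INF x\<in>G. J x) < ereal c" for G c
  proof -
    have "- (INF x\<in>G. J x) \<le> liminf (\<lambda>n. ereal (1 / real n) * eln (prob {\<omega>\<in>space M. X n \<omega> \<in> G}))"
      using L that unfolding satisfies_LDP_def by blast
    with that show ?thesis by (simp add: le_liminf_eln_iff)
  qed
  have "\<forall>\<^sub>F n in sequentially. exp (- (real n * c)) \<le> prob {\<omega>\<in>space M. X n \<omega> \<in> ball x e}"
    if "J x < ereal c" "0 < e" for x c e
    using that by (intro lo) (auto simp: INF_less_iff)
  moreover have "\<exists>e>0. \<forall>\<^sub>F n in sequentially. prob {\<omega>\<in>space M. X n \<omega> \<in> cball x e} \<le> exp (- (real n * c))"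
    if c: "ereal c < J x" for x c
  proof -
    obtain c' where c': "ereal c < ereal c'" "ereal c' < J x" using c by (rule ereal_real_between)
    obtain e where e: "0 < e" "\<And>y. y \<in> cball x e \<Longrightarrow> ereal c' < J y"
      using good_rate_function_eventually_gt[OF good c'(2)] by blast
    have "ereal c' \<le> (INF y\<in>cball x e. J y)" using e(2) by (intro INF_greatest) (simp add: less_imp_le)
    with c' have "ereal c < (INF y\<in>cball x e. J y)" by order
    then show ?thesis using e up[of "cball x e" c] by auto
  qed
  moreover have "\<exists>r. \<forall>\<^sub>F n in sequentially. prob {\<omega>\<in>space M. r < norm (X n \<omega>)} \<le> exp (- (real n * c))" for c
  proof -
    obtain r where r: "\<And>y. J y \<le> ereal (c + 1) \<Longrightarrow> norm y \<le> r"
      using compact_imp_bounded[OF good_rate_functionD(3)[OF good, of "c+1"]]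
      by (auto simp: bounded_iff)
    \<comment> \<open>The upper bound of the LDP needs a closed set. Enlarging the radius by 1 gives
      one that misses the level set, whose points have norm at most r.\<close>
    have cl: "closed {y::'b. r + 1 \<le> norm y}" by (intro closed_Collect_le continuous_intros)
    have "ereal (c + 1) \<le> J y" if "r + 1 \<le> norm y" for y
      using r[of y] that by (cases "J y \<le> ereal (c+1)") auto
    then have "ereal (c + 1) \<le> (INF y\<in>{y. r + 1 \<le> norm y}. J y)" by (intro INF_greatest) simp
    moreover have "ereal c < ereal (c + 1)" by simp
    ultimately have "ereal c < (INF y\<in>{y. r + 1 \<le> norm y}. J y)" by order
    from up[OF cl this] X
    have "\<forall>\<^sub>F n in sequentially. prob {\<omega>\<in>space M. r + 1 < norm (X n \<omega>)} \<le> exp (- (real n * c))"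
    proof eventually_elim
      case (elim n)
      note [measurable] = elim(2)
      have "prob {\<omega>\<in>space M. r + 1 < norm (X n \<omega>)} \<le> prob {\<omega>\<in>space M. X n \<omega> \<in> {y. r + 1 \<le> norm y}}"
        by (intro finite_measure_mono) auto
      then show ?case using elim by linarith
    qed
    then show ?thesis by blast
  qed
  ultimately show ?thesis unfolding local_LDP_def using good X by blast
qed

text \<open>Exponential tightness reduces a closed set to its part in a large ball. That part is
  compact, and finitely many of the small balls from the local upper bound cover it.\<close>

lemma (in prob_space) local_LDP_imp_satisfies_LDP:
  fixes X :: "nat \<Rightarrow> 'a \<Rightarrow> 'b::euclidean_space"
  assumes L: "local_LDP M X J"
  shows "satisfies_LDP M X J"
proof -
  have X: "\<forall>\<^sub>F n in sequentially. X n \<in> borel_measurable M"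
    using L by (simp add: local_LDP_def)
  have "\<forall>\<^sub>F n in sequentially. exp (- (real n * c)) \<le> prob {\<omega>\<in>space M. X n \<omega> \<in> G}"
    if G: "open G" "(INF x\<in>G. J x) < ereal c" for G c
  proof -
    obtain x where x: "x \<in> G" "J x < ereal c" using G by (auto simp: INF_less_iff)
    obtain e where e: "0 < e" "ball x e \<subseteq> G" using G x by (meson open_contains_ball)
    have "\<forall>\<^sub>F n in sequentially. exp (- (real n * c)) \<le> prob {\<omega>\<in>space M. X n \<omega> \<in> ball x e}"
      using L x e unfolding local_LDP_def by blast
    with X show ?thesis
    proof eventually_elim
      case (elim n)
      note [measurable] = elim(1)
      have "G \<in> sets borel" using G by simp
      then have "prob {\<omega>\<in>space M. X n \<omega> \<in> ball x e} \<le> prob {\<omega>\<in>space M. X n \<omega> \<in> G}"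
        using e by (intro finite_measure_mono) auto
      then show ?case using elim by linarith
    qed
  qed
  moreover have "\<forall>\<^sub>F n in sequentially. prob {\<omega>\<in>space M. X n \<omega> \<in> F} \<le> exp (- (real n * c))"
    if F: "closed F" "ereal c < (INF x\<in>F. J x)" for F c
  proof -
    obtain c' where c': "ereal c < ereal c'" "ereal c' < (INF x\<in>F. J x)"
      using F(2) by (rule ereal_real_between)
    obtain r where r: "\<forall>\<^sub>F n in sequentially. prob {\<omega>\<in>space M. r < norm (X n \<omega>)} \<le> exp (- (real n * c'))"
      using L unfolding local_LDP_def by blast
    have "\<forall>x\<in>F. \<exists>e. 0 < e \<and> (\<forall>\<^sub>F n in sequentially. prob {\<omega>\<in>space M. X n \<omega> \<in> cball x e} \<le> exp (- (real n * c')))"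
    proof
      fix x assume that: "x \<in> F"
      have "ereal c' < J x" using c'(2) that by (meson INF_lower less_le_trans)
      then show "\<exists>e. 0 < e \<and> (\<forall>\<^sub>F n in sequentially. prob {\<omega>\<in>space M. X n \<omega> \<in> cball x e} \<le> exp (- (real n * c')))"
        using local_LDP_upper[OF L] by auto
    qed
    from bchoice[OF this] obtain e where e: "\<And>x. x \<in> F \<Longrightarrow> 0 < e x"
      "\<And>x. x \<in> F \<Longrightarrow> \<forall>\<^sub>F n in sequentially. prob {\<omega>\<in>space M. X n \<omega> \<in> cball x (e x)} \<le> exp (- (real n * c'))"
      by blast
    have "compact (F \<inter> cball 0 r)" using F by (simp add: closed_Int_compact)
    then obtain A where A: "A \<subseteq> F" "finite A" "F \<inter> cball 0 r \<subseteq> (\<Union>x\<in>A. ball x (e x))"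
      by (rule compactE_image[of _ F "\<lambda>x. ball x (e x)"]) (use e in force)+
    \<comment> \<open>The option type indexes the cover: \<open>None\<close> is the tail event and
      \<open>Some x\<close> the event near the centre x.\<close>
    define E where "E a n = (case a of None \<Rightarrow> {\<omega>\<in>space M. r < norm (X n \<omega>)}
      | Some x \<Rightarrow> {\<omega>\<in>space M. X n \<omega> \<in> cball x (e x)})" for a n
    show ?thesis
    proof (rule eventually_prob_finite_cover_le[of "insert None (Some ` A)" c c' E])
      show "\<forall>\<^sub>F n in sequentially. \<forall>a\<in>insert None (Some ` A). E a n \<in> events"
        using X by eventually_elim (auto simp: E_def)
      show "\<forall>\<^sub>F n in sequentially. {\<omega>\<in>space M. X n \<omega> \<in> F} \<subseteq> (\<Union>a\<in>insert None (Some ` A). E a n)"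
      proof (intro always_eventually allI subsetI)
        fix n \<omega> assume w: "\<omega> \<in> {\<omega>\<in>space M. X n \<omega> \<in> F}"
        show "\<omega> \<in> (\<Union>a\<in>insert None (Some ` A). E a n)"
        proof (cases "r < norm (X n \<omega>)")
          case False
          with w A obtain x where "x \<in> A" "X n \<omega> \<in> ball x (e x)" by fastforce
          with w show ?thesis by (auto simp: E_def intro!: less_imp_le)
        qed (use w in \<open>auto simp: E_def\<close>)
      qed
    qed (use A c' r e in \<open>auto simp: E_def\<close>)
  qed
  ultimately show ?thesis
    using L unfolding satisfies_LDP_def
    by (auto simp: limsup_eln_le_iff le_liminf_eln_iff local_LDP_def)
qed

text \<open>Only the laws for large n matter. This lets \<open>Z 1\<close> stand in for an outlier
  variable whose index changes with n, and identifies random variables that agree from some n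
  on.\<close>

lemma local_LDP_cong:
  assumes "local_LDP M X J"
    and ev: "\<forall>\<^sub>F n in sequentially. Y n \<in> borel_measurable M \<and>
      (\<forall>B\<in>sets borel. measure M {\<omega>\<in>space M. Y n \<omega> \<in> B} = measure M {\<omega>\<in>space M. X n \<omega> \<in> B})"
  shows "local_LDP M Y J"
proof -
  have *: "\<forall>\<^sub>F n in sequentially. Y n \<in> borel_measurable M"
    using ev by eventually_elim simp
  have ball: "\<forall>\<^sub>F n in sequentially. measure M {\<omega>\<in>space M. Y n \<omega> \<in> ball x e} = measure M {\<omega>\<in>space M. X n \<omega> \<in> ball x e}" for x e
    using ev by eventually_elim (use borel_open[OF open_ball] in blast)
  have cball: "\<forall>\<^sub>F n in sequentially. measure M {\<omega>\<in>space M. Y n \<omega> \<in> cball x e} = measure M {\<omega>\<in>space M. X n \<omega> \<in> cball x e}" for x e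
    using ev by eventually_elim (use borel_closed[OF closed_cball] in blast)
  have norm: "\<forall>\<^sub>F n in sequentially. measure M {\<omega>\<in>space M. r < norm (Y n \<omega>)} = measure M {\<omega>\<in>space M. r < norm (X n \<omega>)}" for r
    using ev
  proof eventually_elim
    case (elim n)
    have "{y::'b. r < norm y} \<in> sets borel" by measurable
    with elim have "measure M {\<omega>\<in>space M. Y n \<omega> \<in> {y. r < norm y}} = measure M {\<omega>\<in>space M. X n \<omega> \<in> {y. r < norm y}}"
      by blast
    then show ?case by simp
  qed
  have 1: "\<forall>\<^sub>F n in sequentially. exp (- (real n * c)) \<le> measure M {\<omega>\<in>space M. Y n \<omega> \<in> ball x e}"
    if "J x < ereal c" "0 < e" for x c e
  proof -
    have "\<forall>\<^sub>F n in sequentially. exp (- (real n * c)) \<le> measure M {\<omega>\<in>space M. X n \<omega> \<in> ball x e}"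
      using local_LDP_lower[OF assms(1)] that by blast
    with ball[of x e] show ?thesis by eventually_elim linarith
  qed
  have 2: "\<exists>e>0. \<forall>\<^sub>F n in sequentially. measure M {\<omega>\<in>space M. Y n \<omega> \<in> cball x e} \<le> exp (- (real n * c))"
    if "ereal c < J x" for x c
  proof -
    obtain e where e: "e > 0"
      "\<forall>\<^sub>F n in sequentially. measure M {\<omega>\<in>space M. X n \<omega> \<in> cball x e} \<le> exp (- (real n * c))"
      using local_LDP_upper[OF assms(1) \<open>ereal c < J x\<close>] by auto
    from e(2) cball[of x e] have "\<forall>\<^sub>F n in sequentially. measure M {\<omega>\<in>space M. Y n \<omega> \<in> cball x e} \<le> exp (- (real n * c))"
      by eventually_elim linarith
    with e(1) show ?thesis by blast
  qed
  have 3: "\<exists>r. \<forall>\<^sub>F n in sequentially. measure M {\<omega>\<in>space M. r < norm (Y n \<omega>)} \<le> exp (- (real n * c))" for c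
  proof -
    obtain r where r:
      "\<forall>\<^sub>F n in sequentially. measure M {\<omega>\<in>space M. r < norm (X n \<omega>)} \<le> exp (- (real n * c))"
      using local_LDP_tight[OF assms(1)] by blast
    from r norm[of r] have "\<forall>\<^sub>F n in sequentially. measure M {\<omega>\<in>space M. r < norm (Y n \<omega>)} \<le> exp (- (real n * c))"
      by eventually_elim linarith
    then show ?thesis by blast
  qed
  show ?thesis using assms(1) * 1 2 3 unfolding local_LDP_def by blast
qed

section \<open>Products and continuous images of local large deviation principles\<close>

text \<open>As both summands are nonnegative, a level set of the sum lies in the product of the two
  level sets, which is compact. Closedness holds because a strict lower bound for the sum splits
  into strict lower bounds for the summands, and these persist nearby.\<close>

lemma good_rate_function_add:
  fixes J1 :: "'b::euclidean_space \<Rightarrow> ereal" and J2 :: "'c::euclidean_space \<Rightarrow> ereal"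
  assumes good: "good_rate_function J1" "good_rate_function J2"
  shows "good_rate_function (\<lambda>p. J1 (fst p) + J2 (snd p))"
proof -
  note nn = good_rate_functionD(1)[OF good(1)] good_rate_functionD(1)[OF good(2)]
  have closed: "closed {p. J1 (fst p) + J2 (snd p) \<le> ereal c}" (is "closed ?S") for c
  proof -
    have "open (- ?S)"
      unfolding open_contains_ball
    proof
      fix p assume "p \<in> - ?S"
      then have "ereal c < J1 (fst p) + J2 (snd p)" by auto
      then obtain a b where ab: "ereal a < J1 (fst p)" "ereal b < J2 (snd p)" "c \<le> a + b"
        using nn by (rule ereal_less_add_split)
      obtain e1 where e1: "0 < e1" "\<And>y. y \<in> cball (fst p) e1 \<Longrightarrow> ereal a < J1 y"
        using good_rate_function_eventually_gt[OF good(1) ab(1)] by blast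
      obtain e2 where e2: "0 < e2" "\<And>y. y \<in> cball (snd p) e2 \<Longrightarrow> ereal b < J2 y"
        using good_rate_function_eventually_gt[OF good(2) ab(2)] by blast
      have "ball p (min e1 e2) \<subseteq> - ?S"
      proof
        fix q assume q: "q \<in> ball p (min e1 e2)"
        have "dist (fst p) (fst q) \<le> e1" "dist (snd p) (snd q) \<le> e2"
          using q dist_fst_le[of p q] dist_snd_le[of p q] by auto
        then have "ereal a < J1 (fst q)" "ereal b < J2 (snd q)" using e1 e2 by auto
        then have "ereal a + ereal b < J1 (fst q) + J2 (snd q)" by (rule ereal_add_strict_mono2)
        moreover have "ereal c \<le> ereal a + ereal b" using ab by simp
        ultimately have "ereal c < J1 (fst q) + J2 (snd q)" by (rule order_le_less_trans[rotated])
        then show "q \<in> - ?S" by (simp add: not_le)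
      qed
      then show "\<exists>e>0. ball p e \<subseteq> - ?S" using e1 e2 by (intro exI[of _ "min e1 e2"]) simp
    qed
    then show ?thesis by (simp add: closed_def)
  qed
  have "compact {p. J1 (fst p) + J2 (snd p) \<le> ereal c}" for c
  proof -
    have "{p. J1 (fst p) + J2 (snd p) \<le> ereal c} \<subseteq> {x. J1 x \<le> ereal c} \<times> {y. J2 y \<le> ereal c}"
    proof
      fix p assume p: "p \<in> {p. J1 (fst p) + J2 (snd p) \<le> ereal c}"
      have "J1 (fst p) \<le> J1 (fst p) + J2 (snd p)" "J2 (snd p) \<le> J1 (fst p) + J2 (snd p)"
        using nn by (simp_all add: add_increasing add_increasing2)
      with p show "p \<in> {x. J1 x \<le> ereal c} \<times> {y. J2 y \<le> ereal c}"
        by (auto simp: mem_Times_iff intro: order_trans)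
    qed
    moreover have "compact ({x. J1 x \<le> ereal c} \<times> {y. J2 y \<le> ereal c})"
      using good by (intro compact_Times) (auto dest: good_rate_functionD)
    ultimately have "bounded {p. J1 (fst p) + J2 (snd p) \<le> ereal c}"
      using bounded_subset compact_imp_bounded by blast
    with closed show ?thesis by (simp add: compact_eq_bounded_closed)
  qed
  with closed nn show ?thesis by (auto simp: good_rate_function_def)
qed

text \<open>Balls are compared with rectangles in both directions: balls of half the radius fit
  inside, and a closed ball projects into closed balls of the same radius. Independence is thus
  needed only as factorisation over rectangles. It is asked for large n only, since outlier indices
  may be out of range before.\<close>

lemma (in prob_space) local_LDP_pair:
  fixes U :: "nat \<Rightarrow> 'a \<Rightarrow> 'b::euclidean_space" and V :: "nat \<Rightarrow> 'a \<Rightarrow> 'c::euclidean_space"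
  assumes U: "local_LDP M U J1" and V: "local_LDP M V J2"
    and prod: "\<forall>\<^sub>F n in sequentially. \<forall>A\<in>sets borel. \<forall>B\<in>sets borel.
      prob {\<omega>\<in>space M. U n \<omega> \<in> A \<and> V n \<omega> \<in> B} =
      prob {\<omega>\<in>space M. U n \<omega> \<in> A} * prob {\<omega>\<in>space M. V n \<omega> \<in> B}"
  shows "local_LDP M (\<lambda>n \<omega>. (U n \<omega>, V n \<omega>)) (\<lambda>p. J1 (fst p) + J2 (snd p))"
proof -
  note good = local_LDP_good[OF U] local_LDP_good[OF V]
  note nn = good_rate_functionD(1)[OF good(1)] good_rate_functionD(1)[OF good(2)]
  note meas = local_LDP_measurable[OF U] local_LDP_measurable[OF V]
  have 1: "\<forall>\<^sub>F n in sequentially. (\<lambda>\<omega>. (U n \<omega>, V n \<omega>)) \<in> borel_measurable M"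
    using meas by eventually_elim simp
  have 2: "\<forall>\<^sub>F n in sequentially. exp (- (real n * c)) \<le> prob {\<omega>\<in>space M. (U n \<omega>, V n \<omega>) \<in> ball p e}"
    if c: "J1 (fst p) + J2 (snd p) < ereal c" and e: "0 < e" for p c e
  proof -
    obtain a b where ab: "J1 (fst p) < ereal a" "J2 (snd p) < ereal b" "a + b \<le> c"
      using c nn by (rule ereal_add_less_split)
    have "\<forall>\<^sub>F n in sequentially. exp (- (real n * a)) \<le> prob {\<omega>\<in>space M. U n \<omega> \<in> ball (fst p) (e/2)}"
      "\<forall>\<^sub>F n in sequentially. exp (- (real n * b)) \<le> prob {\<omega>\<in>space M. V n \<omega> \<in> ball (snd p) (e/2)}"
      using local_LDP_lower[OF U ab(1), of "e/2"] local_LDP_lower[OF V ab(2), of "e/2"] e by auto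
    with prod meas show ?thesis
    proof eventually_elim
      case (elim n)
      note [measurable] = elim(2,3)
      have "(\<lambda>\<omega>. (U n \<omega>, V n \<omega>)) -` ball p e \<inter> space M \<in> events"
        by (intro measurable_sets[where A = borel] borel_measurable_Pair borel_open open_ball) measurable
      then have ev: "{\<omega>\<in>space M. (U n \<omega>, V n \<omega>) \<in> ball p e} \<in> events"
        by (simp add: vimage_def Int_def conj_commute)
      have "exp (- (real n * c)) \<le> exp (- (real n * a)) * exp (- (real n * b))"
        using ab(3) mult_left_mono[OF ab(3), of "real n"] by (simp add: algebra_simps flip: exp_add)
      also have "\<dots> \<le> prob {\<omega>\<in>space M. U n \<omega> \<in> ball (fst p) (e/2)} * prob {\<omega>\<in>space M. V n \<omega> \<in> ball (snd p) (e/2)}"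
        using elim by (intro mult_mono) auto
      also have "\<dots> = prob {\<omega>\<in>space M. U n \<omega> \<in> ball (fst p) (e/2) \<and> V n \<omega> \<in> ball (snd p) (e/2)}"
        by (rule elim(1)[rule_format, symmetric]) simp_all
      also have "\<dots> \<le> prob {\<omega>\<in>space M. (U n \<omega>, V n \<omega>) \<in> ball p e}"
      proof (intro finite_measure_mono)
        show "{\<omega>\<in>space M. U n \<omega> \<in> ball (fst p) (e/2) \<and> V n \<omega> \<in> ball (snd p) (e/2)}
          \<subseteq> {\<omega>\<in>space M. (U n \<omega>, V n \<omega>) \<in> ball p e}"
        proof safe
          fix \<omega> assume "U n \<omega> \<in> ball (fst p) (e/2)" "V n \<omega> \<in> ball (snd p) (e/2)"
          moreover have "dist p (U n \<omega>, V n \<omega>) \<le> dist (fst p) (U n \<omega>) + dist (snd p) (V n \<omega>)"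
            unfolding dist_prod_def using sqrt_sum_squares_le_sum_abs[of "dist (fst p) (U n \<omega>)" "dist (snd p) (V n \<omega>)"] by simp
          ultimately show "(U n \<omega>, V n \<omega>) \<in> ball p e" by simp
        qed
      qed (fact ev)
      finally show ?case .
    qed
  qed
  have 3: "\<exists>e>0. \<forall>\<^sub>F n in sequentially. prob {\<omega>\<in>space M. (U n \<omega>, V n \<omega>) \<in> cball p e} \<le> exp (- (real n * c))"
    if c: "ereal c < J1 (fst p) + J2 (snd p)" for p c
  proof -
    obtain a b where ab: "ereal a < J1 (fst p)" "ereal b < J2 (snd p)" "c \<le> a + b"
      using c nn by (rule ereal_less_add_split)
    obtain e1 where e1: "0 < e1"
      "\<forall>\<^sub>F n in sequentially. prob {\<omega>\<in>space M. U n \<omega> \<in> cball (fst p) e1} \<le> exp (- (real n * a))"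
      using local_LDP_upper[OF U ab(1)] by auto
    obtain e2 where e2: "0 < e2"
      "\<forall>\<^sub>F n in sequentially. prob {\<omega>\<in>space M. V n \<omega> \<in> cball (snd p) e2} \<le> exp (- (real n * b))"
      using local_LDP_upper[OF V ab(2)] by auto
    from e1(2) e2(2) prod meas
    have "\<forall>\<^sub>F n in sequentially. prob {\<omega>\<in>space M. (U n \<omega>, V n \<omega>) \<in> cball p (min e1 e2)} \<le> exp (- (real n * c))"
    proof eventually_elim
      case (elim n)
      note [measurable] = elim(4,5)
      have "prob {\<omega>\<in>space M. (U n \<omega>, V n \<omega>) \<in> cball p (min e1 e2)}
          \<le> prob {\<omega>\<in>space M. U n \<omega> \<in> cball (fst p) e1 \<and> V n \<omega> \<in> cball (snd p) e2}"
      proof (intro finite_measure_mono)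
        show "{\<omega>\<in>space M. (U n \<omega>, V n \<omega>) \<in> cball p (min e1 e2)}
          \<subseteq> {\<omega>\<in>space M. U n \<omega> \<in> cball (fst p) e1 \<and> V n \<omega> \<in> cball (snd p) e2}"
          using order_trans[OF dist_fst_le[of p]] order_trans[OF dist_snd_le[of p]] by force
      qed (simp add: mem_cball)
      also have "\<dots> = prob {\<omega>\<in>space M. U n \<omega> \<in> cball (fst p) e1} * prob {\<omega>\<in>space M. V n \<omega> \<in> cball (snd p) e2}"
        by (rule elim(3)[rule_format]) simp_all
      also have "\<dots> \<le> exp (- (real n * a)) * exp (- (real n * b))"
        using elim by (intro mult_mono) auto
      also have "\<dots> \<le> exp (- (real n * c))"
        using mult_left_mono[OF ab(3), of "real n"] by (simp add: algebra_simps flip: exp_add)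
      finally show ?case .
    qed
    with e1 e2 show ?thesis by (intro exI[of _ "min e1 e2"]) simp
  qed
  have 4: "\<exists>r. \<forall>\<^sub>F n in sequentially. prob {\<omega>\<in>space M. r < norm (U n \<omega>, V n \<omega>)} \<le> exp (- (real n * c))" for c
  proof -
    obtain r1 where r1: "\<forall>\<^sub>F n in sequentially. prob {\<omega>\<in>space M. r1 < norm (U n \<omega>)} \<le> exp (- (real n * (c+1)))"
      using local_LDP_tight[OF U] by blast
    obtain r2 where r2: "\<forall>\<^sub>F n in sequentially. prob {\<omega>\<in>space M. r2 < norm (V n \<omega>)} \<le> exp (- (real n * (c+1)))"
      using local_LDP_tight[OF V] by blast
    define E where "E a n = (if a then {\<omega>\<in>space M. r1 < norm (U n \<omega>)} else {\<omega>\<in>space M. r2 < norm (V n \<omega>)})" for a n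
    have "\<forall>\<^sub>F n in sequentially. prob {\<omega>\<in>space M. r1 + r2 < norm (U n \<omega>, V n \<omega>)} \<le> exp (- (real n * c))"
    proof (rule eventually_prob_finite_cover_le[of UNIV c "c+1" E])
      show "\<forall>\<^sub>F n in sequentially. \<forall>a\<in>UNIV. E a n \<in> events"
        using meas by eventually_elim (auto simp: E_def)
      show "\<forall>\<^sub>F n in sequentially. {\<omega>\<in>space M. r1 + r2 < norm (U n \<omega>, V n \<omega>)} \<subseteq> (\<Union>a\<in>UNIV. E a n)"
      proof (intro always_eventually allI subsetI)
        fix n \<omega> assume w: "\<omega> \<in> {\<omega>\<in>space M. r1 + r2 < norm (U n \<omega>, V n \<omega>)}"
        have "norm (U n \<omega>, V n \<omega>) \<le> norm (U n \<omega>) + norm (V n \<omega>)" by (rule norm_Pair_le)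
        with w have "r1 < norm (U n \<omega>) \<or> r2 < norm (V n \<omega>)" by auto
        with w show "\<omega> \<in> (\<Union>a\<in>UNIV. E a n)" by (auto simp: E_def UNIV_bool)
      qed
      show "\<forall>\<^sub>F n in sequentially. prob (E a n) \<le> exp (- (real n * (c + 1)))" for a
        using r1 r2 by (cases a) (simp_all add: E_def)
    qed auto
    then show ?thesis by blast
  qed
  from good_rate_function_add[OF good] 1 2 3 4 show ?thesis
    unfolding local_LDP_def by blast
qed

text \<open>Instead of showing that the infimum over a fibre is attained, the level set at c is
  written as the intersection, over e > 0, of the images of the level sets of J at c + e, all of
  which are compact.\<close>

lemma good_rate_function_contraction:
  fixes \<phi> :: "'b::euclidean_space \<Rightarrow> 'c::euclidean_space"
  assumes good: "good_rate_function J" and cont: "continuous_on UNIV \<phi>"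
  shows "good_rate_function (\<lambda>z. INF x\<in>{x. \<phi> x = z}. J x)"
proof -
  have compact: "compact {z. (INF x\<in>{x. \<phi> x = z}. J x) \<le> ereal c}" for c
  proof -
    have "{z. (INF x\<in>{x. \<phi> x = z}. J x) \<le> ereal c} = (\<Inter>e\<in>{0<..}. \<phi> ` {x. J x \<le> ereal (c + e)})"
      (is "?L = ?R")
    proof (intro set_eqI iffI)
      fix z assume z: "z \<in> ?L"
      show "z \<in> ?R"
      proof
        fix e :: real assume "e \<in> {0<..}"
        then have "ereal c < ereal (c + e)" by simp
        with z have "(INF x\<in>{x. \<phi> x = z}. J x) < ereal (c + e)" by (auto intro: order_le_less_trans)
        then obtain x where "\<phi> x = z" "J x < ereal (c + e)" by (auto simp: INF_less_iff)
        then show "z \<in> \<phi> ` {x. J x \<le> ereal (c + e)}" by (auto intro: less_imp_le)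
      qed
    next
      fix z assume z: "z \<in> ?R"
      have "(INF x\<in>{x. \<phi> x = z}. J x) \<le> ereal c"
      proof (rule ereal_le_epsilon2)
        fix e :: real assume "0 < e"
        with z obtain x where "\<phi> x = z" "J x \<le> ereal (c + e)" by auto
        then show "(INF x\<in>{x. \<phi> x = z}. J x) \<le> ereal c + ereal e" by (auto intro: INF_lower2)
      qed
      then show "z \<in> ?L" by simp
    qed
    moreover have "compact ?R"
    proof (rule compact_Inter)
      show "\<And>T. T \<in> (\<lambda>e. \<phi> ` {x. J x \<le> ereal (c + e)}) ` {0<..} \<Longrightarrow> compact T"
        using good_rate_functionD(3)[OF good] continuous_on_subset[OF cont] compact_continuous_image by blast
      show "(\<lambda>e. \<phi> ` {x. J x \<le> ereal (c + e)}) ` {0<..} \<noteq> {}"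
        by (auto intro: exI[of _ 1])
    qed
    ultimately show ?thesis by simp
  qed
  then show ?thesis
    using good_rate_functionD(1)[OF good]
    by (auto simp: good_rate_function_def compact_imp_closed intro: INF_greatest)
qed

text \<open>The hypothesis \<open>conv\<close> is continuous convergence of \<open>\<Phi> n\<close>
  to \<phi>. For the upper bound at z each x gets a small ball. If \<phi> x = z, then X n is rarely
  near x; if not, \<Phi> n eventually maps the ball away from z, so the event is empty. Exponential
  tightness leaves a compact set of x, covered by finitely many of these balls.\<close>

lemma (in prob_space) local_LDP_contraction:
  fixes X :: "nat \<Rightarrow> 'a \<Rightarrow> 'b::euclidean_space" and \<phi> :: "'b \<Rightarrow> 'c::euclidean_space"
  assumes X: "local_LDP M X J"
    and meas: "\<And>n. \<Phi> n \<in> borel_measurable borel"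
    and cont: "continuous_on UNIV \<phi>"
    and conv: "\<And>x e. 0 < e \<Longrightarrow> \<exists>d>0. \<forall>\<^sub>F n in sequentially. \<forall>y\<in>ball x d. dist (\<Phi> n y) (\<phi> x) < e"
  shows "local_LDP M (\<lambda>n \<omega>. \<Phi> n (X n \<omega>)) (\<lambda>z. INF x\<in>{x. \<phi> x = z}. J x)"
proof -
  note good = local_LDP_good[OF X]
  note [measurable] = meas
  have Xm: "\<forall>\<^sub>F n in sequentially. X n \<in> borel_measurable M" by (rule local_LDP_measurable[OF X])
  have 1: "\<forall>\<^sub>F n in sequentially. (\<lambda>\<omega>. \<Phi> n (X n \<omega>)) \<in> borel_measurable M"
    using Xm by eventually_elim measurable
  have 2: "\<forall>\<^sub>F n in sequentially. exp (- (real n * c)) \<le> prob {\<omega>\<in>space M. \<Phi> n (X n \<omega>) \<in> ball z e}"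
    if c: "(INF x\<in>{x. \<phi> x = z}. J x) < ereal c" and e: "0 < e" for z c e
  proof -
    obtain x where x: "\<phi> x = z" "J x < ereal c" using c by (auto simp: INF_less_iff)
    obtain d where d: "0 < d" "\<forall>\<^sub>F n in sequentially. \<forall>y\<in>ball x d. dist (\<Phi> n y) (\<phi> x) < e"
      using conv[OF e] by blast
    from d(2) local_LDP_lower[OF X x(2) d(1)] Xm show ?thesis
    proof eventually_elim
      case (elim n)
      note [measurable] = elim(3)
      have "prob {\<omega>\<in>space M. X n \<omega> \<in> ball x d} \<le> prob {\<omega>\<in>space M. \<Phi> n (X n \<omega>) \<in> ball z e}"
        using elim(1) x(1) by (intro finite_measure_mono) (auto simp: dist_commute)
      with elim show ?case by linarith
    qed
  qed
  have 3: "\<exists>e>0. \<forall>\<^sub>F n in sequentially. prob {\<omega>\<in>space M. \<Phi> n (X n \<omega>) \<in> cball z e} \<le> exp (- (real n * c))"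
    if c: "ereal c < (INF x\<in>{x. \<phi> x = z}. J x)" for z c
  proof -
    obtain c' where c': "ereal c < ereal c'" "ereal c' < (INF x\<in>{x. \<phi> x = z}. J x)"
      using c by (rule ereal_real_between)
    obtain r where r: "\<forall>\<^sub>F n in sequentially. prob {\<omega>\<in>space M. r < norm (X n \<omega>)} \<le> exp (- (real n * c'))"
      using local_LDP_tight[OF X] by blast
    have "\<forall>x. \<exists>d. 0 < fst d \<and> 0 < snd d \<and> (\<forall>\<^sub>F n in sequentially.
      prob {\<omega>\<in>space M. X n \<omega> \<in> ball x (fst d) \<and> \<Phi> n (X n \<omega>) \<in> cball z (snd d)} \<le> exp (- (real n * c')))"
    proof
      fix x
      show "\<exists>d. 0 < fst d \<and> 0 < snd d \<and> (\<forall>\<^sub>F n in sequentially.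
        prob {\<omega>\<in>space M. X n \<omega> \<in> ball x (fst d) \<and> \<Phi> n (X n \<omega>) \<in> cball z (snd d)} \<le> exp (- (real n * c')))"
      proof (cases "\<phi> x = z")
        case True
        then have "(INF x\<in>{x. \<phi> x = z}. J x) \<le> J x" by (intro INF_lower) simp
        with c'(2) have "ereal c' < J x" by (rule less_le_trans)
        then obtain d where d: "0 < d" "\<forall>\<^sub>F n in sequentially. prob {\<omega>\<in>space M. X n \<omega> \<in> cball x d} \<le> exp (- (real n * c'))"
          using local_LDP_upper[OF X] by blast
        from d(2) Xm have "\<forall>\<^sub>F n in sequentially.
          prob {\<omega>\<in>space M. X n \<omega> \<in> ball x d \<and> \<Phi> n (X n \<omega>) \<in> cball z 1} \<le> exp (- (real n * c'))"
        proof eventually_elim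
          case (elim n)
          note [measurable] = elim(2)
          have "prob {\<omega>\<in>space M. X n \<omega> \<in> ball x d \<and> \<Phi> n (X n \<omega>) \<in> cball z 1} \<le> prob {\<omega>\<in>space M. X n \<omega> \<in> cball x d}"
            by (intro finite_measure_mono) auto
          with elim show ?case by linarith
        qed
        with d show ?thesis by (intro exI[of _ "(d, 1)"]) simp
      next
        case False
        define \<eta> where "\<eta> = dist (\<phi> x) z / 2"
        have \<eta>: "0 < \<eta>" using False by (simp add: \<eta>_def)
        obtain d where d: "0 < d" "\<forall>\<^sub>F n in sequentially. \<forall>y\<in>ball x d. dist (\<Phi> n y) (\<phi> x) < \<eta>"
          using conv[OF \<eta>] by blast
        from d(2) have "\<forall>\<^sub>F n in sequentially.
          prob {\<omega>\<in>space M. X n \<omega> \<in> ball x d \<and> \<Phi> n (X n \<omega>) \<in> cball z \<eta>} \<le> exp (- (real n * c'))"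
        proof eventually_elim
          case (elim n)
          have "\<not> (y \<in> ball x d \<and> \<Phi> n y \<in> cball z \<eta>)" for y
          proof
            assume y: "y \<in> ball x d \<and> \<Phi> n y \<in> cball z \<eta>"
            with elim have "dist (\<Phi> n y) (\<phi> x) < \<eta>" by blast
            moreover have "dist z (\<Phi> n y) \<le> \<eta>" using y by simp
            moreover have "dist (\<phi> x) z \<le> dist (\<Phi> n y) (\<phi> x) + dist z (\<Phi> n y)"
              by (metis dist_commute dist_triangle)
            ultimately show False by (simp add: \<eta>_def)
          qed
          then have "{\<omega>\<in>space M. X n \<omega> \<in> ball x d \<and> \<Phi> n (X n \<omega>) \<in> cball z \<eta>} = {}" by blast
          then show ?case by (simp only: measure_empty) simp
        qed
        with d \<eta> show ?thesis by (intro exI[of _ "(d, \<eta>)"]) simp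
      qed
    qed
    from choice[OF this] obtain d where d: "\<And>x. 0 < fst (d x)" "\<And>x. 0 < snd (d x)"
      "\<And>x. \<forall>\<^sub>F n in sequentially.
      prob {\<omega>\<in>space M. X n \<omega> \<in> ball x (fst (d x)) \<and> \<Phi> n (X n \<omega>) \<in> cball z (snd (d x))} \<le> exp (- (real n * c'))"
      by blast
    have cover: "cball 0 r \<subseteq> (\<Union>x\<in>UNIV. ball x (fst (d x)))"
      using centre_in_ball d(1) by blast
    obtain A where A: "finite A" "cball 0 r \<subseteq> (\<Union>x\<in>A. ball x (fst (d x)))"
      by (rule compactE_image[OF compact_cball open_ball cover])
    \<comment> \<open>The element 1 keeps the minimum meaningful when A is empty.\<close>
    define e where "e = Min (insert 1 ((\<lambda>x. snd (d x)) ` A))"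
    have e: "0 < e" "\<And>x. x \<in> A \<Longrightarrow> e \<le> snd (d x)" using A(1) d(2) by (auto simp: e_def)
    define E where "E a n = (case a of None \<Rightarrow> {\<omega>\<in>space M. r < norm (X n \<omega>)}
      | Some x \<Rightarrow> {\<omega>\<in>space M. X n \<omega> \<in> ball x (fst (d x)) \<and> \<Phi> n (X n \<omega>) \<in> cball z (snd (d x))})" for a n
    have "\<forall>\<^sub>F n in sequentially. prob {\<omega>\<in>space M. \<Phi> n (X n \<omega>) \<in> cball z e} \<le> exp (- (real n * c))"
    proof (rule eventually_prob_finite_cover_le[of "insert None (Some ` A)" c c' E])
      show "\<forall>\<^sub>F n in sequentially. \<forall>a\<in>insert None (Some ` A). E a n \<in> events"
        using Xm
      proof eventually_elim
        case (elim n)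
        note [measurable] = elim
        show ?case by (auto simp: E_def)
      qed
      show "\<forall>\<^sub>F n in sequentially. {\<omega>\<in>space M. \<Phi> n (X n \<omega>) \<in> cball z e} \<subseteq> (\<Union>a\<in>insert None (Some ` A). E a n)"
      proof (intro always_eventually allI subsetI)
        fix n \<omega> assume w: "\<omega> \<in> {\<omega>\<in>space M. \<Phi> n (X n \<omega>) \<in> cball z e}"
        show "\<omega> \<in> (\<Union>a\<in>insert None (Some ` A). E a n)"
        proof (cases "r < norm (X n \<omega>)")
          case False
          then have "X n \<omega> \<in> cball 0 r" by simp
          with A obtain x where x: "x \<in> A" "X n \<omega> \<in> ball x (fst (d x))" by blast
          with w e(2)[OF x(1)] show ?thesis by (auto simp: E_def)
        qed (use w in \<open>auto simp: E_def\<close>)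
      qed
      show "\<forall>\<^sub>F n in sequentially. prob (E a n) \<le> exp (- (real n * c'))" if "a \<in> insert None (Some ` A)" for a
        using d(3) r by (cases a) (simp_all only: E_def option.case)
    qed (use A c' in auto)
    with e(1) show ?thesis by blast
  qed
  have 4: "\<exists>s. \<forall>\<^sub>F n in sequentially. prob {\<omega>\<in>space M. s < norm (\<Phi> n (X n \<omega>))} \<le> exp (- (real n * c))" for c
  proof -
    obtain r where r: "\<forall>\<^sub>F n in sequentially. prob {\<omega>\<in>space M. r < norm (X n \<omega>)} \<le> exp (- (real n * c))"
      using local_LDP_tight[OF X] by blast
    have "\<forall>x. \<exists>d. 0 < d \<and> (\<forall>\<^sub>F n in sequentially. \<forall>y\<in>ball x d. dist (\<Phi> n y) (\<phi> x) < 1)"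
      using conv[of 1] by simp
    from choice[OF this] obtain d where d: "\<And>x. 0 < d x"
      "\<And>x. \<forall>\<^sub>F n in sequentially. \<forall>y\<in>ball x (d x). dist (\<Phi> n y) (\<phi> x) < 1"
      by blast
    have cover: "cball 0 r \<subseteq> (\<Union>x\<in>UNIV. ball x (d x))"
      using centre_in_ball d(1) by blast
    obtain A where A: "finite A" "cball 0 r \<subseteq> (\<Union>x\<in>A. ball x (d x))"
      by (rule compactE_image[OF compact_cball open_ball cover])
    \<comment> \<open>The sum bounds every single \<open>norm (\<phi> x)\<close>, and 1 is the
      tolerance in the choice of d.\<close>
    define s where "s = (\<Sum>x\<in>A. norm (\<phi> x)) + 1"
    have "\<forall>\<^sub>F n in sequentially. \<forall>x\<in>A. \<forall>y\<in>ball x (d x). dist (\<Phi> n y) (\<phi> x) < 1"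
      using A(1) d(2) by (intro eventually_ball_finite) auto
    with r Xm have "\<forall>\<^sub>F n in sequentially. prob {\<omega>\<in>space M. s < norm (\<Phi> n (X n \<omega>))} \<le> exp (- (real n * c))"
    proof eventually_elim
      case (elim n)
      note [measurable] = elim(2)
      have "norm (\<Phi> n y) \<le> s" if "norm y \<le> r" for y
      proof -
        have "y \<in> cball 0 r" using that by simp
        with A obtain x where x: "x \<in> A" "y \<in> ball x (d x)" by blast
        with elim(3) have "dist (\<Phi> n y) (\<phi> x) < 1" by blast
        moreover have "norm (\<phi> x) \<le> (\<Sum>x\<in>A. norm (\<phi> x))" using x A by (intro member_le_sum) auto
        moreover have "norm (\<Phi> n y) \<le> norm (\<phi> x) + dist (\<Phi> n y) (\<phi> x)"
          by (metis dist_norm norm_triangle_sub)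
        ultimately show ?thesis by (simp add: s_def)
      qed
      then have "prob {\<omega>\<in>space M. s < norm (\<Phi> n (X n \<omega>))} \<le> prob {\<omega>\<in>space M. r < norm (X n \<omega>)}"
        by (intro finite_measure_mono) (auto simp: not_le[symmetric])
      with elim show ?case by linarith
    qed
    then show ?thesis by blast
  qed
  from good_rate_function_contraction[OF good cont] 1 2 3 4 show ?thesis
    unfolding local_LDP_def by blast
qed

section \<open>Truncated and full cumulant generating functions\<close>

text \<open>The exponential is set to 0 outside the ball; the variable is neither clipped nor
  conditioned. A product of such factors is therefore the full exponential restricted to the event
  that all variables are bounded, and the factors increase with k.\<close>

definition trunc_exp :: "nat \<Rightarrow> 'v::euclidean_space \<Rightarrow> 'v \<Rightarrow> real" where
  "trunc_exp k \<theta> y = (if norm y \<le> real k then exp (\<theta> \<bullet> y) else 0)"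

lemma trunc_exp_measurable [measurable]: "trunc_exp k \<theta> \<in> borel_measurable borel"
  unfolding trunc_exp_def by measurable

lemma trunc_exp_nonneg [simp]: "0 \<le> trunc_exp k \<theta> y"
  by (simp add: trunc_exp_def)

lemma trunc_exp_mono: "k \<le> l \<Longrightarrow> trunc_exp k \<theta> y \<le> trunc_exp l \<theta> y"
  by (simp add: trunc_exp_def)

lemma trunc_exp_le: "trunc_exp k \<theta> y \<le> exp (real k * norm \<theta>)"
proof -
  have "\<theta> \<bullet> y \<le> real k * norm \<theta>" if "norm y \<le> real k"
    using order_trans[OF norm_cauchy_schwarz[of \<theta> y] mult_left_mono[OF that norm_ge_zero]]
    by (simp add: mult.commute)
  then show ?thesis by (simp add: trunc_exp_def)
qed

lemma trunc_exp_lipschitz: "trunc_exp k \<theta> y \<le> exp (real k * norm (\<theta> - \<eta>)) * trunc_exp k \<eta> y"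
proof (cases "norm y \<le> real k")
  case True
  then have "trunc_exp k \<theta> y = trunc_exp k (\<theta> - \<eta>) y * trunc_exp k \<eta> y"
    by (simp add: trunc_exp_def inner_diff_left flip: exp_add)
  then show ?thesis using trunc_exp_le[of k "\<theta> - \<eta>" y] by (simp add: mult_right_mono)
qed (simp add: trunc_exp_def)

text \<open>Origin of the quadratic error in semiconcavity. For 0 \<le> x \<le> 1 the summands are
  at most \<open>1 + x + x\<^sup>2\<close> and \<open>1 / (1 + x) \<le> 1 - x + x\<^sup>2\<close>,
  and the linear terms cancel. The claim is even in x.\<close>

lemma exp_add_exp_minus_le:
  fixes x :: real
  assumes "\<bar>x\<bar> \<le> 1"
  shows "exp x + exp (- x) \<le> 2 * (1 + x\<^sup>2)"
proof -
  have *: "exp x + exp (- x) \<le> 2 * (1 + x\<^sup>2)" if x: "0 \<le> x" "x \<le> 1" for x :: real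
  proof -
    have "exp (- x) \<le> 1 / (1 + x)"
      using exp_ge_add_one_self[of x] x by (simp add: exp_minus field_simps)
    also have "\<dots> \<le> 1 - x + x\<^sup>2"
      using x by (simp add: field_simps power2_eq_square power3_eq_cube)
    finally show ?thesis using exp_bound[OF x] by simp
  qed
  show ?thesis using *[of x] *[of "- x"] assms by (cases "0 \<le> x") (auto simp: add.commute)
qed

lemma trunc_exp_add_diff_le:
  assumes "real k * norm v \<le> 1"
  shows "trunc_exp k (\<theta> + v) y + trunc_exp k (\<theta> - v) y \<le> 2 * (1 + (real k * norm v)\<^sup>2) * trunc_exp k \<theta> y"
proof (cases "norm y \<le> real k")
  case True
  have "\<bar>v \<bullet> y\<bar> \<le> norm v * norm y" by (rule Cauchy_Schwarz_ineq2)
  also have "\<dots> \<le> real k * norm v" using mult_left_mono[OF True norm_ge_zero[of v]] by (simp add: mult.commute)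
  finally have vy: "\<bar>v \<bullet> y\<bar> \<le> real k * norm v" .
  then have "(v \<bullet> y)\<^sup>2 \<le> (real k * norm v)\<^sup>2" by (metis abs_ge_zero power2_abs power_mono)
  moreover have "exp (v \<bullet> y) + exp (- (v \<bullet> y)) \<le> 2 * (1 + (v \<bullet> y)\<^sup>2)"
    using vy assms by (intro exp_add_exp_minus_le) simp
  ultimately have "exp (v \<bullet> y) + exp (- (v \<bullet> y)) \<le> 2 * (1 + (real k * norm v)\<^sup>2)" by simp
  then have "exp (\<theta> \<bullet> y) * (exp (v \<bullet> y) + exp (- (v \<bullet> y))) \<le> exp (\<theta> \<bullet> y) * (2 * (1 + (real k * norm v)\<^sup>2))"
    by (intro mult_left_mono) auto
  with True show ?thesis
    by (simp add: trunc_exp_def inner_add_left inner_diff_left algebra_simps flip: exp_add)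
qed (simp add: trunc_exp_def)

lemma ereal_eqI_real_bounds:
  fixes a b :: ereal
  assumes "\<And>s::real. a \<le> ereal s \<longleftrightarrow> b \<le> ereal s"
  shows "a = b"
proof (rule ccontr)
  assume "a \<noteq> b"
  then consider "a < b" | "b < a" by (meson neqE)
  then show False
  proof cases
    case 1
    then obtain r where "a < ereal r" "ereal r < b" by (rule ereal_real_between)
    with assms[of r] show False by auto
  next
    case 2
    then obtain r where "b < ereal r" "ereal r < a" by (rule ereal_real_between)
    with assms[of r] show False by auto
  qed
qed

lemma eln_le_iff: "0 \<le> p \<Longrightarrow> eln p \<le> ereal s \<longleftrightarrow> p \<le> exp s"
  using eln_scaled_le_iff[of 1 p s] by (simp flip: one_ereal_def)

lemma log_mgf_le_iff:
  "log_mgf M Y \<theta> \<le> ereal s \<longleftrightarrow> (\<integral>\<^sup>+\<omega>. ennreal (exp (\<theta> \<bullet> Y \<omega>)) \<partial>M) \<le> ennreal (exp s)" (is "_ \<longleftrightarrow> ?E \<le> _")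
proof (cases "?E = \<infinity>")
  case False
  then obtain g where g: "?E = ennreal g" "0 \<le> g" by (cases ?E) auto
  then show ?thesis by (simp add: log_mgf_def eln_le_iff)
qed (simp add: log_mgf_def top_unique)

lemma exp_convex_comb:
  fixes a b u v :: real
  assumes "0 \<le> u" "0 \<le> v" "u + v = 1"
  shows "exp (u * a + v * b) \<le> u * exp a + v * exp b"
proof -
  have u: "u = 1 - v" using assms by simp
  show ?thesis unfolding u using convex_onD[OF exp_convex, of v a b] assms by simp
qed

text \<open>\<open>K0\<close> is a radius whose ball has positive mass. Truncation levels are
  counted from \<open>K0\<close>, so the truncated moment generating function is positive and its
  logarithm real for every k, including k = 0.\<close>

locale exp_moment = prob_space M for M :: "'a measure" +
  fixes Y :: "'a \<Rightarrow> 'v::euclidean_space" and K0 :: nat and \<alpha> :: real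
  assumes Y_measurable [measurable]: "Y \<in> borel_measurable M"
    and \<alpha>_pos: "0 < \<alpha>"
    and exp_integrable: "integrable M (\<lambda>\<omega>. exp (\<alpha> * norm (Y \<omega>)))"
    and K0_pos: "0 < prob {\<omega>\<in>space M. norm (Y \<omega>) \<le> real K0}"
begin

definition trunc_mgf :: "nat \<Rightarrow> 'v \<Rightarrow> real" where
  "trunc_mgf k \<theta> = (\<integral>\<omega>. trunc_exp (K0 + k) \<theta> (Y \<omega>) \<partial>M)"

definition trunc_cgf :: "nat \<Rightarrow> 'v \<Rightarrow> real" where
  "trunc_cgf k \<theta> = ln (trunc_mgf k \<theta>)"

definition mgf :: "'v \<Rightarrow> real" where
  "mgf \<theta> = (\<integral>\<omega>. exp (\<theta> \<bullet> Y \<omega>) \<partial>M)"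

definition mgf_dom :: "'v set" where
  "mgf_dom = {\<theta>. integrable M (\<lambda>\<omega>. exp (\<theta> \<bullet> Y \<omega>))}"

lemma integrable_trunc_exp: "integrable M (\<lambda>\<omega>. trunc_exp k \<theta> (Y \<omega>))"
  by (rule integrable_const_bound[where B = "exp (real k * norm \<theta>)"]) (auto simp: trunc_exp_le)

lemma trunc_mgf_mono: "k \<le> l \<Longrightarrow> trunc_mgf k \<theta> \<le> trunc_mgf l \<theta>"
  unfolding trunc_mgf_def by (intro integral_mono integrable_trunc_exp trunc_exp_mono) simp

lemma trunc_mgf_pos: "0 < trunc_mgf k \<theta>"
proof -
  have "0 < exp (- (real K0 * norm \<theta>)) * prob {\<omega>\<in>space M. norm (Y \<omega>) \<le> real K0}"
    using K0_pos by simp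
  also have "\<dots> = (\<integral>\<omega>. exp (- (real K0 * norm \<theta>)) * indicator {\<omega>\<in>space M. norm (Y \<omega>) \<le> real K0} \<omega> \<partial>M)"
    by simp
  also have "\<dots> \<le> trunc_mgf k \<theta>"
    unfolding trunc_mgf_def
  proof (intro integral_mono integrable_trunc_exp)
    show "integrable M (\<lambda>\<omega>. exp (- (real K0 * norm \<theta>)) * indicator {\<omega>\<in>space M. norm (Y \<omega>) \<le> real K0} \<omega>)"
      by (intro integrable_mult_right integrable_real_indicator) (auto simp: emeasure_eq_measure)
    fix \<omega>
    have "- (real K0 * norm \<theta>) \<le> \<theta> \<bullet> Y \<omega>" if "norm (Y \<omega>) \<le> real K0"
    proof -
      have "\<bar>\<theta> \<bullet> Y \<omega>\<bar> \<le> norm \<theta> * norm (Y \<omega>)" by (rule Cauchy_Schwarz_ineq2)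
      also have "\<dots> \<le> norm \<theta> * real K0" using that by (intro mult_left_mono) auto
      finally show ?thesis by (simp add: mult.commute)
    qed
    then show "exp (- (real K0 * norm \<theta>)) * indicator {\<omega>\<in>space M. norm (Y \<omega>) \<le> real K0} \<omega> \<le> trunc_exp (K0 + k) \<theta> (Y \<omega>)"
      by (auto simp: trunc_exp_def indicator_def)
  qed
  finally show ?thesis .
qed

lemma exp_trunc_cgf: "exp (trunc_cgf k \<theta>) = trunc_mgf k \<theta>"
  by (simp add: trunc_cgf_def trunc_mgf_pos)

lemma trunc_cgf_mono: "k \<le> l \<Longrightarrow> trunc_cgf k \<theta> \<le> trunc_cgf l \<theta>"
  by (simp add: trunc_cgf_def trunc_mgf_pos trunc_mgf_mono)

text \<open>Truncation may lose mass, so equality cannot be expected; the inequality is what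
  \<open>exists_tilt\<close> asks for.\<close>

lemma trunc_cgf_zero_le: "trunc_cgf k 0 \<le> 0"
proof -
  have "trunc_mgf k 0 \<le> (\<integral>\<omega>. 1 \<partial>M)"
    unfolding trunc_mgf_def by (intro integral_mono integrable_trunc_exp) (auto simp: trunc_exp_def)
  then show ?thesis by (simp add: trunc_cgf_def trunc_mgf_pos prob_space)
qed

lemma trunc_cgf_diff_le: "trunc_cgf k \<theta> - trunc_cgf k \<eta> \<le> real (K0 + k) * norm (\<theta> - \<eta>)"
proof -
  have "trunc_mgf k \<theta> \<le> (\<integral>\<omega>. exp (real (K0 + k) * norm (\<theta> - \<eta>)) * trunc_exp (K0 + k) \<eta> (Y \<omega>) \<partial>M)"
    unfolding trunc_mgf_def by (intro integral_mono integrable_mult_right integrable_trunc_exp trunc_exp_lipschitz)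
  also have "\<dots> = exp (real (K0 + k) * norm (\<theta> - \<eta>)) * trunc_mgf k \<eta>"
    by (simp add: trunc_mgf_def)
  finally have "trunc_cgf k \<theta> \<le> ln (exp (real (K0 + k) * norm (\<theta> - \<eta>)) * trunc_mgf k \<eta>)"
    by (simp add: trunc_cgf_def trunc_mgf_pos)
  then show ?thesis using trunc_mgf_pos[of k \<eta>] by (simp add: trunc_cgf_def ln_mult)
qed

lemma trunc_cgf_lipschitz: "\<bar>trunc_cgf k \<theta> - trunc_cgf k \<eta>\<bar> \<le> real (K0 + k) * norm (\<theta> - \<eta>)"
  using trunc_cgf_diff_le[of k \<theta> \<eta>] trunc_cgf_diff_le[of k \<eta> \<theta>] by (auto simp: norm_minus_commute abs_le_iff)

lemma continuous_on_trunc_cgf: "continuous_on UNIV (trunc_cgf k)"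
proof (rule lipschitz_on_continuous_on)
  show "(real (K0 + k))-lipschitz_on UNIV (trunc_cgf k)"
    using trunc_cgf_lipschitz by (intro lipschitz_onI) (auto simp: dist_norm)
qed

text \<open>Semiconcavity replaces differentiability of the truncated cumulant generating function.\<close>

lemma trunc_cgf_semiconcave:
  assumes "real (K0 + k) * norm v \<le> 1"
  shows "trunc_cgf k (\<theta> + v) + trunc_cgf k (\<theta> - v) \<le> 2 * trunc_cgf k \<theta> + 2 * (real (K0 + k) * norm v)\<^sup>2"
proof -
  define c where "c = real (K0 + k) * norm v"
  have "trunc_mgf k (\<theta> + v) + trunc_mgf k (\<theta> - v) = (\<integral>\<omega>. trunc_exp (K0 + k) (\<theta> + v) (Y \<omega>) + trunc_exp (K0 + k) (\<theta> - v) (Y \<omega>) \<partial>M)"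
    by (simp add: trunc_mgf_def integrable_trunc_exp)
  also have "\<dots> \<le> (\<integral>\<omega>. 2 * (1 + c\<^sup>2) * trunc_exp (K0 + k) \<theta> (Y \<omega>) \<partial>M)"
    using trunc_exp_add_diff_le[OF assms]
    by (intro integral_mono) (auto simp: integrable_trunc_exp c_def)
  also have "\<dots> = 2 * (1 + c\<^sup>2) * trunc_mgf k \<theta>" by (simp add: trunc_mgf_def)
  finally have sum: "trunc_mgf k (\<theta> + v) + trunc_mgf k (\<theta> - v) \<le> 2 * (1 + c\<^sup>2) * trunc_mgf k \<theta>" .
  \<comment> \<open>The arithmetic-geometric mean inequality turns the bound for the sum of the
    moment generating functions into one for their product, hence for the sum of the logarithms.
    Then \<open>1 + c\<^sup>2 \<le> exp (c\<^sup>2)\<close>.\<close>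
  have "4 * (trunc_mgf k (\<theta> + v) * trunc_mgf k (\<theta> - v)) \<le> (trunc_mgf k (\<theta> + v) + trunc_mgf k (\<theta> - v))\<^sup>2"
    using zero_le_power2[of "trunc_mgf k (\<theta> + v) - trunc_mgf k (\<theta> - v)"]
    by (simp add: power2_eq_square algebra_simps)
  also have "\<dots> \<le> (2 * (1 + c\<^sup>2) * trunc_mgf k \<theta>)\<^sup>2"
    using sum trunc_mgf_pos[of k "\<theta> + v"] trunc_mgf_pos[of k "\<theta> - v"] by (intro power_mono) auto
  also have "\<dots> \<le> (2 * exp (c\<^sup>2) * trunc_mgf k \<theta>)\<^sup>2"
    using trunc_mgf_pos[of k \<theta>] by (intro power_mono mult_right_mono mult_left_mono) auto
  finally have "exp (trunc_cgf k (\<theta> + v) + trunc_cgf k (\<theta> - v)) \<le> exp (2 * trunc_cgf k \<theta> + 2 * c\<^sup>2)"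
    by (simp add: exp_add exp_trunc_cgf exp_double power_mult_distrib mult.commute)
  then show ?thesis by (simp add: c_def)
qed

section \<open>Removal of the truncation and the domain of finiteness\<close>

lemma nn_integral_exp_eq_SUP:
  "(\<integral>\<^sup>+\<omega>. ennreal (exp (\<theta> \<bullet> Y \<omega>)) \<partial>M) = (SUP k. ennreal (trunc_mgf k \<theta>))"
proof -
  have "(SUP k. ennreal (trunc_exp (K0 + k) \<theta> y)) = ennreal (exp (\<theta> \<bullet> y))" for y :: 'v
  proof (rule antisym)
    show "(SUP k. ennreal (trunc_exp (K0 + k) \<theta> y)) \<le> ennreal (exp (\<theta> \<bullet> y))"
      by (intro SUP_least ennreal_leI) (simp add: trunc_exp_def)
    obtain k where "norm y \<le> real k" using real_arch_simple by blast
    then have "ennreal (exp (\<theta> \<bullet> y)) = ennreal (trunc_exp (K0 + k) \<theta> y)" by (simp add: trunc_exp_def)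
    also have "\<dots> \<le> (SUP k. ennreal (trunc_exp (K0 + k) \<theta> y))" by (rule SUP_upper) simp
    finally show "ennreal (exp (\<theta> \<bullet> y)) \<le> (SUP k. ennreal (trunc_exp (K0 + k) \<theta> y))" .
  qed
  then have "(\<integral>\<^sup>+\<omega>. ennreal (exp (\<theta> \<bullet> Y \<omega>)) \<partial>M) = (\<integral>\<^sup>+\<omega>. (SUP k. ennreal (trunc_exp (K0 + k) \<theta> (Y \<omega>))) \<partial>M)"
    by simp
  also have "\<dots> = (SUP k. \<integral>\<^sup>+\<omega>. ennreal (trunc_exp (K0 + k) \<theta> (Y \<omega>)) \<partial>M)"
    by (intro nn_integral_monotone_convergence_SUP)
       (auto simp: incseq_def le_fun_def intro!: ennreal_leI trunc_exp_mono)
  also have "\<dots> = (SUP k. ennreal (trunc_mgf k \<theta>))"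
    by (simp add: trunc_mgf_def nn_integral_eq_integral[OF integrable_trunc_exp])
  finally show ?thesis .
qed

text \<open>Comparing both sides with real upper bounds handles finite and infinite values at once.
  Besides the limit k \<rightarrow> \<infinity>, this yields measurability of \<open>log_mgf\<close>
  composed with \<open>l v* f y\<close>.\<close>

lemma log_mgf_eq_SUP: "log_mgf M Y \<theta> = (SUP k. ereal (trunc_cgf k \<theta>))"
proof (rule ereal_eqI_real_bounds)
  fix s :: real
  have "log_mgf M Y \<theta> \<le> ereal s \<longleftrightarrow> (\<forall>k. trunc_mgf k \<theta> \<le> exp s)"
    by (simp add: log_mgf_le_iff nn_integral_exp_eq_SUP SUP_le_iff ennreal_le_iff)
  also have "\<dots> \<longleftrightarrow> (\<forall>k. trunc_cgf k \<theta> \<le> s)"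
    by (simp flip: exp_trunc_cgf)
  finally show "log_mgf M Y \<theta> \<le> ereal s \<longleftrightarrow> (SUP k. ereal (trunc_cgf k \<theta>)) \<le> ereal s"
    by (simp add: SUP_le_iff)
qed

lemma mgf_pos: "\<theta> \<in> mgf_dom \<Longrightarrow> 0 < mgf \<theta>"
proof -
  assume "\<theta> \<in> mgf_dom"
  then have "trunc_mgf 0 \<theta> \<le> mgf \<theta>"
    unfolding trunc_mgf_def mgf_def mgf_dom_def
    by (intro integral_mono integrable_trunc_exp) (auto simp: trunc_exp_def)
  with trunc_mgf_pos[of 0 \<theta>] show ?thesis by linarith
qed

lemma log_mgf_eq: "\<theta> \<in> mgf_dom \<Longrightarrow> log_mgf M Y \<theta> = ereal (ln (mgf \<theta>))"
  using mgf_pos[of \<theta>]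
  by (simp add: log_mgf_def mgf_dom_def mgf_def nn_integral_eq_integral eln_def)

lemma log_mgf_eq_PInf: "\<theta> \<notin> mgf_dom \<Longrightarrow> log_mgf M Y \<theta> = \<infinity>"
proof -
  assume "\<theta> \<notin> mgf_dom"
  then have "(\<integral>\<^sup>+\<omega>. ennreal (exp (\<theta> \<bullet> Y \<omega>)) \<partial>M) = \<infinity>"
    using top.not_eq_extremum by (fastforce simp: mgf_dom_def integrable_iff_bounded)
  then show ?thesis by (simp add: log_mgf_def)
qed

lemma integrable_convex_comb:
  assumes "\<theta> \<in> mgf_dom" "\<eta> \<in> mgf_dom" "0 \<le> u" "0 \<le> v" "u + v = 1"
  shows "u *\<^sub>R \<theta> + v *\<^sub>R \<eta> \<in> mgf_dom"
    and "mgf (u *\<^sub>R \<theta> + v *\<^sub>R \<eta>) \<le> u * mgf \<theta> + v * mgf \<eta>"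
proof -
  have le: "exp ((u *\<^sub>R \<theta> + v *\<^sub>R \<eta>) \<bullet> y) \<le> u * exp (\<theta> \<bullet> y) + v * exp (\<eta> \<bullet> y)" for y
    using exp_convex_comb[OF assms(3-5), of "\<theta> \<bullet> y" "\<eta> \<bullet> y"] by (simp add: inner_add_left)
  have int: "integrable M (\<lambda>\<omega>. u * exp (\<theta> \<bullet> Y \<omega>) + v * exp (\<eta> \<bullet> Y \<omega>))"
    using assms by (auto simp: mgf_dom_def)
  have "integrable M (\<lambda>\<omega>. exp ((u *\<^sub>R \<theta> + v *\<^sub>R \<eta>) \<bullet> Y \<omega>))"
    by (rule Bochner_Integration.integrable_bound[OF int]) (use le in \<open>auto intro: order_trans[OF _ abs_ge_self]\<close>)
  then show dom: "u *\<^sub>R \<theta> + v *\<^sub>R \<eta> \<in> mgf_dom" by (simp add: mgf_dom_def)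
  then have "mgf (u *\<^sub>R \<theta> + v *\<^sub>R \<eta>) \<le> (\<integral>\<omega>. u * exp (\<theta> \<bullet> Y \<omega>) + v * exp (\<eta> \<bullet> Y \<omega>) \<partial>M)"
    unfolding mgf_def mgf_dom_def by (intro integral_mono int le) simp
  also have "\<dots> = u * mgf \<theta> + v * mgf \<eta>" using assms by (simp add: mgf_def mgf_dom_def)
  finally show "mgf (u *\<^sub>R \<theta> + v *\<^sub>R \<eta>) \<le> u * mgf \<theta> + v * mgf \<eta>" .
qed

lemma convex_mgf_dom: "convex mgf_dom"
  by (intro convexI integrable_convex_comb)

lemma ball_subset_mgf_dom: "ball 0 \<alpha> \<subseteq> mgf_dom"
proof
  fix \<theta> :: 'v assume "\<theta> \<in> ball 0 \<alpha>"
  then have \<theta>: "norm \<theta> \<le> \<alpha>" by simp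
  have "\<theta> \<bullet> y \<le> \<alpha> * norm y" for y
    using order_trans[OF norm_cauchy_schwarz[of \<theta> y] mult_right_mono[OF \<theta> norm_ge_zero]] .
  then have "integrable M (\<lambda>\<omega>. exp (\<theta> \<bullet> Y \<omega>))"
    by (intro Bochner_Integration.integrable_bound[OF exp_integrable]) auto
  then show "\<theta> \<in> mgf_dom" by (simp add: mgf_dom_def)
qed

lemma zero_in_interior_mgf_dom: "0 \<in> interior mgf_dom"
  using ball_subset_mgf_dom \<alpha>_pos by (meson centre_in_ball interiorI open_ball)

lemma zero_in_mgf_dom: "0 \<in> mgf_dom"
  using zero_in_interior_mgf_dom interior_subset by blast

lemma mgf_zero: "mgf 0 = 1"
  by (simp add: mgf_def prob_space)

lemma continuous_on_ln_mgf: "continuous_on (interior mgf_dom) (\<lambda>\<theta>. ln (mgf \<theta>))"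
proof -
  have "convex_on (interior mgf_dom) mgf"
    unfolding convex_on_def
  proof (intro conjI ballI allI impI)
    show "convex (interior mgf_dom)" by (intro convex_interior convex_mgf_dom)
    fix x y u v assume "x \<in> interior mgf_dom" "y \<in> interior mgf_dom" "0 \<le> u" "0 \<le> v" "u + v = (1::real)"
    then show "mgf (u *\<^sub>R x + v *\<^sub>R y) \<le> u * mgf x + v * mgf y"
      using interior_subset by (intro integrable_convex_comb(2)) auto
  qed
  then have "continuous_on (interior mgf_dom) mgf" by (intro convex_on_continuous) auto
  moreover have "mgf \<theta> \<noteq> 0" if "\<theta> \<in> interior mgf_dom" for \<theta>
    using mgf_pos[of \<theta>] that interior_subset by fastforce
  ultimately show ?thesis by (intro continuous_on_ln) auto
qed

text \<open>Convexity of the cumulant generating function on the ray from 0, where it vanishes.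
  Convexity of exp is applied pointwise to \<open>\<theta> \<bullet> y - L\<close> and 0. With L the
  logarithm of \<open>mgf \<theta>\<close>, the right-hand side integrates to exactly 1.\<close>

lemma scaleR_mem_mgf_dom:
  assumes "\<theta> \<in> mgf_dom" "0 \<le> t" "t \<le> 1"
  shows "t *\<^sub>R \<theta> \<in> mgf_dom" and "ln (mgf (t *\<^sub>R \<theta>)) \<le> t * ln (mgf \<theta>)"
proof -
  show dom: "t *\<^sub>R \<theta> \<in> mgf_dom"
    using integrable_convex_comb(1)[OF assms(1) zero_in_mgf_dom assms(2), of "1 - t"] assms by simp
  define L where "L = ln (mgf \<theta>)"
  have mgf: "mgf \<theta> = exp L" using mgf_pos[OF assms(1)] by (simp add: L_def)
  have le: "exp (- (t * L)) * exp (t *\<^sub>R \<theta> \<bullet> y) \<le> t * exp (- L) * exp (\<theta> \<bullet> y) + (1 - t)" for y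
    using exp_convex_comb[of t "1 - t" "\<theta> \<bullet> y - L" 0] assms
    by (simp add: right_diff_distrib exp_diff exp_minus divide_inverse mult_ac)
  have "exp (- (t * L)) * mgf (t *\<^sub>R \<theta>) = (\<integral>\<omega>. exp (- (t * L)) * exp (t *\<^sub>R \<theta> \<bullet> Y \<omega>) \<partial>M)"
    by (simp add: mgf_def)
  also have "\<dots> \<le> (\<integral>\<omega>. t * exp (- L) * exp (\<theta> \<bullet> Y \<omega>) + (1 - t) \<partial>M)"
    using assms(1) dom by (intro integral_mono le) (auto simp: mgf_dom_def)
  also have "\<dots> = t * exp (- L) * mgf \<theta> + (1 - t)"
    using assms(1) by (simp add: mgf_def mgf_dom_def prob_space)
  also have "\<dots> = 1" by (simp add: mgf exp_minus)
  finally have "mgf (t *\<^sub>R \<theta>) \<le> exp (t * L)" by (simp add: exp_minus field_simps)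
  then have "ln (mgf (t *\<^sub>R \<theta>)) \<le> ln (exp (t * L))" using mgf_pos[OF dom] by (subst ln_le_cancel_iff) auto
  then show "ln (mgf (t *\<^sub>R \<theta>)) \<le> t * ln (mgf \<theta>)" by (simp add: L_def)
qed

end

lemma (in prob_space) exists_trunc_level:
  fixes Y :: "'a \<Rightarrow> 'v::euclidean_space"
  assumes [measurable]: "Y \<in> borel_measurable M"
  obtains K :: nat where "0 < prob {\<omega>\<in>space M. norm (Y \<omega>) \<le> real K}"
proof -
  have "\<exists>K::nat. 0 < prob {\<omega>\<in>space M. norm (Y \<omega>) \<le> real K}"
  proof (rule ccontr)
    assume "\<not> ?thesis"
    then have 0: "prob {\<omega>\<in>space M. norm (Y \<omega>) \<le> real K} = 0" for K
      by (metis measure_nonneg order_less_le)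
    have "AE \<omega> in M. \<not> norm (Y \<omega>) \<le> real K" for K
      using 0[of K] by (intro AE_I[where N = "{\<omega>\<in>space M. norm (Y \<omega>) \<le> real K}"]) (auto simp: emeasure_eq_measure)
    then have "AE \<omega> in M. \<forall>K::nat. \<not> norm (Y \<omega>) \<le> real K" by (simp add: AE_all_countable)
    then have "AE \<omega> in M. False" by eventually_elim (use real_arch_simple in blast)
    then show False by simp
  qed
  then show thesis using that by blast
qed

section \<open>The extended integral\<close>

lemma ext_integral_eq_integral:
  assumes h: "integrable R h" and eq: "AE y in R. g y = ereal (h y)"
  shows "ext_integral R g = ereal (\<integral>y. h y \<partial>R)"
proof -
  have "(\<integral>\<^sup>+y. e2ennreal (g y) \<partial>R) = (\<integral>\<^sup>+y. ennreal (h y) \<partial>R)"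
    using eq by (intro nn_integral_cong_AE, eventually_elim) simp
  moreover have "(\<integral>\<^sup>+y. e2ennreal (- g y) \<partial>R) = (\<integral>\<^sup>+y. ennreal (- h y) \<partial>R)"
    using eq by (intro nn_integral_cong_AE, eventually_elim) simp
  moreover obtain p q where "(\<integral>\<^sup>+y. ennreal (h y) \<partial>R) = ennreal p" "0 \<le> p"
    "(\<integral>\<^sup>+y. ennreal (- h y) \<partial>R) = ennreal q" "0 \<le> q" "integral\<^sup>L R h = p - q"
    using real_lebesgue_integral_def[OF h] real_integrable_def[of R h] h
    by (cases "\<integral>\<^sup>+y. ennreal (h y) \<partial>R"; cases "\<integral>\<^sup>+y. ennreal (- h y) \<partial>R") auto
  ultimately show ?thesis by (simp add: ext_integral_def)
qed

text \<open>The lower bound makes the negative part finite, so the value is not a difference of two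
  infinities and its finiteness forces the positive part to be finite.\<close>

lemma (in finite_measure) ext_integral_finiteE:
  assumes g: "g \<in> borel_measurable M" and lb: "AE y in M. ereal (- B) \<le> g y" and fin: "ext_integral M g < \<infinity>"
  obtains h where "integrable M h" "AE y in M. g y = ereal (h y)"
proof -
  define P where "P = (\<integral>\<^sup>+y. e2ennreal (g y) \<partial>M)"
  define N where "N = (\<integral>\<^sup>+y. e2ennreal (- g y) \<partial>M)"
  note [measurable] = g
  have "N \<le> (\<integral>\<^sup>+y. ennreal B \<partial>M)"
    unfolding N_def using lb
  proof (intro nn_integral_mono_AE, eventually_elim)
    case (elim y)
    then have "- g y \<le> ereal B" by (cases "g y") auto
    then have "e2ennreal (- g y) \<le> e2ennreal (ereal B)" by (rule e2ennreal_mono)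
    then show ?case by (simp)
  qed
  also have "\<dots> < \<infinity>" by (simp add: ennreal_mult_eq_top_iff less_top[symmetric] emeasure_eq_measure)
  finally have N: "N < \<infinity>" .
  have P: "P < \<infinity>"
  proof (rule ccontr)
    assume "\<not> P < \<infinity>"
    then have "P = \<infinity>" by (metis infinity_ennreal_def top.not_eq_extremum)
    with N fin show False
      unfolding ext_integral_def P_def[symmetric] N_def[symmetric]
      by (cases N) (auto simp: less_top[symmetric])
  qed
  have "AE y in M. e2ennreal (g y) \<noteq> \<infinity>"
    using P unfolding P_def by (intro nn_integral_PInf_AE) auto
  with lb have eq: "AE y in M. g y = ereal (real_of_ereal (g y))"
  proof eventually_elim
    case (elim y)
    then show ?case by (cases "g y") (auto simp: e2ennreal_infty)
  qed
  have "(\<integral>\<^sup>+y. ennreal (norm (real_of_ereal (g y))) \<partial>M) = (\<integral>\<^sup>+y. e2ennreal (g y) + e2ennreal (- g y) \<partial>M)"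
    using eq
  proof (intro nn_integral_cong_AE, eventually_elim)
    case (elim y)
    then obtain r where "g y = ereal r" by blast
    then show ?case by (cases "0 \<le> r") (auto simp: ennreal_neg)
  qed
  also have "\<dots> = P + N" unfolding P_def N_def by (intro nn_integral_add) auto
  finally have "integrable M (\<lambda>y. real_of_ereal (g y))"
    using P N by (intro integrableI_bounded) auto
  from that[OF this eq] show thesis .
qed

text \<open>The functions may be negative, so monotone convergence is first applied to
  \<open>h k y - h 0 y\<close>. This gives a finite supremum almost everywhere, after which the
  signed functions converge to an integrable limit.\<close>

lemma ext_integral_SUP_le:
  assumes int: "\<And>k. integrable R (h k)"
    and mono: "\<And>y. y \<in> space R \<Longrightarrow> incseq (\<lambda>k. h k y)"
    and le: "\<And>k. (\<integral>y. h k y \<partial>R) \<le> s"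
  shows "ext_integral R (\<lambda>y. SUP k. ereal (h k y)) \<le> ereal s"
proof -
  note [measurable] = borel_measurable_integrable[OF int]
  have inc: "incseq (\<lambda>k. \<integral>y. h k y \<partial>R)"
    using mono unfolding incseq_def by (intro allI impI integral_mono int) (auto simp: incseq_def)
  have "(\<integral>\<^sup>+y. (SUP k. ennreal (h k y - h 0 y)) \<partial>R) = (SUP k. \<integral>\<^sup>+y. ennreal (h k y - h 0 y) \<partial>R)"
    using mono by (intro nn_integral_monotone_convergence_SUP_AE) (auto simp: incseq_def intro!: ennreal_leI)
  also have "\<dots> \<le> ennreal (s - (\<integral>y. h 0 y \<partial>R))"
  proof (intro SUP_least)
    fix k
    have "(\<integral>\<^sup>+y. ennreal (h k y - h 0 y) \<partial>R) = ennreal (\<integral>y. h k y - h 0 y \<partial>R)"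
      using mono int by (intro nn_integral_eq_integral) (auto simp: incseq_def)
    also have "\<dots> \<le> ennreal (s - (\<integral>y. h 0 y \<partial>R))"
      using le[of k] int by (intro ennreal_leI) simp
    finally show "(\<integral>\<^sup>+y. ennreal (h k y - h 0 y) \<partial>R) \<le> ennreal (s - (\<integral>y. h 0 y \<partial>R))" .
  qed
  finally have "(\<integral>\<^sup>+y. (SUP k. ennreal (h k y - h 0 y)) \<partial>R) \<noteq> \<infinity>"
    by (auto simp: top_unique)
  then have "AE y in R. (SUP k. ennreal (h k y - h 0 y)) \<noteq> \<infinity>"
    by (intro nn_integral_PInf_AE) auto
  then have lim: "AE y in R. \<exists>r. (SUP k. ereal (h k y)) = ereal r \<and> (\<lambda>k. h k y) \<longlonglongrightarrow> r"
  proof (rule AE_mp, intro AE_I2 impI)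
    fix y assume y: "y \<in> space R" "(SUP k. ennreal (h k y - h 0 y)) \<noteq> \<infinity>"
    then obtain b where b: "0 \<le> b" "(SUP k. ennreal (h k y - h 0 y)) = ennreal b"
      by (cases "SUP k. ennreal (h k y - h 0 y)") auto
    have "h k y \<le> h 0 y + b" for k
    proof -
      have "ennreal (h k y - h 0 y) \<le> ennreal b" unfolding b(2)[symmetric] by (rule SUP_upper) simp
      with b(1) show ?thesis by (simp add: ennreal_le_iff)
    qed
    then obtain r where r: "(\<lambda>k. h k y) \<longlonglongrightarrow> r" "\<And>k. h k y \<le> r"
      using mono[OF y(1)] by (metis incseq_convergent)
    have "(SUP k. ereal (h k y)) = ereal r"
      using mono[OF y(1)] r(1) by (intro SUP_Lim) (auto simp: incseq_def)
    with r show "\<exists>r. (SUP k. ereal (h k y)) = ereal r \<and> (\<lambda>k. h k y) \<longlonglongrightarrow> r" by blast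
  qed
  define H where "H y = real_of_ereal (SUP k. ereal (h k y))" for y
  have [measurable]: "H \<in> borel_measurable R" unfolding H_def by measurable
  obtain l where l: "(\<lambda>k. \<integral>y. h k y \<partial>R) \<longlonglongrightarrow> l" using inc le by (meson incseq_convergent)
  have "has_bochner_integral R H l"
    using mono lim
    by (intro has_bochner_integral_monotone_convergence[of R h, OF int _ _ l]) (auto simp: H_def)
  moreover have "l \<le> s" using l le by (intro LIMSEQ_le_const2) auto
  ultimately show ?thesis
    using lim by (subst ext_integral_eq_integral[of R H]) (auto simp: has_bochner_integral_iff H_def)
qed

section \<open>Matrix estimates\<close>

lemma vector_matrix_mult_eq_sum: "(l::real^'m) v* A = (\<Sum>k\<in>UNIV. l $ k *\<^sub>R (A::real^'d^'m) $ k)"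
  by (simp add: vec_eq_iff vector_matrix_mult_def mult.commute)

lemma norm_vector_matrix_mult_le:
  fixes A :: "real^'d^'m"
  shows "norm (l v* A) \<le> real CARD('m) * norm l * norm A"
proof -
  have "norm (l v* A) \<le> (\<Sum>k\<in>UNIV. norm (l $ k *\<^sub>R A $ k))"
    unfolding vector_matrix_mult_eq_sum by (rule norm_sum)
  also have "\<dots> \<le> (\<Sum>k\<in>(UNIV::'m set). norm l * norm A)"
    by (intro sum_mono) (simp add: mult_mono component_le_norm_cart Finite_Cartesian_Product.norm_nth_le)
  finally show ?thesis by simp
qed

text \<open>By duality from the bound for \<open>l v* A\<close> with \<open>l = A *v y\<close>,
  dividing by the norm of \<open>A *v y\<close>.\<close>

lemma norm_matrix_vector_mult_le:
  fixes A :: "real^'d^'m"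
  shows "norm (A *v y) \<le> real CARD('m) * norm A * norm y"
proof (cases "A *v y = 0")
  case False
  have "norm (A *v y) * norm (A *v y) = ((A *v y) v* A) \<bullet> y"
    by (simp add: dot_lmul_matrix flip: power2_eq_square power2_norm_eq_inner)
  also have "\<dots> \<le> norm ((A *v y) v* A) * norm y" by (rule norm_cauchy_schwarz)
  also have "\<dots> \<le> real CARD('m) * norm (A *v y) * norm A * norm y"
    by (intro mult_right_mono norm_vector_matrix_mult_le) auto
  finally have "norm (A *v y) * norm (A *v y) \<le> norm (A *v y) * (real CARD('m) * norm A * norm y)"
    by (simp add: mult_ac)
  with False show ?thesis by simp
qed simp

lemma borel_measurable_matrix_vector_mult: "(\<lambda>y. (A :: real^'d^'m) *v y) \<in> borel_measurable borel"
  by (intro borel_measurable_continuous_onI linear_continuous_on linear_conv_bounded_linear[THEN iffD1]) simp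

section \<open>Penalised minimisers\<close>

text \<open>The quadratic penalty makes the superlevel sets compact, so that the supremum over the
  truncation level \<open>k\<close> passes through the supremum over \<open>l\<close>. The penalised minimiser \<open>l\<close> is the tilting
  parameter, and \<open>w = z - 4\<epsilon>l\<close> is what the gradient of \<open>G k\<close> at \<open>l\<close> would be.\<close>

lemma exists_tilt:
  fixes G :: "nat \<Rightarrow> 'v::euclidean_space \<Rightarrow> real"
  assumes cont: "\<And>k. continuous_on UNIV (G k)"
    and mono: "\<And>k k' l. k \<le> k' \<Longrightarrow> G k l \<le> G k' l"
    and lower: "\<And>l. - (A * norm l + B) \<le> G 0 l"
    and zero: "\<And>k. G k 0 \<le> 0"
    and semi: "\<And>k. \<exists>C. \<exists>r>0. \<forall>l v. norm v \<le> r \<longrightarrow> G k (l + v) + G k (l - v) \<le> 2 * G k l + C * (norm v)\<^sup>2"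
    and conj: "\<And>l. \<exists>k. l \<bullet> z - G k l < c"
    and e: "0 < e"
  obtains k l w C r where "dist z w < e" "l \<bullet> w - G k l < c" "0 < r"
    "\<forall>v. norm v \<le> r \<longrightarrow> G k (l + v) \<le> G k l + v \<bullet> w + C * (norm v)\<^sup>2"
proof -
  obtain k0 where "0 \<bullet> z - G k0 0 < c" using conj by blast
  then have c: "0 < c" using zero[of k0] by simp
  \<comment> \<open>The minimiser l found below satisfies
    \<open>\<epsilon> * (norm l)\<^sup>2 < c\<close>, so the squared distance from z to w is below
    16 * \<epsilon> * c, which is half of \<open>e\<^sup>2\<close>.\<close>
  define \<epsilon> where "\<epsilon> = e\<^sup>2 / (32 * c)"
  have \<epsilon>: "0 < \<epsilon>" using c e by (simp add: \<epsilon>_def)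
  have G_lower: "- (\<bar>A\<bar> * norm l + \<bar>B\<bar>) \<le> G k l" for k l
  proof -
    have "A * norm l \<le> \<bar>A\<bar> * norm l" by (intro mult_right_mono) auto
    then show ?thesis using lower[of l] mono[of 0 k l] by linarith
  qed
  \<comment> \<open>The penalty outgrows the linear bounds on - G k l and on
    \<open>l \<bullet> z\<close>. The radius does not depend on k.\<close>
  have coercive: "norm l < (\<bar>A\<bar> + norm z + \<bar>B\<bar> + \<bar>s\<bar>) / \<epsilon> + 1"
    if s: "s \<le> l \<bullet> z - G k l - \<epsilon> * (norm l)\<^sup>2" for s k l
  proof (rule ccontr)
    define D where "D = \<bar>A\<bar> + norm z + \<bar>B\<bar> + \<bar>s\<bar>"
    assume "\<not> ?thesis"
    then have n: "D / \<epsilon> + 1 \<le> norm l" by (simp add: D_def)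
    have D: "0 \<le> D" by (simp add: D_def)
    then have n1: "1 \<le> norm l" using n \<epsilon> by (smt (verit) divide_nonneg_pos)
    have "D / \<epsilon> < norm l" using n by simp
    then have "D < \<epsilon> * norm l" using \<epsilon> by (simp add: pos_divide_less_eq mult.commute)
    then have "D * norm l < \<epsilon> * norm l * norm l" using n1 by (intro mult_strict_right_mono) auto
    moreover have "D * norm l = \<bar>A\<bar> * norm l + norm z * norm l + (\<bar>B\<bar> + \<bar>s\<bar>) * norm l"
      by (simp add: D_def algebra_simps)
    moreover have "(\<bar>B\<bar> + \<bar>s\<bar>) * 1 \<le> (\<bar>B\<bar> + \<bar>s\<bar>) * norm l" using n1 by (intro mult_left_mono) auto
    moreover have "l \<bullet> z \<le> norm z * norm l" using norm_cauchy_schwarz[of l z] by (simp add: mult.commute)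
    ultimately show False using s G_lower[of l k] by (simp add: power2_eq_square)
  qed
  have "\<exists>k. \<forall>l. l \<bullet> z - G k l - \<epsilon> * (norm l)\<^sup>2 < c"
  proof (rule ccontr)
    assume no: "\<not> ?thesis"
    define S where "S k = {l. c \<le> l \<bullet> z - G k l - \<epsilon> * (norm l)\<^sup>2}" for k
    have "\<Inter> (range S) \<noteq> {}"
    proof (rule compact_nest)
      fix k
      have "closed (S k)"
        unfolding S_def by (intro closed_Collect_le continuous_intros cont)
      moreover have "S k \<subseteq> ball 0 ((\<bar>A\<bar> + norm z + \<bar>B\<bar> + \<bar>c\<bar>) / \<epsilon> + 1)"
        using coercive[of c _ k] by (auto simp: S_def)
      ultimately show "compact (S k)"
        using bounded_subset[OF bounded_ball] by (auto simp: compact_eq_bounded_closed)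
      show "S k \<noteq> {}" using no by (auto simp: S_def not_less)
    next
      fix k k' :: nat assume "k \<le> k'"
      show "S k' \<subseteq> S k"
      proof
        fix l assume "l \<in> S k'"
        with mono[OF \<open>k \<le> k'\<close>, of l] show "l \<in> S k" by (simp add: S_def)
      qed
    qed
    then obtain l where l: "\<And>k. l \<in> S k" by blast
    obtain k where "l \<bullet> z - G k l < c" using conj by blast
    moreover have "0 \<le> \<epsilon> * (norm l)\<^sup>2" using \<epsilon> by simp
    ultimately show False using l[of k] by (simp add: S_def)
  qed
  then obtain k where k: "\<And>l. l \<bullet> z - G k l - \<epsilon> * (norm l)\<^sup>2 < c" by blast
  \<comment> \<open>The penalty is doubled compared with the choice of k: \<Psi> is at most \<Psi> 0
    \<le> 0 at its minimiser, while the inequality \<open>k\<close> pays for one copy only. The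
    other copy is then bounded by c, which is \<open>small\<close> below.\<close>
  define \<Psi> where "\<Psi> l = G k l - l \<bullet> z + 2 * \<epsilon> * (norm l)\<^sup>2" for l
  define r where "r = (\<bar>A\<bar> + norm z + \<bar>B\<bar> + \<bar>\<Psi> 0\<bar>) / \<epsilon> + 1"
  have "0 \<le> r" using \<epsilon> by (simp add: r_def)
  then have "\<exists>l\<in>cball 0 r. \<forall>l'\<in>cball 0 r. \<Psi> l \<le> \<Psi> l'"
    unfolding \<Psi>_def by (intro continuous_attains_inf continuous_intros continuous_on_subset[OF cont]) auto
  then obtain l where l: "l \<in> cball 0 r" "\<And>l'. l' \<in> cball 0 r \<Longrightarrow> \<Psi> l \<le> \<Psi> l'" by blast
  \<comment> \<open>The minimum over the ball is global: by coercivity every point with \<Psi> at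
    most \<Psi> 0 lies in the ball.\<close>
  have min: "\<Psi> l \<le> \<Psi> l'" for l'
  proof (cases "\<Psi> l' \<le> \<Psi> 0")
    case True
    have "0 \<le> \<epsilon> * (norm l')\<^sup>2" using \<epsilon> by simp
    with True have "- \<bar>\<Psi> 0\<bar> \<le> l' \<bullet> z - G k l' - \<epsilon> * (norm l')\<^sup>2" by (simp add: \<Psi>_def)
    from coercive[OF this] have "l' \<in> cball 0 r" by (simp add: r_def)
    then show ?thesis by (rule l(2))
  next
    case False
    with l(2)[of 0] \<open>0 \<le> r\<close> show ?thesis by simp
  qed
  define w where "w = z - (4 * \<epsilon>) *\<^sub>R l"
  have small: "\<epsilon> * (norm l)\<^sup>2 < c"
    using k[of l] min[of 0] zero[of k] by (simp add: \<Psi>_def)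
  have lw: "l \<bullet> w - G k l < c"
  proof -
    have "l \<bullet> w = l \<bullet> z - 4 * \<epsilon> * (norm l)\<^sup>2"
      by (simp add: w_def inner_diff_right power2_norm_eq_inner)
    moreover have "0 \<le> \<epsilon> * (norm l)\<^sup>2" using \<epsilon> by simp
    ultimately show ?thesis using k[of l] by simp
  qed
  have "(4 * \<epsilon> * norm l)\<^sup>2 = 16 * \<epsilon> * (\<epsilon> * (norm l)\<^sup>2)" by (simp add: power2_eq_square)
  also have "\<dots> < 16 * \<epsilon> * c" using small \<epsilon> by simp
  also have "\<dots> < e\<^sup>2" using c e by (simp add: \<epsilon>_def)
  finally have "4 * \<epsilon> * norm l < e" using e by (intro power2_less_imp_less[of _ e]) simp_all
  then have dist: "dist z w < e" using \<epsilon> by (simp add: w_def dist_norm)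
  obtain C r' where r': "0 < r'" "\<And>l v. norm v \<le> r' \<Longrightarrow> G k (l + v) + G k (l - v) \<le> 2 * G k l + C * (norm v)\<^sup>2"
    using semi[of k] by blast
  \<comment> \<open>Minimality at l bounds G k (l - v) from below with slope w; semiconcavity
    reflects this into an upper bound at l + v. No derivative of G k is involved.\<close>
  have "G k (l + v) \<le> G k l + v \<bullet> w + (C + 2 * \<epsilon>) * (norm v)\<^sup>2" if "norm v \<le> r'" for v
  proof -
    have "(norm (l - v))\<^sup>2 = (norm l)\<^sup>2 - 2 * (l \<bullet> v) + (norm v)\<^sup>2"
      by (simp add: power2_norm_eq_inner inner_diff_left inner_diff_right inner_commute)
    with min[of "l - v"] have "G k l - v \<bullet> w - 2 * \<epsilon> * (norm v)\<^sup>2 \<le> G k (l - v)"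
      by (simp add: \<Psi>_def w_def inner_diff_left inner_diff_right inner_commute algebra_simps)
    with r'(2)[OF that, of l] show ?thesis by (simp add: algebra_simps)
  qed
  with dist lw r'(1) show thesis by (intro that[of w l k r' "C + 2 * \<epsilon>"]) auto
qed

section \<open>Averages over the bulk points\<close>

lemma space_eq_of_sets_restrict_borel: "sets R = sets (restrict_space borel X) \<Longrightarrow> space R = X"
  by (simp add: sets_eq_imp_space_eq space_restrict_space)

lemma borel_Int_in_sets_restrict:
  assumes "sets R = sets (restrict_space borel X)" "U \<in> sets borel"
  shows "U \<inter> X \<in> sets R"
  using assms by (auto simp: sets_restrict_space)

lemma openin_in_sets_restrict:
  fixes X :: "'x::topological_space set"
  assumes "sets R = sets (restrict_space borel X)" "openin (top_of_set X) U"
  shows "U \<in> sets R"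
proof -
  obtain V where "open V" "U = X \<inter> V" using assms(2) by (auto simp: openin_open)
  then show ?thesis using borel_Int_in_sets_restrict[OF assms(1), of V] by (simp add: Int_commute)
qed

text \<open>The complement of the support is covered by balls of measure zero, and the Lindelof
  property leaves countably many of them.\<close>

lemma AE_measure_support:
  fixes R :: "'x::euclidean_space measure"
  assumes "finite_measure R" and sets: "sets R = sets (restrict_space borel X)"
  shows "AE y in R. y \<in> measure_support R"
proof -
  interpret finite_measure R by fact
  have sp: "space R = X" using sets by (rule space_eq_of_sets_restrict_borel)
  define F where "F = {ball y e | y e. measure R (ball y e \<inter> X) = 0}"
  obtain F' where F': "F' \<subseteq> F" "countable F'" "\<Union>F' = \<Union>F"
    by (rule Lindelof[of F]) (auto simp: F_def)
  have "(\<Union>B\<in>F'. B \<inter> X) \<in> null_sets R"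
  proof (rule null_sets_UN'[OF F'(2)])
    fix B assume "B \<in> F'"
    with F' obtain y e where B: "B = ball y e" "measure R (ball y e \<inter> X) = 0" by (auto simp: F_def)
    moreover have "ball y e \<inter> X \<in> sets R" using borel_Int_in_sets_restrict[OF sets] by simp
    ultimately show "B \<inter> X \<in> null_sets R" by (auto simp: null_sets_def emeasure_eq_measure)
  qed
  moreover have "{y\<in>space R. y \<notin> measure_support R} \<subseteq> (\<Union>B\<in>F'. B \<inter> X)"
  proof
    fix y assume y: "y \<in> {y\<in>space R. y \<notin> measure_support R}"
    then obtain e where e: "e > 0" "\<not> measure R (ball y e \<inter> space R) > 0" by (auto simp: measure_support_def)
    then have "measure R (ball y e \<inter> X) = 0" using sp by (simp add: not_less measure_le_0_iff)
    then have "y \<in> \<Union>F" using e by (auto simp: F_def intro!: exI[of _ "ball y e"])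
    then show "y \<in> (\<Union>B\<in>F'. B \<inter> X)" using F'(3) y sp by auto
  qed
  ultimately show ?thesis by (rule AE_I')
qed

lemma measure_support_openin_pos:
  fixes R :: "'x::euclidean_space measure"
  assumes "finite_measure R" and sets: "sets R = sets (restrict_space borel X)"
    and y: "y \<in> measure_support R" "y \<in> U" and U: "openin (top_of_set X) U"
  shows "0 < measure R U"
proof -
  interpret finite_measure R by fact
  have sp: "space R = X" using sets by (rule space_eq_of_sets_restrict_borel)
  obtain e where e: "e > 0" "ball y e \<inter> X \<subseteq> U" using U y by (meson openin_contains_ball)
  have "0 < measure R (ball y e \<inter> X)" using y e by (simp add: measure_support_def sp)
  also have "\<dots> \<le> measure R U"
    using e openin_in_sets_restrict[OF sets U] by (intro finite_measure_mono) auto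
  finally show ?thesis .
qed

lemma integrable_indicator_continuous:
  fixes R :: "'x::euclidean_space measure" and h :: "'x \<Rightarrow> real"
  assumes "finite_measure R" and sets: "sets R = sets (restrict_space borel X)"
    and S: "compact S" "S \<subseteq> X" and h: "continuous_on S h"
  shows "integrable R (\<lambda>y. indicator S y * h y)"
proof -
  interpret finite_measure R by fact
  have "(\<lambda>y. indicator S y *\<^sub>R h y) \<in> borel_measurable borel"
    using S h by (intro borel_measurable_continuous_on_indicator) (auto simp: compact_imp_closed)
  then have "(\<lambda>y. indicator S y * h y) \<in> borel_measurable (restrict_space borel X)"
    by (intro measurable_restrict_space1) simp
  then have m: "(\<lambda>y. indicator S y * h y) \<in> borel_measurable R"
    using measurable_cong_sets[OF sets refl] by blast
  obtain B where B: "\<And>y. y \<in> S \<Longrightarrow> norm (h y) \<le> B"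
    using compact_imp_bounded[OF compact_continuous_image[OF h S(1)]] by (auto simp: bounded_iff)
  have "norm (indicator S y * h y) \<le> \<bar>B\<bar>" for y using B[of y] by (auto simp: indicator_def)
  then show ?thesis using m by (intro integrable_const_bound[where B = "\<bar>B\<bar>"]) auto
qed

text \<open>X need not be closed in the ambient space, so a closed e-neighbourhood taken within X is
  compact only because it fits into a compact V \<subseteq> X. The result turns a uniform distance
  bound on the bulk points into membership in W.\<close>

lemma locally_compact_neighbourhood:
  fixes X :: "'x::euclidean_space set"
  assumes X: "locally compact X" and S: "compact S" "S \<subseteq> X" "S \<noteq> {}"
    and W: "openin (top_of_set X) W" "S \<subseteq> W"
  obtains e where "0 < e" "{y\<in>X. infdist y S \<le> e} \<subseteq> W" "compact {y\<in>X. infdist y S \<le> e}"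
proof -
  obtain U V where UV: "S \<subseteq> U" "U \<subseteq> V" "V \<subseteq> X" "openin (top_of_set X) U" "compact V"
    using X[unfolded locally_compact_compact, rule_format, of S] S by auto
  have "openin (top_of_set X) (U \<inter> W)" using UV W by (intro openin_Int) auto
  then obtain O' where O': "open O'" "U \<inter> W = X \<inter> O'" by (auto simp: openin_open)
  have "S \<subseteq> O'" using O' UV W by blast
  then obtain e where e: "0 < e" "{y. infdist y S \<le> e} \<subseteq> O'"
    using compact_in_open_separated[OF S(3,1) O'(1)] by blast
  have sub: "{y\<in>X. infdist y S \<le> e} \<subseteq> U \<inter> W" using e O' by blast
  have "{y\<in>X. infdist y S \<le> e} = V \<inter> {y. infdist y S \<le> e}" using sub UV by blast
  moreover have "closed {y. infdist y S \<le> e}" by (intro closed_Collect_le continuous_intros)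
  ultimately have "compact {y\<in>X. infdist y S \<le> e}" using UV by (simp add: compact_Int_closed)
  with e sub show thesis by (intro that[of e]) auto
qed

text \<open>Weak convergence tests bounded continuous functions on X, whereas h is controlled only
  near the support. It is restricted to a compact neighbourhood N and extended to X with the same
  bound by Tietze's theorem. The bulk points eventually lie in N, and the at most T excluded indices
  contribute O(1/n).\<close>

lemma bulk_average_tendsto:
  fixes X :: "(real^'p) set" and h :: "real^'p \<Rightarrow> real"
  assumes X: "locally compact X" and xX: "\<forall>n. \<forall>i\<in>{1..n}. x n i \<in> X"
    and R: "prob_space R" "sets R = sets (restrict_space borel X)"
    and weak: "\<forall>g :: real^'p \<Rightarrow> real. continuous_on X g \<and> bounded (g ` X) \<longrightarrow>
          (\<lambda>n. (1 / real n) * (\<Sum>i=1..n. g (x n i))) \<longlonglongrightarrow> (\<integral>y. g y \<partial>R)"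
    and S: "compact S" "S \<subseteq> X" "S \<noteq> {}" "AE y in R. y \<in> S"
    and bulk: "\<forall>e>0. \<forall>\<^sub>F n in sequentially. \<forall>i\<in>{1..n} - J n. infdist (x n i) S \<le> e"
    and J: "\<And>n. finite (J n)" "\<And>n. card (J n) \<le> T"
    and W: "openin (top_of_set X) W" "S \<subseteq> W" and h: "continuous_on W h"
  shows "(\<lambda>n. (1 / real n) * (\<Sum>i\<in>{1..n} - J n. h (x n i))) \<longlonglongrightarrow> (\<integral>y. indicator S y * h y \<partial>R)"
proof -
  interpret R: prob_space R by fact
  obtain e where e: "0 < e" "{y\<in>X. infdist y S \<le> e} \<subseteq> W" "compact {y\<in>X. infdist y S \<le> e}"
    using locally_compact_neighbourhood[OF X S(1-3) W] by blast
  define N where "N = {y\<in>X. infdist y S \<le> e}"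
  have hN: "continuous_on N h" using continuous_on_subset[OF h] e by (simp add: N_def)
  have "bounded (h ` N)"
    using e by (intro compact_imp_bounded compact_continuous_image hN) (simp add: N_def)
  then obtain B where "0 < B" "\<forall>y\<in>N. norm (h y) \<le> B" by (auto simp: bounded_pos)
  then have B: "\<And>y. y \<in> N \<Longrightarrow> norm (h y) \<le> B" "0 \<le> B" by auto
  have "closedin (top_of_set X) N"
    using e by (intro closed_subset compact_imp_closed) (auto simp: N_def)
  then obtain g where g: "continuous_on X g" "\<And>y. y \<in> N \<Longrightarrow> g y = h y" "\<And>y. y \<in> X \<Longrightarrow> norm (g y) \<le> B"
    using Tietze[OF hN _ B(2,1)] by blast
  have "bounded (g ` X)" using g(3) by (auto simp: bounded_iff)
  with weak g have lim1: "(\<lambda>n. (1 / real n) * (\<Sum>i=1..n. g (x n i))) \<longlonglongrightarrow> (\<integral>y. g y \<partial>R)" by blast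
  have lim2: "(\<lambda>n. (1 / real n) * (\<Sum>i\<in>{1..n} \<inter> J n. g (x n i))) \<longlonglongrightarrow> 0"
  proof (rule Lim_null_comparison)
    show "\<forall>\<^sub>F n in sequentially. norm ((1 / real n) * (\<Sum>i\<in>{1..n} \<inter> J n. g (x n i))) \<le> (real T * B) * (1 / real n)"
    proof (intro always_eventually allI)
      fix n
      have "norm (\<Sum>i\<in>{1..n} \<inter> J n. g (x n i)) \<le> real (card ({1..n} \<inter> J n)) * B"
        using xX g(3) by (intro sum_norm_bound) auto
      also have "\<dots> \<le> real T * B"
        using B J card_mono[OF J(1), of "{1..n} \<inter> J n" n] order_trans by (intro mult_right_mono) (auto, fastforce)
      finally show "norm ((1 / real n) * (\<Sum>i\<in>{1..n} \<inter> J n. g (x n i))) \<le> (real T * B) * (1 / real n)"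
        by (simp add: divide_right_mono)
    qed
    show "(\<lambda>n. (real T * B) * (1 / real n)) \<longlonglongrightarrow> 0"
      by (intro tendsto_mult_right_zero lim_1_over_n)
  qed
  have "(\<integral>y. g y \<partial>R) = (\<integral>y. indicator S y * h y \<partial>R)"
  proof (intro integral_cong_AE)
    show "AE y in R. g y = indicator S y * h y"
      using S(4)
    proof eventually_elim
      case (elim y)
      then have "y \<in> N" using S e(1) by (auto simp: N_def)
      then show ?case using g(2) elim by simp
    qed
    have "g \<in> borel_measurable (restrict_space borel X)"
      by (rule borel_measurable_continuous_on_restrict[OF g(1)])
    then show "g \<in> borel_measurable R" using measurable_cong_sets[OF R(2) refl] by blast
    show "(\<lambda>y. indicator S y * h y) \<in> borel_measurable R"
      using integrable_indicator_continuous[OF R.finite_measure_axioms R(2) S(1,2) continuous_on_subset[OF h W(2)]]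
      by (rule borel_measurable_integrable)
  qed
  with tendsto_diff[OF lim1 lim2]
  have "(\<lambda>n. (1 / real n) * (\<Sum>i=1..n. g (x n i)) - (1 / real n) * (\<Sum>i\<in>{1..n} \<inter> J n. g (x n i)))
      \<longlonglongrightarrow> (\<integral>y. indicator S y * h y \<partial>R)" by simp
  moreover have "\<forall>\<^sub>F n in sequentially. (1 / real n) * (\<Sum>i=1..n. g (x n i)) - (1 / real n) * (\<Sum>i\<in>{1..n} \<inter> J n. g (x n i))
      = (1 / real n) * (\<Sum>i\<in>{1..n} - J n. h (x n i))"
    using bulk[rule_format, OF e(1)]
  proof eventually_elim
    case (elim n)
    have "(\<Sum>i\<in>{1..n} - J n. h (x n i)) = (\<Sum>i\<in>{1..n} - J n. g (x n i))"
      using elim xX by (intro sum.cong refl g(2)[symmetric]) (auto simp: N_def)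
    moreover have "(\<Sum>i=1..n. g (x n i)) = (\<Sum>i\<in>{1..n} \<inter> J n. g (x n i)) + (\<Sum>i\<in>{1..n} - J n. g (x n i))"
      by (rule sum.Int_Diff) simp
    ultimately show ?case by (simp add: algebra_simps)
  qed
  ultimately show ?thesis by (rule Lim_transform_eventually)
qed

section \<open>Large deviations of the bulk\<close>

lemma half_scaled:
  fixes a d :: real
  shows "0 \<le> a \<Longrightarrow> d / (2 * (a + 1)) * (a + 1) = d / 2"
  by (simp add: field_simps)

text \<open>Room for shrinking l to \<open>t *\<^sub>R l\<close> in the upper bound. For d \<le> 0
  shrinking does not decrease t * d, so any t in (0, 1) works.\<close>

lemma less_scaled_real:
  fixes c d :: real
  assumes "c < d"
  obtains t where "0 < t" "t < 1" "c < t * d"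
proof (cases "0 < d")
  case True
  with assms obtain s where "max c 0 < s" "s < d" by (metis dense max_less_iff_conj)
  with True show thesis by (intro that[of "s / d"]) auto
next
  case False
  with assms show thesis by (intro that[of "1/2"]) auto
qed

text \<open>The bulk points enter only through \<open>near\<close> and \<open>average\<close>, so
  outliers are invisible here. The test function h is continuous only on a neighbourhood W of the
  support because \<open>ln (mgf (l v* f y))\<close> is controlled only where
  \<open>l v* f y\<close> is interior to the domain.\<close>

locale weighted_bulk = exp_moment M Y K0 \<alpha>
  for M :: "'a measure" and Y :: "'a \<Rightarrow> real^'d" and K0 :: nat and \<alpha> :: real +
  fixes Z :: "nat \<Rightarrow> 'a \<Rightarrow> real^'d" and X :: "(real^'p) set" and f :: "real^'p \<Rightarrow> real^'d^'m" and x :: "nat \<Rightarrow> nat \<Rightarrow> real^'p"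
    and R :: "(real^'p) measure" and A :: "nat \<Rightarrow> nat set"
  assumes indep: "indep_vars (\<lambda>_. borel) Z {1..}"
    and distr: "\<And>i. 1 \<le> i \<Longrightarrow> distr M borel (Z i) = distr M borel Y"
    and f_cont: "continuous_on X f"
    and R_prob: "prob_space R"
    and R_sets: "sets R = sets (restrict_space borel X)"
    and supp_compact: "compact (measure_support R)"
    and A_subset: "A n \<subseteq> {1..n}"
    and near: "openin (top_of_set X) W \<Longrightarrow> measure_support R \<subseteq> W \<Longrightarrow> \<forall>\<^sub>F n in sequentially. \<forall>i\<in>A n. x n i \<in> W"
    and average: "openin (top_of_set X) W \<Longrightarrow> measure_support R \<subseteq> W \<Longrightarrow> continuous_on W h \<Longrightarrow>
      (\<lambda>n. (1 / real n) * (\<Sum>i\<in>A n. h (x n i))) \<longlonglongrightarrow> (\<integral>y. indicator (measure_support R) y * h y \<partial>R)"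
begin

abbreviation S :: "(real^'p) set" where "S \<equiv> measure_support R"

definition bulk :: "nat \<Rightarrow> 'a \<Rightarrow> real^'m" where
  "bulk n \<omega> = (1 / real n) *\<^sub>R (\<Sum>i\<in>A n. f (x n i) *v Z i \<omega>)"

abbreviation Gam :: "real^'m \<Rightarrow> ereal" where "Gam \<equiv> Gamma_fun M Y R f"

definition trunc_Gam :: "nat \<Rightarrow> real^'m \<Rightarrow> real" where
  "trunc_Gam k l = (\<integral>y. trunc_cgf k (l v* f y) \<partial>R)"

sublocale R: prob_space R by (rule R_prob)

lemma R_finite: "finite_measure R" by unfold_locales

lemma space_R: "space R = X"
  using R_sets by (rule space_eq_of_sets_restrict_borel)

lemma S_subset: "S \<subseteq> X"
  by (auto simp: measure_support_def space_R)

lemma AE_S: "AE y in R. y \<in> S"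
  by (rule AE_measure_support[OF R_finite R_sets])

lemma Gam_eq: "Gam l = ext_integral R (\<lambda>y. log_mgf M Y (l v* f y))"
  by (simp add: Gamma_fun_def vector_matrix_mult_eq_sum)

lemma continuous_on_adj: "continuous_on X (\<lambda>y. l v* f y)"
  unfolding vector_matrix_mult_eq_sum by (intro continuous_intros f_cont)

lemma continuous_on_trunc_adj: "continuous_on X (\<lambda>y. trunc_cgf k (l v* f y))"
  by (rule continuous_on_compose2[OF continuous_on_trunc_cgf continuous_on_adj]) simp

lemma borel_measurable_trunc_adj [measurable]: "(\<lambda>y. trunc_cgf k (l v* f y)) \<in> borel_measurable R"
  using borel_measurable_continuous_on_restrict[OF continuous_on_trunc_adj] measurable_cong_sets[OF R_sets refl]
  by blast

lemma integrable_trunc_adj: "integrable R (\<lambda>y. trunc_cgf k (l v* f y))"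
proof -
  have int: "integrable R (\<lambda>y. indicator S y * trunc_cgf k (l v* f y))"
    by (rule integrable_indicator_continuous[OF R_finite R_sets supp_compact S_subset
          continuous_on_subset[OF continuous_on_trunc_adj S_subset]])
  show ?thesis
    using AE_S by (intro integrable_cong_AE_imp[OF int]) (auto elim: eventually_mono)
qed

lemma trunc_Gam_average:
  "(\<lambda>n. (1 / real n) * (\<Sum>i\<in>A n. trunc_cgf k (l v* f (x n i)))) \<longlonglongrightarrow> trunc_Gam k l"
proof -
  have "(\<integral>y. indicator S y * trunc_cgf k (l v* f y) \<partial>R) = trunc_Gam k l"
    unfolding trunc_Gam_def
    using AE_S integrable_indicator_continuous[OF R_finite R_sets supp_compact S_subset
          continuous_on_subset[OF continuous_on_trunc_adj S_subset]]
    by (intro integral_cong_AE) (auto elim: eventually_mono simp: borel_measurable_integrable)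
  then show ?thesis
    using average[OF openin_subtopology_self S_subset continuous_on_trunc_adj[of k l]] by simp
qed

lemma adj_bound: obtains C where "0 < C" "\<And>y l. y \<in> S \<Longrightarrow> norm (l v* f y) \<le> C * norm l"
proof -
  have "bounded (f ` S)"
    by (intro compact_imp_bounded compact_continuous_image supp_compact continuous_on_subset[OF f_cont S_subset])
  then obtain F where F: "0 < F" "\<forall>y\<in>S. norm (f y) \<le> F" by (auto simp: bounded_pos)
  have "norm (l v* f y) \<le> real CARD('m) * F * norm l" if "y \<in> S" for y l
  proof -
    have "norm (l v* f y) \<le> real CARD('m) * norm l * norm (f y)" by (rule norm_vector_matrix_mult_le)
    also have "\<dots> \<le> real CARD('m) * norm l * F" using F that by (intro mult_left_mono) auto
    finally show ?thesis by (simp add: mult_ac)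
  qed
  with F show thesis by (intro that[of "real CARD('m) * F"]) auto
qed

lemma trunc_Gam_mono: "k \<le> k' \<Longrightarrow> trunc_Gam k l \<le> trunc_Gam k' l"
  unfolding trunc_Gam_def by (intro integral_mono integrable_trunc_adj trunc_cgf_mono)

lemma trunc_Gam_zero_le: "trunc_Gam k 0 \<le> 0"
  unfolding trunc_Gam_def by (simp add: R.prob_space trunc_cgf_zero_le)

lemma trunc_Gam_lipschitz:
  obtains C where "0 < C" "\<And>k l l'. \<bar>trunc_Gam k l - trunc_Gam k l'\<bar> \<le> real (K0 + k) * C * norm (l - l')"
proof -
  obtain C where C: "0 < C" "\<And>y l. y \<in> S \<Longrightarrow> norm (l v* f y) \<le> C * norm l" by (rule adj_bound) blast
  have le: "trunc_Gam k l - trunc_Gam k l' \<le> real (K0 + k) * C * norm (l - l')" for k l l'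
  proof -
    have "trunc_Gam k l - trunc_Gam k l' = (\<integral>y. trunc_cgf k (l v* f y) - trunc_cgf k (l' v* f y) \<partial>R)"
      by (simp add: trunc_Gam_def integrable_trunc_adj)
    also have "\<dots> \<le> (\<integral>y. real (K0 + k) * C * norm (l - l') \<partial>R)"
    proof (intro integral_mono_AE)
      show "AE y in R. trunc_cgf k (l v* f y) - trunc_cgf k (l' v* f y) \<le> real (K0 + k) * C * norm (l - l')"
        using AE_S
      proof eventually_elim
        case (elim y)
        have "trunc_cgf k (l v* f y) - trunc_cgf k (l' v* f y) \<le> real (K0 + k) * norm (l v* f y - l' v* f y)"
          by (rule trunc_cgf_diff_le)
        also have "l v* f y - l' v* f y = (l - l') v* f y"
          by (simp add: vector_matrix_mult_eq_sum algebra_simps sum_subtractf)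
        also have "real (K0 + k) * norm ((l - l') v* f y) \<le> real (K0 + k) * (C * norm (l - l'))"
          using C(2)[OF elim] by (intro mult_left_mono) auto
        finally show ?case by (simp add: mult.assoc)
      qed
    qed (auto simp: integrable_trunc_adj)
    finally show ?thesis by (simp add: R.prob_space)
  qed
  have "\<bar>trunc_Gam k l - trunc_Gam k l'\<bar> \<le> real (K0 + k) * C * norm (l - l')" for k l l'
    using le[of k l l'] le[of k l' l] by (simp add: abs_le_iff norm_minus_commute)
  with C(1) show thesis by (rule that)
qed

text \<open>Pointwise semiconcavity limits the size of \<open>v v* f y\<close>. Compactness of the
  support bounds f there, so one radius serves all y; writing D + 1 avoids dividing by 0.\<close>

lemma trunc_Gam_semiconcave:
  "\<exists>C. \<exists>r>0. \<forall>l v. norm v \<le> r \<longrightarrow> trunc_Gam k (l + v) + trunc_Gam k (l - v) \<le> 2 * trunc_Gam k l + C * (norm v)\<^sup>2"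
proof -
  obtain C where C: "0 < C" "\<And>y l. y \<in> S \<Longrightarrow> norm (l v* f y) \<le> C * norm l" by (rule adj_bound) blast
  define D where "D = real (K0 + k) * C"
  have D: "0 \<le> D" using C by (simp add: D_def)
  have "trunc_Gam k (l + v) + trunc_Gam k (l - v) \<le> 2 * trunc_Gam k l + 2 * D\<^sup>2 * (norm v)\<^sup>2"
    if v: "norm v \<le> 1 / (D + 1)" for l v
  proof -
    have "trunc_Gam k (l + v) + trunc_Gam k (l - v) = (\<integral>y. trunc_cgf k ((l + v) v* f y) + trunc_cgf k ((l - v) v* f y) \<partial>R)"
      by (simp add: trunc_Gam_def integrable_trunc_adj)
    also have "\<dots> \<le> (\<integral>y. 2 * trunc_cgf k (l v* f y) + 2 * D\<^sup>2 * (norm v)\<^sup>2 \<partial>R)"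
    proof (intro integral_mono_AE)
      show "AE y in R. trunc_cgf k ((l + v) v* f y) + trunc_cgf k ((l - v) v* f y) \<le> 2 * trunc_cgf k (l v* f y) + 2 * D\<^sup>2 * (norm v)\<^sup>2"
        using AE_S
      proof eventually_elim
        case (elim y)
        have "real (K0 + k) * norm (v v* f y) \<le> real (K0 + k) * (C * norm v)"
          using C(2)[OF elim] by (intro mult_left_mono) auto
        then have n: "real (K0 + k) * norm (v v* f y) \<le> D * norm v" by (simp add: D_def mult.assoc)
        also have "\<dots> \<le> D * (1 / (D + 1))" using v D by (intro mult_left_mono) auto
        also have "\<dots> \<le> 1" using D by simp
        finally have "trunc_cgf k (l v* f y + v v* f y) + trunc_cgf k (l v* f y - v v* f y)
          \<le> 2 * trunc_cgf k (l v* f y) + 2 * (real (K0 + k) * norm (v v* f y))\<^sup>2"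
          by (rule trunc_cgf_semiconcave)
        also have "\<dots> \<le> 2 * trunc_cgf k (l v* f y) + 2 * (D * norm v)\<^sup>2"
          using power_mono[OF n, of 2] by simp
        finally show ?case
          by (simp add: vector_matrix_mult_eq_sum algebra_simps sum_subtractf sum.distrib power_mult_distrib)
      qed
    qed (auto simp: integrable_trunc_adj)
    also have "\<dots> = 2 * trunc_Gam k l + 2 * D\<^sup>2 * (norm v)\<^sup>2"
      by (simp add: trunc_Gam_def integrable_trunc_adj R.prob_space)
    finally show ?thesis .
  qed
  with D show ?thesis by (intro exI[of _ "2 * D\<^sup>2"] exI[of _ "1 / (D + 1)"]) auto
qed

text \<open>The lower bound uses the contrapositive: if \<open>Gam l\<close> exceeds a real s, so
  does \<open>trunc_Gam k l\<close> for some k.\<close>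

lemma Gam_le: "(\<And>k. trunc_Gam k l \<le> s) \<Longrightarrow> Gam l \<le> ereal s"
  unfolding Gam_eq log_mgf_eq_SUP trunc_Gam_def
  by (intro ext_integral_SUP_le integrable_trunc_adj) (auto simp: incseq_def trunc_cgf_mono)

text \<open>The y with \<open>l v* f y\<close> outside the closure of the domain form a relatively
  open R-null set, which cannot meet the support. The closure is taken to make this set
  open.\<close>

lemma Gam_finiteE:
  assumes "Gam l < \<infinity>"
  obtains h where "integrable R h" "AE y in R. log_mgf M Y (l v* f y) = ereal (h y)" "Gam l = ereal (\<integral>y. h y \<partial>R)"
    "\<And>y. y \<in> S \<Longrightarrow> l v* f y \<in> closure mgf_dom"
proof -
  have m: "(\<lambda>y. log_mgf M Y (l v* f y)) \<in> borel_measurable R"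
    unfolding log_mgf_eq_SUP by measurable
  have "bounded ((\<lambda>y. trunc_cgf 0 (l v* f y)) ` S)"
    by (intro compact_imp_bounded compact_continuous_image supp_compact continuous_on_subset[OF continuous_on_trunc_adj S_subset])
  then obtain B where B: "\<And>y. y \<in> S \<Longrightarrow> \<bar>trunc_cgf 0 (l v* f y)\<bar> \<le> B" by (auto simp: bounded_iff)
  have "AE y in R. ereal (- B) \<le> log_mgf M Y (l v* f y)"
    using AE_S
  proof eventually_elim
    case (elim y)
    then have "ereal (- B) \<le> ereal (trunc_cgf 0 (l v* f y))" using B[of y] by simp
    also have "\<dots> \<le> log_mgf M Y (l v* f y)" unfolding log_mgf_eq_SUP by (rule SUP_upper) simp
    finally show ?case .
  qed
  from R.ext_integral_finiteE[OF m this assms[unfolded Gam_eq]]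
  obtain h where h: "integrable R h" "AE y in R. log_mgf M Y (l v* f y) = ereal (h y)" by blast
  have "l v* f y \<in> closure mgf_dom" if y: "y \<in> S" for y
  proof (rule ccontr)
    assume n: "l v* f y \<notin> closure mgf_dom"
    define U where "U = X \<inter> (\<lambda>y. l v* f y) -` (- closure mgf_dom)"
    have U: "openin (top_of_set X) U"
      unfolding U_def by (rule continuous_openin_preimage_gen[OF continuous_on_adj]) auto
    have "y \<in> U" using n y S_subset by (auto simp: U_def)
    then have "0 < measure R U" by (rule measure_support_openin_pos[OF R_finite R_sets y _ U])
    moreover have "AE y in R. y \<notin> U"
      using h(2)
    proof eventually_elim
      case (elim z)
      then have "l v* f z \<in> mgf_dom" using log_mgf_eq_PInf[of "l v* f z"] by auto
      then show ?case using closure_subset by (auto simp: U_def)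
    qed
    then have "measure R U = 0"
      using openin_in_sets_restrict[OF R_sets U] by (simp add: R.prob_eq_0)
    ultimately show False by simp
  qed
  with h show thesis by (intro that[of h]) (auto simp: Gam_eq ext_integral_eq_integral)
qed

lemma openin_mgf_interior: "openin (top_of_set X) (X \<inter> (\<lambda>y. l v* f y) -` interior mgf_dom)"
  by (rule continuous_openin_preimage_gen[OF continuous_on_adj]) auto

lemma continuous_on_ln_mgf_adj:
  "continuous_on (X \<inter> (\<lambda>y. l v* f y) -` interior mgf_dom) (\<lambda>y. ln (mgf (l v* f y)))"
  by (rule continuous_on_compose2[OF continuous_on_ln_mgf continuous_on_subset[OF continuous_on_adj]]) auto

lemma Gam_interior:
  assumes "\<And>y. y \<in> S \<Longrightarrow> l v* f y \<in> interior mgf_dom"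
  shows "integrable R (\<lambda>y. indicator S y * ln (mgf (l v* f y)))"
    and "Gam l = ereal (\<integral>y. indicator S y * ln (mgf (l v* f y)) \<partial>R)"
proof -
  have "continuous_on S (\<lambda>y. ln (mgf (l v* f y)))"
    using assms S_subset by (intro continuous_on_subset[OF continuous_on_ln_mgf_adj]) auto
  then show int: "integrable R (\<lambda>y. indicator S y * ln (mgf (l v* f y)))"
    by (rule integrable_indicator_continuous[OF R_finite R_sets supp_compact S_subset])
  have "AE y in R. log_mgf M Y (l v* f y) = ereal (indicator S y * ln (mgf (l v* f y)))"
    using AE_S
  proof eventually_elim
    case (elim y)
    then have "l v* f y \<in> mgf_dom" using assms interior_subset by blast
    then show ?case using elim by (simp add: log_mgf_eq)
  qed
  with int show "Gam l = ereal (\<integral>y. indicator S y * ln (mgf (l v* f y)) \<partial>R)"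
    unfolding Gam_eq by (rule ext_integral_eq_integral)
qed

lemma Z_measurable: "1 \<le> i \<Longrightarrow> Z i \<in> borel_measurable M"
  using indep by (auto simp: indep_vars_def)

lemma finite_A: "finite (A n)"
  using A_subset finite_subset by blast

lemma A_ge_1: "i \<in> A n \<Longrightarrow> 1 \<le> i"
  using A_subset by fastforce

lemma bulk_measurable: "bulk n \<in> borel_measurable M"
proof -
  have "(\<lambda>\<omega>. f (x n i) *v Z i \<omega>) \<in> borel_measurable M" if "i \<in> A n" for i
    using Z_measurable[OF A_ge_1[OF that]] borel_measurable_matrix_vector_mult by (rule measurable_compose)
  then show ?thesis unfolding bulk_def by (intro borel_measurable_scaleR borel_measurable_sum) auto
qed

lemma expectation_prod:
  assumes g: "\<And>i. i \<in> A n \<Longrightarrow> g i \<in> borel_measurable borel"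
    and int: "\<And>i. i \<in> A n \<Longrightarrow> integrable M (\<lambda>\<omega>. g i (Y \<omega>) :: real)"
  shows "integrable M (\<lambda>\<omega>. \<Prod>i\<in>A n. g i (Z i \<omega>))"
    and "(\<integral>\<omega>. (\<Prod>i\<in>A n. g i (Z i \<omega>)) \<partial>M) = (\<Prod>i\<in>A n. \<integral>\<omega>. g i (Y \<omega>) \<partial>M)"
proof -
  have "indep_vars (\<lambda>_. borel) Z (A n)"
    using A_ge_1 by (intro indep_vars_subset[OF indep]) auto
  then have ind: "indep_vars (\<lambda>_. borel) (\<lambda>i \<omega>. g i (Z i \<omega>)) (A n)"
    by (rule indep_vars_compose2) (rule g)
  have int': "integrable M (\<lambda>\<omega>. g i (Z i \<omega>))" if "i \<in> A n" for i
    using int[OF that] integrable_distr_eq[OF Z_measurable[OF A_ge_1[OF that]] g[OF that]]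
      integrable_distr_eq[OF Y_measurable g[OF that]] distr[OF A_ge_1[OF that]] by simp
  have eq: "(\<integral>\<omega>. g i (Z i \<omega>) \<partial>M) = (\<integral>\<omega>. g i (Y \<omega>) \<partial>M)" if "i \<in> A n" for i
    using integral_distr[OF Z_measurable[OF A_ge_1[OF that]] g[OF that]]
      integral_distr[OF Y_measurable g[OF that]] distr[OF A_ge_1[OF that]] by simp
  show "integrable M (\<lambda>\<omega>. \<Prod>i\<in>A n. g i (Z i \<omega>))"
    by (rule indep_vars_integrable[OF finite_A ind int'])
  show "(\<integral>\<omega>. (\<Prod>i\<in>A n. g i (Z i \<omega>)) \<partial>M) = (\<Prod>i\<in>A n. \<integral>\<omega>. g i (Y \<omega>) \<partial>M)"
    using indep_vars_lebesgue_integral[OF finite_A ind int'] eq by simp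
qed

lemma inner_bulk:
  assumes "0 < n"
  shows "real n * (l \<bullet> bulk n \<omega>) = (\<Sum>i\<in>A n. (l v* f (x n i)) \<bullet> Z i \<omega>)"
  using assms by (simp add: bulk_def inner_sum_right dot_lmul_matrix)

section \<open>Upper bound for the bulk\<close>

lemma chernoff:
  assumes n: "0 < n" and dom: "\<And>i. i \<in> A n \<Longrightarrow> l v* f (x n i) \<in> mgf_dom"
  shows "prob {\<omega>\<in>space M. s \<le> l \<bullet> bulk n \<omega>} \<le> exp (- (real n * s) + (\<Sum>i\<in>A n. ln (mgf (l v* f (x n i)))))"
proof -
  define P where "P \<omega> = (\<Prod>i\<in>A n. exp ((l v* f (x n i)) \<bullet> Z i \<omega>))" for \<omega>
  have P: "P \<omega> = exp (real n * (l \<bullet> bulk n \<omega>))" for \<omega>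
    by (simp add: P_def inner_bulk[OF n] exp_sum finite_A)
  have int: "integrable M P" and EP: "(\<integral>\<omega>. P \<omega> \<partial>M) = (\<Prod>i\<in>A n. mgf (l v* f (x n i)))"
    unfolding P_def mgf_def using dom by (auto intro!: expectation_prod simp: mgf_dom_def)
  note [measurable] = bulk_measurable
  have "exp (real n * s) * prob {\<omega>\<in>space M. s \<le> l \<bullet> bulk n \<omega>}
      = (\<integral>\<omega>. exp (real n * s) * indicator {\<omega>\<in>space M. s \<le> l \<bullet> bulk n \<omega>} \<omega> \<partial>M)" by simp
  also have "\<dots> \<le> (\<integral>\<omega>. P \<omega> \<partial>M)"
  proof (intro integral_mono int)
    show "integrable M (\<lambda>\<omega>. exp (real n * s) * indicator {\<omega>\<in>space M. s \<le> l \<bullet> bulk n \<omega>} \<omega>)"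
      by (intro integrable_mult_right integrable_real_indicator) (auto simp: emeasure_eq_measure)
    show "exp (real n * s) * indicator {\<omega>\<in>space M. s \<le> l \<bullet> bulk n \<omega>} \<omega> \<le> P \<omega>" for \<omega>
      using n by (auto simp: P indicator_def mult_left_mono)
  qed
  also have "\<dots> = exp (\<Sum>i\<in>A n. ln (mgf (l v* f (x n i))))"
    unfolding EP exp_sum[OF finite_A] using dom by (intro prod.cong) (auto simp: mgf_pos)
  finally have "prob {\<omega>\<in>space M. s \<le> l \<bullet> bulk n \<omega>}
      \<le> exp (\<Sum>i\<in>A n. ln (mgf (l v* f (x n i)))) / exp (real n * s)"
    by (simp add: pos_le_divide_eq mult.commute)
  then show ?thesis by (simp flip: exp_diff)
qed

lemma bulk_upper:
  assumes c: "ereal c < convex_conjugate Gam z"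
  shows "\<exists>e>0. \<forall>\<^sub>F n in sequentially. prob {\<omega>\<in>space M. bulk n \<omega> \<in> cball z e} \<le> exp (- (real n * c))"
proof -
  obtain l where l: "ereal c < ereal (l \<bullet> z) - Gam l"
    using c by (auto simp: convex_conjugate_def less_SUP_iff)
  then have "Gam l < \<infinity>" by (cases "Gam l") auto
  then obtain h where h: "integrable R h" "AE y in R. log_mgf M Y (l v* f y) = ereal (h y)"
    "Gam l = ereal (\<integral>y. h y \<partial>R)" "\<And>y. y \<in> S \<Longrightarrow> l v* f y \<in> closure mgf_dom"
    by (rule Gam_finiteE) blast
  define g where "g = (\<integral>y. h y \<partial>R)"
  have cg: "c < l \<bullet> z - g" using l h(3) by (simp add: g_def)
  obtain t where t: "0 < t" "t < 1" "c < t * (l \<bullet> z - g)"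
    using cg by (rule less_scaled_real)
  define W where "W = X \<inter> (\<lambda>y. (t *\<^sub>R l) v* f y) -` interior mgf_dom"
  have scale: "(t *\<^sub>R l) v* f y = t *\<^sub>R (l v* f y)" for y
    by (simp add: vector_matrix_mult_eq_sum scaleR_sum_right)
  \<comment> \<open>Moving a point of the closure of a convex set towards the interior point 0 makes
    it interior.\<close>
  have int: "(t *\<^sub>R l) v* f y \<in> interior mgf_dom" if "y \<in> S" for y
    using mem_interior_closure_convex_shrink[OF convex_mgf_dom zero_in_interior_mgf_dom h(4)[OF that], of "1 - t"] t
    by (simp add: scale algebra_simps)
  have SW: "S \<subseteq> W" using int S_subset by (auto simp: W_def)
  define a where "a = (\<integral>y. indicator S y * ln (mgf ((t *\<^sub>R l) v* f y)) \<partial>R)"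
  have lim: "(\<lambda>n. (1 / real n) * (\<Sum>i\<in>A n. ln (mgf ((t *\<^sub>R l) v* f (x n i))))) \<longlonglongrightarrow> a"
    unfolding a_def
    by (rule average[OF openin_mgf_interior SW[unfolded W_def] continuous_on_ln_mgf_adj])
  have "a \<le> (\<integral>y. t * h y \<partial>R)"
    unfolding a_def
  proof (intro integral_mono_AE Gam_interior(1) int)
    show "integrable R (\<lambda>y. t * h y)" using h(1) by simp
    show "AE y in R. indicator S y * ln (mgf ((t *\<^sub>R l) v* f y)) \<le> t * h y"
      using h(2) AE_S
    proof eventually_elim
      case (elim y)
      then have "l v* f y \<in> mgf_dom" using log_mgf_eq_PInf[of "l v* f y"] by auto
      with elim scaleR_mem_mgf_dom(2)[OF this, of t] t show ?case
        by (simp add: scale log_mgf_eq)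
    qed
  qed
  then have a: "a \<le> t * g" by (simp add: g_def)
  \<comment> \<open>The slack in the rate: one half pays for the radius e of the ball, the other for
    the error of the averages. The + 1 in e covers l = 0.\<close>
  define \<kappa> where "\<kappa> = t * (l \<bullet> z - g) - c"
  have \<kappa>: "0 < \<kappa>" using t by (simp add: \<kappa>_def)
  define e where "e = \<kappa> / (2 * (norm (t *\<^sub>R l) + 1))"
  have e: "0 < e" using \<kappa> by (simp add: e_def add_nonneg_pos)
  have e2: "e * norm (t *\<^sub>R l) \<le> \<kappa> / 2"
  proof -
    have "e * norm (t *\<^sub>R l) \<le> e * (norm (t *\<^sub>R l) + 1)" using e by (intro mult_left_mono) auto
    also have "\<dots> = \<kappa> / 2" unfolding e_def by (rule half_scaled) simp
    finally show ?thesis .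
  qed
  have "\<forall>\<^sub>F n in sequentially. (1 / real n) * (\<Sum>i\<in>A n. ln (mgf ((t *\<^sub>R l) v* f (x n i)))) < a + \<kappa> / 2"
    using \<kappa> by (intro order_tendstoD(2)[OF lim]) simp
  with near[OF openin_mgf_interior SW[unfolded W_def]] eventually_gt_at_top[of 0]
  have "\<forall>\<^sub>F n in sequentially. prob {\<omega>\<in>space M. bulk n \<omega> \<in> cball z e} \<le> exp (- (real n * c))"
  proof eventually_elim
    case (elim n)
    define s where "s = (t *\<^sub>R l) \<bullet> z - e * norm (t *\<^sub>R l)"
    note [measurable] = bulk_measurable
    have "prob {\<omega>\<in>space M. bulk n \<omega> \<in> cball z e} \<le> prob {\<omega>\<in>space M. s \<le> (t *\<^sub>R l) \<bullet> bulk n \<omega>}"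
    proof (intro finite_measure_mono subsetI)
      fix \<omega> assume w: "\<omega> \<in> {\<omega>\<in>space M. bulk n \<omega> \<in> cball z e}"
      have "(t *\<^sub>R l) \<bullet> (z - bulk n \<omega>) \<le> norm (t *\<^sub>R l) * norm (z - bulk n \<omega>)" by (rule norm_cauchy_schwarz)
      also have "\<dots> \<le> norm (t *\<^sub>R l) * e" using w by (intro mult_left_mono) (auto simp: dist_norm)
      finally have "s \<le> (t *\<^sub>R l) \<bullet> bulk n \<omega>" by (simp only: s_def inner_diff_right mult.commute[of e])
      with w show "\<omega> \<in> {\<omega>\<in>space M. s \<le> (t *\<^sub>R l) \<bullet> bulk n \<omega>}" by simp
    qed measurable
    also have "\<dots> \<le> exp (- (real n * s) + (\<Sum>i\<in>A n. ln (mgf ((t *\<^sub>R l) v* f (x n i)))))"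
      using elim(1) interior_subset by (intro chernoff[OF elim(2)]) blast
    also have "\<dots> \<le> exp (- (real n * c))"
    proof -
      have "(\<Sum>i\<in>A n. ln (mgf ((t *\<^sub>R l) v* f (x n i)))) \<le> real n * (a + \<kappa> / 2)"
        using elim(2,3) by (simp add: field_simps)
      also have "\<dots> \<le> real n * (s - c)"
      proof (intro mult_left_mono)
        have "s - c = \<kappa> + t * g - e * norm (t *\<^sub>R l)"
          by (simp add: s_def \<kappa>_def right_diff_distrib)
        with a e2 show "a + \<kappa> / 2 \<le> s - c" by linarith
      qed simp
      finally show ?thesis by (simp add: algebra_simps)
    qed
    finally show ?case .
  qed
  with e show ?thesis by blast
qed

section \<open>Exponential tightness and goodness of the conjugate\<close>

lemma mgf_le:
  assumes "norm \<theta> \<le> \<alpha>"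
  shows "mgf \<theta> \<le> (\<integral>\<omega>. exp (\<alpha> * norm (Y \<omega>)) \<partial>M)"
proof -
  have le: "\<theta> \<bullet> y \<le> \<alpha> * norm y" for y
    using order_trans[OF norm_cauchy_schwarz[of \<theta> y] mult_right_mono[OF assms norm_ge_zero]] .
  then have "integrable M (\<lambda>\<omega>. exp (\<theta> \<bullet> Y \<omega>))"
    by (intro Bochner_Integration.integrable_bound[OF exp_integrable]) auto
  then show ?thesis unfolding mgf_def using le by (intro integral_mono exp_integrable) auto
qed

text \<open>Near the support f is bounded, so \<open>norm (bulk n \<omega>)\<close> is at most C / n
  times the sum of the norms of the variables, to which the exponential Markov inequality with
  parameter \<alpha> applies. The radius r solves \<alpha> * r / C = c + ln q.\<close>

lemma bulk_tight:
  "\<exists>r. \<forall>\<^sub>F n in sequentially. prob {\<omega>\<in>space M. r < norm (bulk n \<omega>)} \<le> exp (- (real n * c))"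
proof -
  have "bounded (f ` S)"
    by (intro compact_imp_bounded compact_continuous_image supp_compact continuous_on_subset[OF f_cont S_subset])
  then obtain F where F: "0 < F" "\<forall>y\<in>S. norm (f y) \<le> F" by (auto simp: bounded_pos)
  define W where "W = X \<inter> f -` ball 0 (F + 1)"
  have W: "openin (top_of_set X) W"
    unfolding W_def by (rule continuous_openin_preimage_gen[OF f_cont]) auto
  have SW: "S \<subseteq> W" using F S_subset by (auto simp: W_def intro: le_less_trans)
  define C where "C = real CARD('m) * (F + 1)"
  have C: "0 < C" using F by (simp add: C_def)
  define q where "q = (\<integral>\<omega>. exp (\<alpha> * norm (Y \<omega>)) \<partial>M)"
  have q: "1 \<le> q" using mgf_le[of 0] \<alpha>_pos by (simp add: mgf_zero q_def)
  define r where "r = C * (c + ln q) / \<alpha>"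
  have "\<forall>\<^sub>F n in sequentially. prob {\<omega>\<in>space M. r < norm (bulk n \<omega>)} \<le> exp (- (real n * c))"
    using near[OF W SW] eventually_gt_at_top[of 0]
  proof eventually_elim
    case (elim n)
    note [measurable] = bulk_measurable
    define P where "P \<omega> = (\<Prod>i\<in>A n. exp (\<alpha> * norm (Z i \<omega>)))" for \<omega>
    have int: "integrable M P" and EP: "(\<integral>\<omega>. P \<omega> \<partial>M) = (\<Prod>i\<in>A n. q)"
      unfolding P_def q_def using exp_integrable expectation_prod[of n "\<lambda>_ y. exp (\<alpha> * norm y)"] by auto
    have le: "norm (bulk n \<omega>) \<le> (C / real n) * (\<Sum>i\<in>A n. norm (Z i \<omega>))" for \<omega>
    proof -
      have "norm (\<Sum>i\<in>A n. f (x n i) *v Z i \<omega>) \<le> (\<Sum>i\<in>A n. C * norm (Z i \<omega>))"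
      proof (intro sum_norm_le)
        fix i assume "i \<in> A n"
        with elim have "norm (f (x n i)) \<le> F + 1" by (auto simp: W_def)
        then have "real CARD('m) * norm (f (x n i)) * norm (Z i \<omega>) \<le> C * norm (Z i \<omega>)"
          unfolding C_def by (intro mult_right_mono mult_left_mono) auto
        then show "norm (f (x n i) *v Z i \<omega>) \<le> C * norm (Z i \<omega>)"
          using norm_matrix_vector_mult_le[of "f (x n i)" "Z i \<omega>"] by linarith
      qed
      then have "norm (\<Sum>i\<in>A n. f (x n i) *v Z i \<omega>) / real n \<le> (C * (\<Sum>i\<in>A n. norm (Z i \<omega>))) / real n"
        by (intro divide_right_mono) (auto simp: sum_distrib_left)
      then show ?thesis by (simp add: bulk_def)
    qed
    have "exp (real n * (c + ln q)) * prob {\<omega>\<in>space M. r < norm (bulk n \<omega>)}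
        = (\<integral>\<omega>. exp (real n * (c + ln q)) * indicator {\<omega>\<in>space M. r < norm (bulk n \<omega>)} \<omega> \<partial>M)" by simp
    also have "\<dots> \<le> (\<integral>\<omega>. P \<omega> \<partial>M)"
    proof (intro integral_mono int)
      show "integrable M (\<lambda>\<omega>. exp (real n * (c + ln q)) * indicator {\<omega>\<in>space M. r < norm (bulk n \<omega>)} \<omega>)"
        by (intro integrable_mult_right integrable_real_indicator) (auto simp: emeasure_eq_measure)
      fix \<omega>
      have "real n * (c + ln q) \<le> (\<Sum>i\<in>A n. \<alpha> * norm (Z i \<omega>))" if "r < norm (bulk n \<omega>)"
      proof -
        have "r < (C / real n) * (\<Sum>i\<in>A n. norm (Z i \<omega>))" using that le[of \<omega>] by linarith
        then have "C * (c + ln q) * real n < C * (\<Sum>i\<in>A n. norm (Z i \<omega>)) * \<alpha>"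
          using \<alpha>_pos elim(2) unfolding r_def by (simp add: field_simps)
        then have "C * ((c + ln q) * real n) < C * ((\<Sum>i\<in>A n. norm (Z i \<omega>)) * \<alpha>)" by (simp only: mult.assoc)
        then have "(c + ln q) * real n < (\<Sum>i\<in>A n. norm (Z i \<omega>)) * \<alpha>" using C by (simp only: mult_less_cancel_left_pos)
        then show ?thesis by (simp add: sum_distrib_left[symmetric] mult.commute)
      qed
      then show "exp (real n * (c + ln q)) * indicator {\<omega>\<in>space M. r < norm (bulk n \<omega>)} \<omega> \<le> P \<omega>"
        by (auto simp: P_def indicator_def prod_nonneg exp_sum[OF finite_A, symmetric])
    qed
    also have "\<dots> = q ^ card (A n)" by (simp add: EP)
    also have "\<dots> \<le> q ^ n"
      using q card_mono[OF _ A_subset[of n]] by (intro power_increasing) auto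
    also have "\<dots> = exp (real n * ln q)" using q by (simp add: exp_of_nat_mult)
    finally have "prob {\<omega>\<in>space M. r < norm (bulk n \<omega>)} \<le> exp (real n * ln q) / exp (real n * (c + ln q))"
      by (simp add: pos_le_divide_eq mult.commute)
    then show ?case by (simp add: algebra_simps flip: exp_diff)
  qed
  then show ?thesis by blast
qed

lemma Gam_zero: "Gam 0 = 0"
proof -
  have "ln (mgf (0 v* f y)) = 0" for y by (simp add: mgf_zero)
  then show ?thesis using Gam_interior(2)[of 0] zero_in_interior_mgf_dom by simp
qed

text \<open>Level sets are closed as intersections of sets defined by affine inequalities. They are
  bounded because \<open>Gam\<close> is at most ln q on the ball of radius r, so the conjugate is at
  least r * norm z - ln q.\<close>

lemma good_convex_conjugate_Gam: "good_rate_function (convex_conjugate Gam)"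
proof -
  have nonneg: "0 \<le> convex_conjugate Gam z" for z
    unfolding convex_conjugate_def by (rule SUP_upper2[of 0]) (auto simp: Gam_zero)
  have closed: "closed {z. convex_conjugate Gam z \<le> ereal c}" for c
  proof -
    have "{z. convex_conjugate Gam z \<le> ereal c} = (\<Inter>l. {z. ereal (l \<bullet> z) - Gam l \<le> ereal c})"
      by (auto simp: convex_conjugate_def SUP_le_iff)
    moreover have "closed {z. ereal (l \<bullet> z) - Gam l \<le> ereal c}" for l
    proof (cases "Gam l")
      case (real g)
      have "{z. ereal (l \<bullet> z) - Gam l \<le> ereal c} = {z. l \<bullet> z - g \<le> c}" using real by simp
      moreover have "closed \<dots>" by (intro closed_Collect_le continuous_intros)
      ultimately show ?thesis by simp
    qed simp_all
    ultimately show ?thesis by auto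
  qed
  obtain C where C: "0 < C" "\<And>y l. y \<in> S \<Longrightarrow> norm (l v* f y) \<le> C * norm l" by (rule adj_bound) blast
  \<comment> \<open>For norm l \<le> r the vectors \<open>l v* f y\<close> stay in the ball of
    radius \<alpha>, where \<open>mgf\<close> is at most q.\<close>
  define r where "r = \<alpha> / (2 * C)"
  have r: "0 < r" "C * r < \<alpha>" using C \<alpha>_pos by (auto simp: r_def)
  define q where "q = (\<integral>\<omega>. exp (\<alpha> * norm (Y \<omega>)) \<partial>M)"
  have q: "1 \<le> q" using mgf_le[of 0] \<alpha>_pos by (simp add: mgf_zero q_def)
  have Gam_le_q: "Gam l \<le> ereal (ln q)" if l: "norm l \<le> r" for l
  proof -
    have n: "norm (l v* f y) < \<alpha>" if "y \<in> S" for y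
      using C(2)[OF that, of l] mult_left_mono[OF l, of C] C(1) r(2) by linarith
    have int: "l v* f y \<in> interior mgf_dom" if "y \<in> S" for y
      using n[OF that] ball_subset_mgf_dom by (intro interiorI[of "ball 0 \<alpha>"]) auto
    have "(\<integral>y. indicator S y * ln (mgf (l v* f y)) \<partial>R) \<le> (\<integral>y. ln q \<partial>R)"
    proof (intro integral_mono_AE Gam_interior(1) int)
      show "AE y in R. indicator S y * ln (mgf (l v* f y)) \<le> ln q"
        using AE_S
      proof eventually_elim
        case (elim y)
        then have "l v* f y \<in> mgf_dom" using int interior_subset by blast
        then have "ln (mgf (l v* f y)) \<le> ln q"
          using mgf_le[of "l v* f y"] n[OF elim] q mgf_pos by (simp add: q_def)
        with elim show ?case by simp
      qed
    qed auto
    then show ?thesis using Gam_interior(2)[OF int] by (simp add: R.prob_space)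
  qed
  have "bounded {z. convex_conjugate Gam z \<le> ereal c}" for c
    unfolding bounded_iff
  proof (intro exI ballI)
    fix z assume z: "z \<in> {z. convex_conjugate Gam z \<le> ereal c}"
    show "norm z \<le> (\<bar>c\<bar> + ln q) / r"
    proof (cases "z = 0")
      case False
      define l where "l = (r / norm z) *\<^sub>R z"
      have "norm l = r" using False r by (simp add: l_def)
      then have gl: "Gam l \<le> ereal (ln q)" using Gam_le_q by simp
      have lz: "l \<bullet> z = r * norm z"
        using False by (simp add: l_def flip: power2_norm_eq_inner) (simp add: power2_eq_square)
      have "ereal (l \<bullet> z) - Gam l \<le> ereal c"
        using z unfolding convex_conjugate_def by (auto simp: SUP_le_iff)
      then have "l \<bullet> z - ln q \<le> c" using gl by (cases "Gam l") auto
      then have "r * norm z \<le> \<bar>c\<bar> + ln q" using lz by linarith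
      then show ?thesis using r by (simp add: field_simps)
    qed (use q r in auto)
  qed
  with closed nonneg show ?thesis
    by (auto simp: good_rate_function_def compact_eq_bounded_closed)
qed

section \<open>Lower bound for the bulk\<close>

lemma prod_trunc_exp:
  assumes "0 < n"
  shows "(\<Prod>i\<in>A n. trunc_exp K (l v* f (x n i)) (Z i \<omega>)) =
    (if \<forall>i\<in>A n. norm (Z i \<omega>) \<le> real K then exp (real n * (l \<bullet> bulk n \<omega>)) else 0)"
proof (cases "\<forall>i\<in>A n. norm (Z i \<omega>) \<le> real K")
  case True
  then have "(\<Prod>i\<in>A n. trunc_exp K (l v* f (x n i)) (Z i \<omega>)) = (\<Prod>i\<in>A n. exp ((l v* f (x n i)) \<bullet> Z i \<omega>))"
    by (intro prod.cong) (auto simp: trunc_exp_def)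
  with True show ?thesis by (simp add: inner_bulk[OF assms] exp_sum finite_A)
next
  case False
  then obtain i where "i \<in> A n" "\<not> norm (Z i \<omega>) \<le> real K" by blast
  then have "(\<Prod>i\<in>A n. trunc_exp K (l v* f (x n i)) (Z i \<omega>)) = 0"
    by (intro prod_zero finite_A) (auto simp: trunc_exp_def)
  with False show ?thesis by simp
qed

lemma expectation_prod_trunc_exp:
  "integrable M (\<lambda>\<omega>. \<Prod>i\<in>A n. trunc_exp (K0 + k) (l v* f (x n i)) (Z i \<omega>))"
  "(\<integral>\<omega>. (\<Prod>i\<in>A n. trunc_exp (K0 + k) (l v* f (x n i)) (Z i \<omega>)) \<partial>M) = exp (\<Sum>i\<in>A n. trunc_cgf k (l v* f (x n i)))"
  using expectation_prod[of n "\<lambda>i. trunc_exp (K0 + k) (l v* f (x n i))"]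
  by (auto simp: integrable_trunc_exp exp_sum finite_A exp_trunc_cgf trunc_mgf_def)

text \<open>Splits the truncated exponential moment at l. If the bulk is near w, the integrand is at
  most its value at w up to \<open>\<delta> * norm l\<close>. Otherwise
  \<open>bulk n \<omega> - w\<close> has component at least D in some direction v, and there the
  integrand is dominated by the one at \<open>l + \<sigma> *\<^sub>R v\<close>, as in a Chernoff
  bound under the tilted law.\<close>

lemma tilting_inequality:
  assumes n: "0 < n" and \<sigma>: "0 < \<sigma>" and \<delta>: "0 < \<delta>"
  defines "V \<equiv> Basis \<union> uminus ` Basis" and "D \<equiv> \<delta> / real DIM(real^'m)"
  shows "exp (\<Sum>i\<in>A n. trunc_cgf k (l v* f (x n i))) \<le>
    exp (real n * (l \<bullet> w + \<delta> * norm l)) * prob {\<omega>\<in>space M. bulk n \<omega> \<in> ball w \<delta>} +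
    (\<Sum>v\<in>V. exp (- (real n * \<sigma> * (D + v \<bullet> w))) * exp (\<Sum>i\<in>A n. trunc_cgf k ((l + \<sigma> *\<^sub>R v) v* f (x n i))))"
proof -
  note [measurable] = bulk_measurable
  define P where "P l \<omega> = (\<Prod>i\<in>A n. trunc_exp (K0 + k) (l v* f (x n i)) (Z i \<omega>))" for l \<omega>
  have P0: "0 \<le> P l \<omega>" for l \<omega> by (simp add: P_def prod_nonneg)
  have finV: "finite V" by (simp add: V_def)
  define E where "E = {\<omega>\<in>space M. bulk n \<omega> \<in> ball w \<delta>}"
  have E: "E \<in> events" unfolding E_def by simp
  have intE: "integrable M (\<lambda>\<omega>. exp (real n * (l \<bullet> w + \<delta> * norm l)) * indicator E \<omega>)"
    using E by (intro integrable_mult_right integrable_real_indicator) (auto simp: emeasure_eq_measure)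
  have intP: "integrable M (P l)" for l unfolding P_def by (rule expectation_prod_trunc_exp)
  have "(\<integral>\<omega>. P l \<omega> \<partial>M) \<le> (\<integral>\<omega>. exp (real n * (l \<bullet> w + \<delta> * norm l)) * indicator E \<omega> +
      (\<Sum>v\<in>V. exp (- (real n * \<sigma> * (D + v \<bullet> w))) * P (l + \<sigma> *\<^sub>R v) \<omega>) \<partial>M)"
  proof (intro integral_mono intP Bochner_Integration.integrable_add intE Bochner_Integration.integrable_sum integrable_mult_right)
    fix \<omega> assume \<omega>: "\<omega> \<in> space M"
    define b where "b = bulk n \<omega>"
    have S0: "0 \<le> (\<Sum>v\<in>V. exp (- (real n * \<sigma> * (D + v \<bullet> w))) * P (l + \<sigma> *\<^sub>R v) \<omega>)"
      by (intro sum_nonneg mult_nonneg_nonneg P0) auto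
    show "P l \<omega> \<le> exp (real n * (l \<bullet> w + \<delta> * norm l)) * indicator E \<omega> +
      (\<Sum>v\<in>V. exp (- (real n * \<sigma> * (D + v \<bullet> w))) * P (l + \<sigma> *\<^sub>R v) \<omega>)"
    proof (cases "b \<in> ball w \<delta>")
      case True
      have "l \<bullet> (b - w) \<le> norm l * norm (b - w)" by (rule norm_cauchy_schwarz)
      also have "\<dots> \<le> norm l * \<delta>" using True by (intro mult_left_mono) (auto simp: dist_norm norm_minus_commute)
      finally have "l \<bullet> b \<le> l \<bullet> w + \<delta> * norm l" by (simp add: inner_diff_right mult.commute)
      then have "P l \<omega> \<le> exp (real n * (l \<bullet> w + \<delta> * norm l))"
        using n by (simp add: P_def prod_trunc_exp[OF n] b_def[symmetric])
      with S0 True \<omega> show ?thesis by (simp add: E_def b_def)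
    next
      case False
      \<comment> \<open>If all coordinates were below D in absolute value, the l1 norm, hence the
        Euclidean norm, would be below DIM * D = \<delta>.\<close>
      have "\<exists>v\<in>V. D \<le> v \<bullet> (b - w)"
      proof (rule ccontr)
        assume "\<not> ?thesis"
        then have no: "v \<bullet> (b - w) < D" if "v \<in> V" for v using that by force
        have "\<bar>(b - w) \<bullet> v\<bar> < D" if "v \<in> Basis" for v
          using no[of v] no[of "- v"] that by (auto simp: V_def inner_commute abs_less_iff)
        then have "(\<Sum>v\<in>Basis. \<bar>(b - w) \<bullet> v\<bar>) < (\<Sum>v\<in>(Basis :: (real^'m) set). D)"
          by (intro sum_strict_mono) auto
        also have "\<dots> = \<delta>" by (simp add: D_def)
        finally have "norm (b - w) < \<delta>" using norm_le_l1[of "b - w"] by linarith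
        with False show False by (simp add: dist_norm norm_minus_commute)
      qed
      then obtain v where v: "v \<in> V" "D \<le> v \<bullet> (b - w)" by blast
      have "real n * \<sigma> * D \<le> real n * \<sigma> * (v \<bullet> (b - w))" using v \<sigma> by (intro mult_left_mono) auto
      then have "real n * (l \<bullet> b) \<le> - (real n * \<sigma> * (D + v \<bullet> w)) + real n * ((l + \<sigma> *\<^sub>R v) \<bullet> b)"
        by (simp add: inner_diff_right inner_add_left algebra_simps)
      then have "P l \<omega> \<le> exp (- (real n * \<sigma> * (D + v \<bullet> w))) * P (l + \<sigma> *\<^sub>R v) \<omega>"
        by (simp add: P_def prod_trunc_exp[OF n] b_def[symmetric] flip: exp_add)
      also have "\<dots> \<le> (\<Sum>v\<in>V. exp (- (real n * \<sigma> * (D + v \<bullet> w))) * P (l + \<sigma> *\<^sub>R v) \<omega>)"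
        using v P0 finV by (intro member_le_sum) auto
      finally show ?thesis by (simp add: add_increasing)
    qed
  qed
  also have "\<dots> = exp (real n * (l \<bullet> w + \<delta> * norm l)) * prob E +
      (\<Sum>v\<in>V. exp (- (real n * \<sigma> * (D + v \<bullet> w))) * (\<integral>\<omega>. P (l + \<sigma> *\<^sub>R v) \<omega> \<partial>M))"
    using E intE intP by (simp add: Bochner_Integration.integral_add Bochner_Integration.integral_sum)
  finally show ?thesis unfolding P_def expectation_prod_trunc_exp(2) E_def .
qed

text \<open>At the pair l, w from \<open>exists_tilt\<close>, the quadratic bound makes all moments
  at \<open>l + \<sigma> *\<^sub>R v\<close> in the tilting inequality exponentially smaller than
  the one at l. The term with the probability of the ball around w must then carry the mass.\<close>

lemma bulk_lower:
  assumes c: "convex_conjugate Gam z < ereal c" and e: "0 < e"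
  shows "\<forall>\<^sub>F n in sequentially. exp (- (real n * c)) \<le> prob {\<omega>\<in>space M. bulk n \<omega> \<in> ball z e}"
proof -
  obtain C where C: "0 < C" "\<And>k l l'. \<bar>trunc_Gam k l - trunc_Gam k l'\<bar> \<le> real (K0 + k) * C * norm (l - l')"
    by (rule trunc_Gam_lipschitz) blast
  have conj: "\<exists>k. l \<bullet> z - trunc_Gam k l < c" for l
  proof (rule ccontr)
    assume "\<not> ?thesis"
    then have "trunc_Gam k l \<le> l \<bullet> z - c" for k by (metis diff_le_eq linorder_not_less add.commute le_diff_eq)
    then have "Gam l \<le> ereal (l \<bullet> z - c)" by (rule Gam_le)
    then have "ereal c \<le> ereal (l \<bullet> z) - Gam l" by (cases "Gam l") auto
    also have "\<dots> \<le> convex_conjugate Gam z" unfolding convex_conjugate_def by (rule SUP_upper) simp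
    finally show False using c by simp
  qed
  have cont: "continuous_on UNIV (trunc_Gam k)" for k
    using C by (intro lipschitz_on_continuous_on[where L = "real (K0 + k) * C"] lipschitz_onI) (auto simp: dist_norm)
  have low: "- (real K0 * C * norm l + - trunc_Gam 0 0) \<le> trunc_Gam 0 l" for l
    using C(2)[of 0 l 0] by (simp add: abs_le_iff)
  have e2: "0 < e / 2" using e by simp
  obtain k l w C' r where tilt: "dist z w < e / 2" "l \<bullet> w - trunc_Gam k l < c" "0 < r"
    "\<forall>v. norm v \<le> r \<longrightarrow> trunc_Gam k (l + v) \<le> trunc_Gam k l + v \<bullet> w + C' * (norm v)\<^sup>2"
    by (rule exists_tilt[OF cont trunc_Gam_mono low trunc_Gam_zero_le trunc_Gam_semiconcave conj e2]) blast
  define G where "G = trunc_Gam k"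
  define \<kappa> where "\<kappa> = c - (l \<bullet> w - G l)"
  have \<kappa>: "0 < \<kappa>" using tilt by (simp add: \<kappa>_def G_def)
  define \<delta> where "\<delta> = min (e / 2) (\<kappa> / (2 * (norm l + 1)))"
  have \<delta>: "0 < \<delta>" "\<delta> \<le> e / 2" "\<delta> \<le> \<kappa> / (2 * (norm l + 1))"
    using \<kappa> e by (simp_all only: \<delta>_def min.cobounded1 min.cobounded2) (simp add: add_nonneg_pos)
  have \<delta>l: "\<delta> * norm l \<le> \<kappa> / 2"
  proof -
    have "\<delta> * norm l \<le> \<kappa> / (2 * (norm l + 1)) * (norm l + 1)"
      using \<kappa> \<delta> by (intro mult_mono) auto
    also have "\<dots> = \<kappa> / 2" by (rule half_scaled) simp
    finally show ?thesis .
  qed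
  define D where "D = \<delta> / real DIM(real^'m)"
  have D: "0 < D" using \<delta> by (simp add: D_def)
  \<comment> \<open>The gain in direction v is linear, \<sigma> * D, and the error
    \<open>C' * \<sigma>\<^sup>2\<close> is quadratic; for this \<sigma> at most half of the gain is
    lost.\<close>
  define \<sigma> where "\<sigma> = min r (D / (2 * (\<bar>C'\<bar> + 1)))"
  have \<sigma>: "0 < \<sigma>" "\<sigma> \<le> r" "\<sigma> \<le> D / (2 * (\<bar>C'\<bar> + 1))"
    using tilt(3) D by (simp_all only: \<sigma>_def min.cobounded1 min.cobounded2) (simp add: add_nonneg_pos)
  have \<sigma>D: "C' * \<sigma> \<le> D / 2"
  proof -
    have "C' * \<sigma> \<le> \<bar>C'\<bar> * \<sigma>" using \<sigma> by (intro mult_right_mono) auto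
    also have "\<dots> \<le> (\<bar>C'\<bar> + 1) * (D / (2 * (\<bar>C'\<bar> + 1)))"
      using \<sigma> by (intro mult_mono) auto
    also have "\<dots> = D / 2" using half_scaled[of "\<bar>C'\<bar>" D] by (simp only: mult.commute abs_ge_zero)
    finally show ?thesis .
  qed
  define V where "V = Basis \<union> uminus ` (Basis :: (real^'m) set)"
  have V: "finite V" "\<And>v. v \<in> V \<Longrightarrow> norm v = 1" by (auto simp: V_def)
  \<comment> \<open>The remaining gain \<sigma> * D / 2 is at least 4 * \<eta>: one \<eta> pays for
    the averages at the shifted points, so their exponents are at most G l - 3 * \<eta>, against G l
    - \<eta> at l. At the end 2 * \<eta> and \<delta> * norm l each use at most half of
    \<kappa>.\<close>
  define \<eta> where "\<eta> = min (\<kappa> / 4) (\<sigma> * D / 8)"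
  have \<eta>: "0 < \<eta>" "\<eta> \<le> \<kappa> / 4" "\<eta> \<le> \<sigma> * D / 8"
    using \<kappa> \<sigma>(1) D by (simp_all only: \<eta>_def min.cobounded1 min.cobounded2) simp
  have Gv: "G (l + \<sigma> *\<^sub>R v) \<le> G l + \<sigma> * (v \<bullet> w) + \<sigma> * D / 2" if "v \<in> V" for v
  proof -
    have "G (l + \<sigma> *\<^sub>R v) \<le> G l + (\<sigma> *\<^sub>R v) \<bullet> w + C' * (norm (\<sigma> *\<^sub>R v))\<^sup>2"
      unfolding G_def using V(2)[OF that] \<sigma> by (intro tilt(4)[rule_format]) simp
    also have "C' * (norm (\<sigma> *\<^sub>R v))\<^sup>2 = \<sigma> * (C' * \<sigma>)"
      using V(2)[OF that] by (simp add: power2_eq_square mult_ac)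
    also have "\<sigma> * (C' * \<sigma>) \<le> \<sigma> * (D / 2)" using \<sigma>D \<sigma> by (intro mult_left_mono) auto
    finally show ?thesis by simp
  qed
  define H where "H n l = (\<Sum>i\<in>A n. trunc_cgf k (l v* f (x n i)))" for n l
  have lim: "(\<lambda>n. (1 / real n) * H n l) \<longlonglongrightarrow> G l" for l
    unfolding H_def G_def by (rule trunc_Gam_average)
  have ev1: "\<forall>\<^sub>F n in sequentially. G l - \<eta> < (1 / real n) * H n l"
    using \<eta> by (intro order_tendstoD(1)[OF lim]) simp
  have ev2: "\<forall>\<^sub>F n in sequentially. \<forall>v\<in>V. (1 / real n) * H n (l + \<sigma> *\<^sub>R v) < G (l + \<sigma> *\<^sub>R v) + \<eta>"
    using \<eta> V by (intro eventually_ball_finite ballI order_tendstoD(2)[OF lim]) auto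
  have ev3: "\<forall>\<^sub>F n in sequentially. (real (card V) + 1) * exp (- (real n * \<eta>)) \<le> exp (- (real n * 0))"
    using \<eta> by (intro eventually_const_mult_exp_le)
  from ev1 ev2 ev3 eventually_gt_at_top[of 0] show ?thesis
  proof eventually_elim
    case (elim n)
    note [measurable] = bulk_measurable
    define p where "p = prob {\<omega>\<in>space M. bulk n \<omega> \<in> ball w \<delta>}"
    have n: "0 < real n" using elim by simp
    have "exp (real n * (G l - \<eta>)) \<le> exp (H n l)"
      using elim(1) n by (simp add: field_simps)
    also have "\<dots> \<le> exp (real n * (l \<bullet> w + \<delta> * norm l)) * p +
        (\<Sum>v\<in>V. exp (- (real n * \<sigma> * (D + v \<bullet> w))) * exp (H n (l + \<sigma> *\<^sub>R v)))"
      using tilting_inequality[OF elim(4) \<sigma>(1) \<delta>(1), of k l w] by (simp add: H_def p_def V_def D_def)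
    also have "(\<Sum>v\<in>V. exp (- (real n * \<sigma> * (D + v \<bullet> w))) * exp (H n (l + \<sigma> *\<^sub>R v)))
        \<le> (\<Sum>v\<in>V. exp (real n * (G l - 3 * \<eta>)))"
    proof (intro sum_mono)
      fix v assume v: "v \<in> V"
      have "H n (l + \<sigma> *\<^sub>R v) \<le> real n * (G (l + \<sigma> *\<^sub>R v) + \<eta>)"
        using elim(2) v n by (force simp: field_simps)
      also have "\<dots> \<le> real n * (G l + \<sigma> * (v \<bullet> w) + \<sigma> * D - 3 * \<eta>)"
        using Gv[OF v] \<eta> n by (intro mult_left_mono) auto
      finally have "- (real n * \<sigma> * (D + v \<bullet> w)) + H n (l + \<sigma> *\<^sub>R v) \<le> real n * (G l - 3 * \<eta>)"
        by (simp add: algebra_simps)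
      then show "exp (- (real n * \<sigma> * (D + v \<bullet> w))) * exp (H n (l + \<sigma> *\<^sub>R v)) \<le> exp (real n * (G l - 3 * \<eta>))"
        by (simp flip: exp_add)
    qed
    also have "\<dots> = real (card V) * exp (real n * (G l - 3 * \<eta>))" by simp
    finally have main: "exp (real n * (G l - \<eta>)) \<le> exp (real n * (l \<bullet> w + \<delta> * norm l)) * p
        + real (card V) * exp (real n * (G l - 3 * \<eta>))" by simp
    have "real (card V) * exp (real n * (G l - 3 * \<eta>)) + exp (real n * (G l - 2 * \<eta>))
        \<le> (real (card V) + 1) * exp (real n * (G l - 2 * \<eta>))"
      using n \<eta> by (simp add: algebra_simps mult_left_mono)
    also have "\<dots> = exp (real n * (G l - \<eta>)) * ((real (card V) + 1) * exp (- (real n * \<eta>)))"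
      by (simp add: algebra_simps flip: exp_add)
    also have "\<dots> \<le> exp (real n * (G l - \<eta>)) * 1"
      using elim(3) by (intro mult_left_mono) auto
    finally have "exp (real n * (G l - 2 * \<eta>)) \<le> exp (real n * (l \<bullet> w + \<delta> * norm l)) * p"
      using main by simp
    then have "exp (real n * (G l - 2 * \<eta>)) / exp (real n * (l \<bullet> w + \<delta> * norm l)) \<le> p"
      by (simp add: pos_divide_le_eq mult.commute)
    then have "exp (real n * (G l - 2 * \<eta>) - real n * (l \<bullet> w + \<delta> * norm l)) \<le> p"
      by (simp add: exp_diff)
    moreover have "- (real n * c) \<le> real n * (G l - 2 * \<eta>) - real n * (l \<bullet> w + \<delta> * norm l)"
    proof -
      have "real n * (- c) \<le> real n * (G l - 2 * \<eta> - (l \<bullet> w + \<delta> * norm l))"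
        using \<delta>l \<eta> n by (intro mult_left_mono) (auto simp: \<kappa>_def)
      then show ?thesis by (simp add: algebra_simps)
    qed
    ultimately have "exp (- (real n * c)) \<le> p" by (meson exp_le_cancel_iff order_trans)
    also have "p \<le> prob {\<omega>\<in>space M. bulk n \<omega> \<in> ball z e}"
      unfolding p_def
    proof (intro finite_measure_mono)
      have "ball w \<delta> \<subseteq> ball z e"
        using tilt(1) \<delta>(2) by (intro ball_subset_ball_iff[THEN iffD2] disjI1) (simp add: dist_commute)
      then show "{\<omega>\<in>space M. bulk n \<omega> \<in> ball w \<delta>} \<subseteq> {\<omega>\<in>space M. bulk n \<omega> \<in> ball z e}" by blast
    qed simp
    finally show ?case .
  qed
qed

theorem bulk_local_LDP: "local_LDP M bulk (convex_conjugate Gam)"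
  unfolding local_LDP_def
  using good_convex_conjugate_Gam bulk_measurable bulk_lower bulk_upper bulk_tight by auto

end

section \<open>Adding the outliers\<close>

text \<open>The rate after the first t outliers, which makes the final formula accessible to
  induction on t. The second component is a total function of which only the values at 1, ..., t are
  used.\<close>

definition outlier_rate ::
  "('b::ab_group_add \<Rightarrow> ereal) \<Rightarrow> ('c \<Rightarrow> ereal) \<Rightarrow> (nat \<Rightarrow> 'c \<Rightarrow> 'b) \<Rightarrow> nat \<Rightarrow> 'b \<Rightarrow> ereal" where
  "outlier_rate J I F t z = (INF p \<in> {(z0, y). z0 + (\<Sum>l=1..t. F l (y l)) = z}. J (fst p) + (\<Sum>l=1..t. I (snd p l)))"

lemma outlier_rate_0: "outlier_rate J I F 0 = J"
proof
  fix z
  have "{(z0, y). z0 + (\<Sum>l=1..0::nat. F l (y l)) = z} = {z} \<times> UNIV" by auto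
  then have "outlier_rate J I F 0 z = (INF p \<in> {z} \<times> UNIV. J (fst p) + (\<Sum>l=1..0::nat. I (snd p l)))"
    unfolding outlier_rate_def by simp
  also have "\<dots> = (INF p \<in> ({z} \<times> UNIV :: ('a \<times> (nat \<Rightarrow> 'b)) set). J z)" by (rule INF_cong) auto
  also have "\<dots> = J z" by (rule cINF_const) auto
  finally show "outlier_rate J I F 0 z = J z" .
qed

text \<open>Merges the infimum produced by one contraction step with the inner one. Nonnegativity of
  the rates and a nonempty fibre allow the addition of I to be moved inside the infimum.\<close>

lemma outlier_rate_Suc:
  fixes J :: "'b::ab_group_add \<Rightarrow> ereal" and I :: "'c \<Rightarrow> ereal"
  assumes J: "\<And>z. 0 \<le> J z" and I: "\<And>y. 0 \<le> I y"
  shows "(INF q\<in>{q. fst q + F (Suc t) (snd q) = z}. outlier_rate J I F t (fst q) + I (snd q)) = outlier_rate J I F (Suc t) z"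
    (is "?L = ?R")
proof (rule antisym)
  show "?L \<le> ?R"
    unfolding outlier_rate_def[of J I F "Suc t"]
  proof (rule INF_greatest)
    fix p :: "'b \<times> (nat \<Rightarrow> 'c)"
    assume p: "p \<in> {(z0, y). z0 + (\<Sum>l=1..Suc t. F l (y l)) = z}"
    define u where "u = fst p + (\<Sum>l=1..t. F l (snd p l))"
    have "?L \<le> outlier_rate J I F t u + I (snd p (Suc t))"
      using p by (intro INF_lower2[of "(u, snd p (Suc t))"]) (auto simp: u_def add.assoc)
    also have "\<dots> \<le> (J (fst p) + (\<Sum>l=1..t. I (snd p l))) + I (snd p (Suc t))"
      unfolding outlier_rate_def by (intro add_right_mono INF_lower) (auto simp: u_def case_prod_beta)
    finally show "?L \<le> J (fst p) + (\<Sum>l=1..Suc t. I (snd p l))" by (simp add: add.assoc)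
  qed
  show "?R \<le> ?L"
  proof (rule INF_greatest)
    fix q :: "'b \<times> 'c" assume q: "q \<in> {q. fst q + F (Suc t) (snd q) = z}"
    define P where "P = {(z0, y). z0 + (\<Sum>l=1..t. F l (y l)) = fst q}"
    \<comment> \<open>The first component is unconstrained, so any choice of the y can be completed
      to a point of the fibre.\<close>
    have "(fst q - (\<Sum>l=1..t. F l undefined), \<lambda>_. undefined) \<in> P" by (simp add: P_def)
    then have ne: "P \<noteq> {}" by blast
    have nn: "0 \<le> J (fst p) + (\<Sum>l=1..t. I (snd p l))" for p
      by (intro add_nonneg_nonneg sum_nonneg J I)
    have "I (snd q) \<noteq> - \<infinity>" using I[of "snd q"] by auto
    then have "outlier_rate J I F t (fst q) + I (snd q) = (INF p\<in>P. J (fst p) + (\<Sum>l=1..t. I (snd p l)) + I (snd q))"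
      unfolding outlier_rate_def P_def[symmetric] using ne nn by (subst INF_ereal_add_left) auto
    moreover have "?R \<le> \<dots>"
    proof (rule INF_greatest)
      fix p assume p: "p \<in> P"
      define y where "y = (snd p)(Suc t := snd q)"
      have s: "(\<Sum>l=1..t. F l (y l)) = (\<Sum>l=1..t. F l (snd p l))" "(\<Sum>l=1..t. I (y l)) = (\<Sum>l=1..t. I (snd p l))"
        by (auto simp: y_def intro!: sum.cong)
      have "?R \<le> J (fst p) + (\<Sum>l=1..Suc t. I (y l))"
        unfolding outlier_rate_def
        using p q s by (intro INF_lower2[of "(fst p, y)"]) (auto simp: P_def y_def add.assoc[symmetric])
      also have "\<dots> = J (fst p) + (\<Sum>l=1..t. I (snd p l)) + I (snd q)"
        using s by (simp add: y_def add.assoc)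
      finally show "?R \<le> J (fst p) + (\<Sum>l=1..t. I (snd p l)) + I (snd q)" .
    qed
    ultimately show "?R \<le> outlier_rate J I F t (fst q) + I (snd q)" by simp
  qed
qed

text \<open>Functions of disjoint blocks of independent variables are independent. The blocks B and
  {j} become random elements of product spaces, where the two conditions are measurable
  sets.\<close>

lemma (in prob_space) indep_vars_prob_sum_prod:
  fixes Z :: "'i \<Rightarrow> 'a \<Rightarrow> real^'d" and c :: "'i \<Rightarrow> real^'d^'m"
  assumes ind: "indep_vars (\<lambda>_. borel) Z I" and B: "B \<subseteq> I" "j \<in> I" "j \<notin> B"
    and A: "A \<in> sets borel" and C: "C \<in> sets borel"
  shows "prob {\<omega>\<in>space M. s *\<^sub>R (\<Sum>i\<in>B. c i *v Z i \<omega>) \<in> A \<and> r *\<^sub>R Z j \<omega> \<in> C} =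
    prob {\<omega>\<in>space M. s *\<^sub>R (\<Sum>i\<in>B. c i *v Z i \<omega>) \<in> A} * prob {\<omega>\<in>space M. r *\<^sub>R Z j \<omega> \<in> C}"
proof -
  have indB: "indep_var (PiM B (\<lambda>_. borel)) (\<lambda>\<omega>. restrict (\<lambda>i. Z i \<omega>) B) (PiM {j} (\<lambda>_. borel)) (\<lambda>\<omega>. restrict (\<lambda>i. Z i \<omega>) {j})"
    using B by (intro indep_var_restrict[OF ind]) auto
  define A' where "A' = {g \<in> space (PiM B (\<lambda>_. borel)). s *\<^sub>R (\<Sum>i\<in>B. c i *v g i) \<in> A}"
  define C' where "C' = {g :: 'i \<Rightarrow> real^'d. g \<in> space (PiM {j} (\<lambda>_. borel)) \<and> r *\<^sub>R g j \<in> C}"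
  have m1: "(\<lambda>g. s *\<^sub>R (\<Sum>i\<in>B. c i *v g i)) \<in> borel_measurable (PiM B (\<lambda>_. borel))"
  proof (intro borel_measurable_scaleR borel_measurable_sum borel_measurable_const)
    fix i assume "i \<in> B"
    then have "(\<lambda>g. g i) \<in> PiM B (\<lambda>_. borel) \<rightarrow>\<^sub>M (borel :: (real^'d) measure)"
      by (rule measurable_component_singleton)
    then show "(\<lambda>g. c i *v g i) \<in> borel_measurable (PiM B (\<lambda>_. borel))"
      by (rule measurable_compose[OF _ borel_measurable_matrix_vector_mult])
  qed
  have m2: "(\<lambda>g::'i \<Rightarrow> real^'d. r *\<^sub>R g j) \<in> borel_measurable (PiM {j} (\<lambda>_. borel))"
  proof (intro borel_measurable_scaleR borel_measurable_const)
    show "(\<lambda>g. g j) \<in> PiM {j} (\<lambda>_. borel) \<rightarrow>\<^sub>M (borel :: (real^'d) measure)"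
      by (rule measurable_component_singleton) simp
  qed
  have sets: "A' \<in> sets (PiM B (\<lambda>_. borel))" "C' \<in> sets (PiM {j} (\<lambda>_. borel))"
    unfolding A'_def C'_def using measurable_sets[OF m1 A] measurable_sets[OF m2 C]
    by (simp_all add: vimage_def Int_def conj_commute)
  have "prob ((\<lambda>\<omega>. (restrict (\<lambda>i. Z i \<omega>) B, restrict (\<lambda>i. Z i \<omega>) {j})) -` (A' \<times> C') \<inter> space M) =
      prob ((\<lambda>\<omega>. restrict (\<lambda>i. Z i \<omega>) B) -` A' \<inter> space M) * prob ((\<lambda>\<omega>. restrict (\<lambda>i. Z i \<omega>) {j}) -` C' \<inter> space M)"
    by (rule indep_varD[OF indB sets])
  moreover have "(\<lambda>\<omega>. restrict (\<lambda>i. Z i \<omega>) B) -` A' \<inter> space M = {\<omega>\<in>space M. s *\<^sub>R (\<Sum>i\<in>B. c i *v Z i \<omega>) \<in> A}"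
    by (auto simp: A'_def space_PiM cong: sum.cong)
  moreover have "(\<lambda>\<omega>. restrict (\<lambda>i. Z i \<omega>) {j}) -` C' \<inter> space M = {\<omega>\<in>space M. r *\<^sub>R Z j \<omega> \<in> C}"
    by (auto simp: C'_def space_PiM)
  moreover have "(\<lambda>\<omega>. (restrict (\<lambda>i. Z i \<omega>) B, restrict (\<lambda>i. Z i \<omega>) {j})) -` (A' \<times> C') \<inter> space M
      = {\<omega>\<in>space M. s *\<^sub>R (\<Sum>i\<in>B. c i *v Z i \<omega>) \<in> A \<and> r *\<^sub>R Z j \<omega> \<in> C}"
    by (auto simp: A'_def C'_def space_PiM cong: sum.cong)
  ultimately show ?thesis by simp
qed

lemma continuous_on_matrix_vector_mult [continuous_intros]:
  fixes A :: "'x::topological_space \<Rightarrow> real^'d^'m"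
  assumes "continuous_on S A" "continuous_on S y"
  shows "continuous_on S (\<lambda>q. A q *v y q)"
  unfolding matrix_vector_mult_def using assms by (intro continuous_intros)

text \<open>Contraction along maps that still depend on n through \<open>Bn n\<close>. Joint
  continuity of g in the matrix and the two vectors gives the continuous convergence
  required.\<close>

lemma (in prob_space) local_LDP_add_outlier:
  fixes U :: "nat \<Rightarrow> 'a \<Rightarrow> real^'m" and V :: "nat \<Rightarrow> 'a \<Rightarrow> real^'d" and B :: "real^'d^'m"
  assumes U: "local_LDP M U J1" and V: "local_LDP M V J2"
    and prod: "\<forall>\<^sub>F n in sequentially. \<forall>A\<in>sets borel. \<forall>C\<in>sets borel.
      prob {\<omega>\<in>space M. U n \<omega> \<in> A \<and> V n \<omega> \<in> C} =
      prob {\<omega>\<in>space M. U n \<omega> \<in> A} * prob {\<omega>\<in>space M. V n \<omega> \<in> C}"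
    and lim: "Bn \<longlonglongrightarrow> B"
  shows "local_LDP M (\<lambda>n \<omega>. U n \<omega> + Bn n *v V n \<omega>)
    (\<lambda>z. INF q\<in>{q. fst q + B *v snd q = z}. J1 (fst q) + J2 (snd q))"
proof -
  define g where "g q = fst (snd q) + fst q *v snd (snd q)" for q :: "(real^'d^'m) \<times> (real^'m) \<times> (real^'d)"
  have g: "continuous_on UNIV g" unfolding g_def by (intro continuous_intros)
  have "local_LDP M (\<lambda>n \<omega>. g (Bn n, (U n \<omega>, V n \<omega>))) (\<lambda>z. INF q\<in>{q. g (B, q) = z}. J1 (fst q) + J2 (snd q))"
  proof (rule local_LDP_contraction[OF local_LDP_pair[OF U V prod], where \<Phi> = "\<lambda>n q. g (Bn n, q)"])
    show "continuous_on UNIV (\<lambda>q. g (B, q))"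
      by (intro continuous_on_compose2[OF g] continuous_intros) auto
    show "(\<lambda>q. g (Bn n, q)) \<in> borel_measurable borel" for n
      by (intro borel_measurable_continuous_onI continuous_on_compose2[OF g] continuous_intros) auto
    fix p :: "(real^'m) \<times> (real^'d)" and e :: real assume e: "0 < e"
    from g have "isCont g (B, p)" using continuous_on_eq_continuous_at[of UNIV g] by blast
    with e obtain d where d: "0 < d" "\<And>q. dist q (B, p) < d \<Longrightarrow> dist (g q) (g (B, p)) < e"
      unfolding continuous_at_eps_delta by blast
    have "\<forall>\<^sub>F n in sequentially. dist (Bn n) B < d / 2" using lim d by (intro tendstoD) auto
    then have "\<forall>\<^sub>F n in sequentially. \<forall>y\<in>ball p (d / 2). dist (g (Bn n, y)) (g (B, p)) < e"
    proof eventually_elim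
      case (elim n)
      show ?case
      proof
        fix y assume "y \<in> ball p (d / 2)"
        then have "dist y p < d / 2" by (simp add: dist_commute)
        moreover have "dist (Bn n, y) (B, p) \<le> dist (Bn n) B + dist y p"
          unfolding dist_Pair_Pair using sqrt_sum_squares_le_sum_abs[of "dist (Bn n) B" "dist y p"] by simp
        ultimately show "dist (g (Bn n, y)) (g (B, p)) < e" using elim by (intro d(2)) simp
      qed
    qed
    with d show "\<exists>d>0. \<forall>\<^sub>F n in sequentially. \<forall>y\<in>ball p d. dist (g (Bn n, y)) (g (B, p)) < e"
      by (intro exI[of _ "d / 2"]) auto
  qed
  then show ?thesis by (simp add: g_def)
qed

theorem theorem5p1:
  fixes M :: "'a measure"
    and Z :: "nat \<Rightarrow> 'a \<Rightarrow> real^'d"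
    and I :: "real^'d \<Rightarrow> ereal"
    and X :: "(real^'p) set"
    and f :: "real^'p \<Rightarrow> real^'d^'m"
    and x :: "nat \<Rightarrow> nat \<Rightarrow> real^'p"
    and R :: "(real^'p) measure"
    and T :: nat
    and idx :: "nat \<Rightarrow> nat \<Rightarrow> nat"
    and xinf :: "nat \<Rightarrow> real^'p"
  assumes M: "prob_space M"
    and iid_indep: "prob_space.indep_vars M (\<lambda>_. borel) Z {1..}"
    and iid_distr: "\<forall>i\<ge>1. distr M borel (Z i) = distr M borel (Z 1)"
    \<comment> \<open>(A1)\<close>
    and A1_exp: "\<exists>\<alpha>>0. integrable M (\<lambda>\<omega>. exp (\<alpha> * norm (Z 1 \<omega>)))"
    and A1_LDP: "satisfies_LDP M (\<lambda>n \<omega>. (1 / real n) *\<^sub>R Z 1 \<omega>) I"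
    \<comment> \<open>f continuous\<close>
    and f_cont: "continuous_on X f"
    \<comment> \<open>(A5)\<close>
    and X_lc: "locally compact X"
    and x_in: "\<forall>n. \<forall>i\<in>{1..n}. x n i \<in> X"
    and R_prob: "prob_space R"
    and R_sets: "sets R = sets (restrict_space borel X)"
    and weak_conv: "\<forall>g :: real^'p \<Rightarrow> real. continuous_on X g \<and> bounded (g ` X) \<longrightarrow>
          (\<lambda>n. (1 / real n) * (\<Sum>i=1..n. g (x n i))) \<longlonglongrightarrow> (\<integral>y. g y \<partial>R)"
    and supp_compact: "compact (measure_support R)"
    and supp_pos: "\<forall>U. openin (top_of_set (measure_support R)) U \<and> U \<noteq> {} \<longrightarrow>
          measure R U > 0"
    \<comment> \<open>(A6)\<close>
    and idx_range: "eventually (\<lambda>n. \<forall>l\<in>{1..T}. idx n l \<in> {1..n}) sequentially"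
    and idx_inj: "\<forall>n. inj_on (idx n) {1..T}"
    and A6_bulk: "\<forall>e>0. eventually (\<lambda>n. \<forall>i\<in>{1..n} - idx n ` {1..T}.
          infdist (x n i) (measure_support R) \<le> e) sequentially"
    and A6_out_lim: "\<forall>l\<in>{1..T}. (\<lambda>n. x n (idx n l)) \<longlonglongrightarrow> xinf l"
    and A6_out_notin: "\<forall>l\<in>{1..T}. xinf l \<notin> measure_support R"
    and A6_out_in: "\<forall>l\<in>{1..T}. xinf l \<in> X"
  shows "satisfies_LDP M
           (\<lambda>n \<omega>. (1 / real n) *\<^sub>R (\<Sum>i=1..n. f (x n i) *v Z i \<omega>))
           (\<lambda>z. INF p \<in> {(z0, y). z0 + (\<Sum>l=1..T. f (xinf l) *v y l) = z}.
                  convex_conjugate (Gamma_fun M (Z 1) R f) (fst p)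
                  + (\<Sum>l=1..T. I (snd p l)))"
proof -
  interpret prob_space M by (rule M)
  interpret R: prob_space R by (rule R_prob)
  let ?S = "measure_support R"
  have Zm: "Z i \<in> borel_measurable M" if "1 \<le> i" for i
    using iid_indep that by (auto simp: indep_vars_def)
  obtain \<alpha> where \<alpha>: "0 < \<alpha>" "integrable M (\<lambda>\<omega>. exp (\<alpha> * norm (Z 1 \<omega>)))" using A1_exp by blast
  obtain K0 :: nat where K0: "0 < prob {\<omega>\<in>space M. norm (Z 1 \<omega>) \<le> real K0}"
    using exists_trunc_level[OF Zm[of 1]] by auto
  have sp: "space R = X" using R_sets by (rule space_eq_of_sets_restrict_borel)
  have SX: "?S \<subseteq> X" by (auto simp: measure_support_def sp)
  have AE_S: "AE y in R. y \<in> ?S" by (rule AE_measure_support[OF R.finite_measure_axioms R_sets])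
  \<comment> \<open>\<open>infdist\<close> to the empty set is 0, so distance bounds say something
    only for a nonempty support.\<close>
  have S_ne: "?S \<noteq> {}" using AE_S R.AE_False by auto
  define A where "A n = {1..n} - idx n ` {1..T}" for n
  interpret weighted_bulk M "Z 1" K0 \<alpha> Z X f x R A
  proof (unfold_locales, goal_cases)
    case 1 show ?case using Zm[of 1] by simp
  next
    case 2 show ?case by (rule \<alpha>(1))
  next
    case 3 show ?case by (rule \<alpha>(2))
  next
    case 4 show ?case by (rule K0)
  next
    case 5 show ?case by (rule iid_indep)
  next
    case (6 i) then show ?case using iid_distr by blast
  next
    case 7 show ?case by (rule f_cont)
  next
    case 8 show ?case by (rule R_sets)
  next
    case 9 show ?case by (rule supp_compact)
  next
    case (10 n) show ?case by (auto simp: A_def)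
  next
    case (11 W)
    obtain e where e: "0 < e" "{y\<in>X. infdist y ?S \<le> e} \<subseteq> W"
      using locally_compact_neighbourhood[OF X_lc supp_compact SX S_ne 11] by blast
    from A6_bulk[rule_format, OF e(1)] show ?case
      by eventually_elim (use e(2) x_in in \<open>auto simp: A_def\<close>)
  next
    case (12 W h)
    show ?case
      unfolding A_def
      by (rule bulk_average_tendsto[OF X_lc x_in R_prob R_sets weak_conv supp_compact SX S_ne AE_S A6_bulk, where T = T])
         (use 12 card_image_le[of "{1..T}"] in auto)
  qed
  \<comment> \<open>The bulk together with the first t outliers; \<open>U t\<close> is the
    corresponding partial sum on which the induction runs.\<close>
  define B where "B t n = A n \<union> idx n ` {1..t}" for t n
  define U where "U t n \<omega> = (1 / real n) *\<^sub>R (\<Sum>i\<in>B t n. f (x n i) *v Z i \<omega>)" for t n \<omega>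
  define F where "F l y = f (xinf l) *v y" for l and y :: "real^'d"
  define J where "J = convex_conjugate (Gamma_fun M (Z 1) R f)"
  have Zldp: "local_LDP M (\<lambda>n \<omega>. (1 / real n) *\<^sub>R Z 1 \<omega>) I"
    using Zm[of 1] by (intro satisfies_LDP_imp_local_LDP A1_LDP always_eventually allI) auto
  have J0: "0 \<le> J z" for z
    unfolding J_def using good_rate_functionD(1)[OF local_LDP_good[OF bulk_local_LDP]] by simp
  have I0: "0 \<le> I y" for y
    using good_rate_functionD(1)[OF local_LDP_good[OF Zldp]] by simp
  have main: "local_LDP M (U t) (outlier_rate J I F t)" if "t \<le> T" for t
    using that
  proof (induction t)
    case 0
    have "U 0 = bulk" by (simp add: U_def B_def bulk_def fun_eq_iff)
    then show ?case using bulk_local_LDP by (simp add: outlier_rate_0 J_def)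
  next
    case (Suc t)
    define V where "V n \<omega> = (1 / real n) *\<^sub>R Z (idx n (Suc t)) \<omega>" for n \<omega>
    have tT: "Suc t \<in> {1..T}" using Suc by simp
    have fresh: "idx n (Suc t) \<notin> B t n" for n
    proof
      assume "idx n (Suc t) \<in> B t n"
      then obtain l where "l \<in> {1..t}" "idx n (Suc t) = idx n l" using tT by (auto simp: B_def A_def)
      then show False using inj_onD[OF idx_inj[rule_format, of n], of "Suc t" l] tT by auto
    qed
    have range: "\<forall>\<^sub>F n in sequentially. \<forall>l\<in>{1..T}. 1 \<le> idx n l \<and> idx n l \<le> n"
      using idx_range by eventually_elim auto
    \<comment> \<open>The index depends on n, so \<open>V\<close> is not a rescaled fixed variable;
      but for large n the index is at least 1, and the law of V n is that of \<open>Z 1\<close>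
      scaled by 1 / n.\<close>
    have V: "local_LDP M V I"
    proof (rule local_LDP_cong[OF Zldp])
      show "\<forall>\<^sub>F n in sequentially. V n \<in> borel_measurable M \<and>
        (\<forall>C\<in>sets borel. prob {\<omega>\<in>space M. V n \<omega> \<in> C} = prob {\<omega>\<in>space M. (1 / real n) *\<^sub>R Z 1 \<omega> \<in> C})"
        using range
      proof eventually_elim
        case (elim n)
        define j where "j = idx n (Suc t)"
        have j: "1 \<le> j" using elim tT by (auto simp: j_def)
        note m = Zm[OF j] Zm[OF order_refl]
        have "prob {\<omega>\<in>space M. (1 / real n) *\<^sub>R Z j \<omega> \<in> C} = prob {\<omega>\<in>space M. (1 / real n) *\<^sub>R Z 1 \<omega> \<in> C}"
          if C: "C \<in> sets borel" for C :: "(real^'d) set"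
        proof -
          define C' where "C' = (\<lambda>y::real^'d. (1 / real n) *\<^sub>R y) -` C \<inter> space borel"
          have C': "C' \<in> sets borel"
            unfolding C'_def by (rule measurable_sets[OF _ C]) simp
          have eq: "prob {\<omega>\<in>space M. (1 / real n) *\<^sub>R Z i \<omega> \<in> C} = measure (distr M borel (Z i)) C'" if "Z i \<in> borel_measurable M" for i
            unfolding measure_distr[OF that C'] by (auto simp: C'_def intro!: arg_cong[where f = prob])
          show ?thesis unfolding eq[OF m(1)] eq[OF m(2)] iid_distr[rule_format, OF j] ..
        qed
        moreover have "V n \<in> borel_measurable M"
          unfolding V_def[abs_def] j_def[symmetric] using m(1) by (intro borel_measurable_scaleR) auto
        ultimately show ?case by (simp add: V_def j_def)
      qed
    qed
    have prod: "\<forall>\<^sub>F n in sequentially. \<forall>D\<in>sets borel. \<forall>C\<in>sets borel.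
      prob {\<omega>\<in>space M. U t n \<omega> \<in> D \<and> V n \<omega> \<in> C} =
      prob {\<omega>\<in>space M. U t n \<omega> \<in> D} * prob {\<omega>\<in>space M. V n \<omega> \<in> C}"
      using range
    proof eventually_elim
      case (elim n)
      have "B t n \<subseteq> {1..}" using elim Suc.prems by (fastforce simp: B_def A_def)
      moreover have "idx n (Suc t) \<in> {1..}" using elim tT by auto
      ultimately show ?case
        unfolding U_def V_def using fresh by (intro ballI indep_vars_prob_sum_prod[OF iid_indep])
    qed
    have lim: "(\<lambda>n. f (x n (idx n (Suc t)))) \<longlonglongrightarrow> f (xinf (Suc t))"
    proof (rule continuous_on_tendsto_compose[OF f_cont])
      show "(\<lambda>n. x n (idx n (Suc t))) \<longlonglongrightarrow> xinf (Suc t)" "xinf (Suc t) \<in> X"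
        using A6_out_lim A6_out_in tT by auto
      show "\<forall>\<^sub>F n in sequentially. x n (idx n (Suc t)) \<in> X"
        using range by eventually_elim (use x_in tT in auto)
    qed
    have IH: "local_LDP M (U t) (outlier_rate J I F t)" using Suc by simp
    from local_LDP_add_outlier[OF IH V prod lim]
    have "local_LDP M (\<lambda>n \<omega>. U t n \<omega> + f (x n (idx n (Suc t))) *v V n \<omega>)
      (\<lambda>z. INF q\<in>{q. fst q + F (Suc t) (snd q) = z}. outlier_rate J I F t (fst q) + I (snd q))"
      by (simp add: F_def)
    moreover have "(\<lambda>z. INF q\<in>{q. fst q + F (Suc t) (snd q) = z}. outlier_rate J I F t (fst q) + I (snd q))
        = outlier_rate J I F (Suc t)"
      by (rule ext) (rule outlier_rate_Suc[OF J0 I0])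
    ultimately have L: "local_LDP M (\<lambda>n \<omega>. U t n \<omega> + f (x n (idx n (Suc t))) *v V n \<omega>) (outlier_rate J I F (Suc t))"
      by simp
    show ?case
    proof (rule local_LDP_cong[OF L])
      from local_LDP_measurable[OF L] range
      show "\<forall>\<^sub>F n in sequentially. U (Suc t) n \<in> borel_measurable M \<and>
        (\<forall>C\<in>sets borel. prob {\<omega>\<in>space M. U (Suc t) n \<omega> \<in> C} = prob {\<omega>\<in>space M. U t n \<omega> + f (x n (idx n (Suc t))) *v V n \<omega> \<in> C})"
      proof eventually_elim
        case (elim n)
        note fresh[of n]
        moreover have "B (Suc t) n = insert (idx n (Suc t)) (B t n)"
          by (auto simp: B_def atLeastAtMostSuc_conv)
        moreover have "finite (B t n)" by (simp add: B_def A_def)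
        ultimately have "U (Suc t) n \<omega> = U t n \<omega> + f (x n (idx n (Suc t))) *v V n \<omega>" for \<omega>
          by (simp add: U_def V_def scaleR_add_right matrix_vector_mult_scaleR scaleR_matrix_vector_assoc add.commute)
        then have "U (Suc t) n = (\<lambda>\<omega>. U t n \<omega> + f (x n (idx n (Suc t))) *v V n \<omega>)" by blast
        with elim show ?case by simp
      qed
    qed
  qed
  have "local_LDP M (\<lambda>n \<omega>. (1 / real n) *\<^sub>R (\<Sum>i=1..n. f (x n i) *v Z i \<omega>)) (outlier_rate J I F T)"
  proof (rule local_LDP_cong[OF main[OF order_refl]])
    from local_LDP_measurable[OF main[OF order_refl]] idx_range
    show "\<forall>\<^sub>F n in sequentially. (\<lambda>\<omega>. (1 / real n) *\<^sub>R (\<Sum>i=1..n. f (x n i) *v Z i \<omega>)) \<in> borel_measurable M \<and>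
      (\<forall>C\<in>sets borel. prob {\<omega>\<in>space M. (1 / real n) *\<^sub>R (\<Sum>i=1..n. f (x n i) *v Z i \<omega>) \<in> C} = prob {\<omega>\<in>space M. U T n \<omega> \<in> C})"
    proof eventually_elim
      case (elim n)
      \<comment> \<open>Once all outlier indices are in range, adding them back restores the full
        index set.\<close>
      have "B T n = {1..n}" using elim(2) by (auto simp: B_def A_def)
      then have "(\<lambda>\<omega>. (1 / real n) *\<^sub>R (\<Sum>i=1..n. f (x n i) *v Z i \<omega>)) = U T n" by (simp add: U_def fun_eq_iff)
      with elim show ?case by (simp add: fun_eq_iff)
    qed
  qed
  then have "satisfies_LDP M (\<lambda>n \<omega>. (1 / real n) *\<^sub>R (\<Sum>i=1..n. f (x n i) *v Z i \<omega>)) (outlier_rate J I F T)"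
    by (rule local_LDP_imp_satisfies_LDP)
  then show ?thesis unfolding outlier_rate_def[abs_def] J_def F_def .
qed

end
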